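(* There is a constant $C_b>0$ such that $$|\widetilde a_h(\mathbf{E},\mathbf{v})|\le C_b\,\|\mathbf{E}\|_h\,\|\mathbf{v}\|_h\qquad\forall\,\mathbf{E},\mathbf{v}\in\mathbf{V}(h).$$
   Context: **Domain and data.** $\Omega\subset\mathbb{R}^3$ is a bounded domain with Lipschitz continuous boundary and unit outward normal $\mathbf{n}$. Bold letters denote $\mathbb{R}^3$-valued fields and spaces of such fields. $\mathbf{H}_0(\mathrm{curl},\Omega)=\{\mathbf{v}\in\mathbf{L}^2(\Omega):\nabla\times\mathbf{v}\in\mathbf{L}^2(\Omega),\ \mathbf{n}\times\mathbf{v}=\mathbf{0}\text{ on }\partial\Omega\}$. The scalar coefficients $\epsilon,\mu\in L^\infty(\Omega)$ satisfy $0<\epsilon_0\le\epsilon(x)\le\epsilon_1<\infty$ and $0<\mu_0\le\mu(x)\le\mu_1<\infty$ for a.e. $x\in\Omega$, with constants $\epsilon_0,\epsilon_1,\mu_0,\mu_1$. **Mesh and DG notation.** $\mathcal{T}_h$ is a shape-regular partition of $\overline\Omega$ into tetrahedral or hexahedral elements $K$ with diameters $h_K$, and $h=\max_{K\in\mathcal{T}_h}h_K$. $\mathcal{F}_h^{\mathcal I}$ and $\mathcal{F}_h^{\mathcal B}$ are the sets of interior and boundary faces, and $\mathcal{F}_h=\mathcal{F}_h^{\mathcal I}\cup\mathcal{F}_h^{\mathcal B}$. On an interior face $f$ shared by $K_1,K_2$, with outward unit normals $\mathbf{n}_1,\mathbf{n}_2$ and traces $\mathbf{v}_1,\mathbf{v}_2$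 of $\mathbf{v}$ taken from $K_1,K_2$, the tangential jump and average are $[\![\mathbf{v}]\!]=\mathbf{n}_1\times\mathbf{v}_1+\mathbf{n}_2\times\mathbf{v}_2$ and $\{\mathbf{v}\}=(\mathbf{v}_1+\mathbf{v}_2)/2$; on a boundary face $[\![\mathbf{v}]\!]=\mathbf{n}\times\mathbf{v}$ and $\{\mathbf{v}\}=\mathbf{v}$. For a positive integer $l$, $\mathbf{V}_h=\{\mathbf{v}\in\mathbf{L}^2(\Omega):\mathbf{v}|_K\in[P^l(K)]^3\ \forall K\in\mathcal{T}_h\}$, where $P^l(K)$ is the space of polynomials of degree at most $l$ on $K$; $\nabla_h\times$ is the elementwise curl. Set $h_f=\min\{h_K,h_{K'}\}$ for an interior face $f=\partial K\cap\partial K'$, $h_f=h_K$ for a boundary face $f=\partial K\cap\partial\Omega$, and $\alpha|_f=\eta h_f^{-1}$ with a constant $\eta>0$. **The space $\mathbf{V}(h)$.** $\mathbf{V}(h)=\mathbf{H}_0(\mathrm{curl},\Omega)+\mathbf{V}_h$. Tangential jumps of elements of $\mathbf{H}_0(\mathrm{curl},\Omega)$ vanish on $\mathcal{F}_h$. The seminorm and norm on $\mathbf{V}(h)$ are $$|\mathbf{v}|_h^2=\sum_{K\in\mathcal{T}_h}\|\nabla_h\times\mathbf{v}\|_{0,K}^2+\sum_{f\in\mathcal{F}_h}\|\alpha^{1/2}[\![\mathbf{v}]\!]\|_{0,f}^2,\qquad\|\mathbf{v}\|_h^2=\|\mathbf{v}\|_{0,\Omega}^2+|\mathbf{v}|_h^2,$$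 where $\|\cdot\|_{0,D}$ is the $L^2(D)$ norm. **The form $\widetilde a_h$.** With $\boldsymbol{\Pi}_h$ the $L^2$-projection from $\mathbf{L}^2(\Omega)$ onto $\mathbf{V}_h$, for $\mathbf{E},\mathbf{v}\in\mathbf{V}(h)$, $$\begin{aligned}\widetilde a_h(\mathbf{E},\mathbf{v})=&\int_\Omega\epsilon\,\mathbf{E}\cdot\mathbf{v}\,dx+\sum_{K\in\mathcal{T}_h}\int_K\mu^{-1}(\nabla_h\times\mathbf{E})\cdot(\nabla_h\times\mathbf{v})\,dx-\sum_{f\in\mathcal{F}_h}\int_f[\![\mathbf{E}]\!]\cdot\{\mu^{-1}\boldsymbol{\Pi}_h(\nabla_h\times\mathbf{v})\}\,dS\\&-\sum_{f\in\mathcal{F}_h}\int_f[\![\mathbf{v}]\!]\cdot\{\mu^{-1}\boldsymbol{\Pi}_h(\nabla_h\times\mathbf{E})\}\,dS+\sum_{f\in\mathcal{F}_h}\int_f\alpha[\![\mathbf{E}]\!]\cdot[\![\mathbf{v}]\!]\,dS.\end{aligned}$$ *)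

theory Defs
  imports "HOL-Analysis.Analysis"
begin

type_synonym field3 = "real^3 \<Rightarrow> real^3"

section \<open>Domain and coefficients\<close>

text \<open>
  The boundary is locally the graph of a Lipschitz function in the direction \<open>e\<close>, with the domain
  on one side of it. The graph function is defined on the whole space but does not depend on the
  \<open>e\<close>-coordinate, so it is a function on the plane orthogonal to \<open>e\<close>.
\<close>

definition lipschitz_domain :: "(real^3) set \<Rightarrow> bool" where
  "lipschitz_domain \<Omega> \<longleftrightarrow>
     open \<Omega> \<and> connected \<Omega> \<and> bounded \<Omega> \<and> \<Omega> \<noteq> {} \<and>
     (\<forall>p\<in>frontier \<Omega>. \<exists>e r L (g :: real^3 \<Rightarrow> real).
        norm e = 1 \<and> 0 < r \<and> L-lipschitz_on UNIV g \<and> (\<forall>x t. g (x + t *\<^sub>R e) = g x) \<and>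
        (\<forall>x\<in>ball p r. x \<in> \<Omega> \<longleftrightarrow> x \<bullet> e < g x))"

definition bounded_coefficient :: "(real^3) set \<Rightarrow> (real^3 \<Rightarrow> real) \<Rightarrow> real \<Rightarrow> real \<Rightarrow> bool" where
  "bounded_coefficient \<Omega> c c0 c1 \<longleftrightarrow>
     c \<in> borel_measurable (lebesgue_on \<Omega>) \<and> 0 < c0 \<and>
     (AE x in lebesgue_on \<Omega>. c0 \<le> c x \<and> c x \<le> c1)"

section \<open>Weak curl and \<open>H_0(curl)\<close>\<close>

definition L2_field :: "(real^3) set \<Rightarrow> field3 \<Rightarrow> bool" where
  "L2_field D v \<longleftrightarrow>
     v \<in> borel_measurable (lebesgue_on D) \<and> integrable (lebesgue_on D) (\<lambda>x. (norm (v x))\<^sup>2)"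

definition L2_norm :: "(real^3) set \<Rightarrow> field3 \<Rightarrow> real" where
  "L2_norm D v = sqrt (integral\<^sup>L (lebesgue_on D) (\<lambda>x. (norm (v x))\<^sup>2))"

definition partial :: "3 \<Rightarrow> (real^3 \<Rightarrow> real) \<Rightarrow> real^3 \<Rightarrow> real" where
  "partial i f x = frechet_derivative f (at x) (axis i 1)"

primrec C_k :: "nat \<Rightarrow> (real^3 \<Rightarrow> real) \<Rightarrow> bool" where
  "C_k 0 f \<longleftrightarrow> continuous_on UNIV f"
| "C_k (Suc k) f \<longleftrightarrow> (\<forall>x. f differentiable (at x)) \<and> (\<forall>i. C_k k (partial i f))"

definition smooth_field :: "field3 \<Rightarrow> bool" where
  "smooth_field \<phi> \<longleftrightarrow> (\<forall>k i. C_k k (\<lambda>x. \<phi> x $ i))"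

definition curl :: "field3 \<Rightarrow> field3" where
  "curl \<phi> x = (let d = (\<lambda>i j. partial i (\<lambda>y. \<phi> y $ j) x) in
     vector [d 2 3 - d 3 2, d 3 1 - d 1 3, d 1 2 - d 2 1])"

definition has_weak_curl :: "(real^3) set \<Rightarrow> field3 \<Rightarrow> field3 \<Rightarrow> bool" where
  "has_weak_curl U v w \<longleftrightarrow>
     (\<forall>\<phi>. smooth_field \<phi> \<and> compact (closure {x. \<phi> x \<noteq> 0}) \<and> closure {x. \<phi> x \<noteq> 0} \<subseteq> U \<longrightarrow>
        integral\<^sup>L (lebesgue_on U) (\<lambda>x. v x \<bullet> curl \<phi> x) =
        integral\<^sup>L (lebesgue_on U) (\<lambda>x. w x \<bullet> \<phi> x))"

text \<open>
  The tangential trace of \<open>v\<close> with weak curl \<open>w\<close> is the functional on fields that are smooth up to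
  the boundary, given by Green's formula: it is formally the integral of \<open>(n \<times> v) \<bullet> \<phi>\<close> over
  the boundary.
\<close>

definition tangential_trace :: "(real^3) set \<Rightarrow> field3 \<Rightarrow> field3 \<Rightarrow> field3 \<Rightarrow> real" where
  "tangential_trace \<Omega> v w \<phi> = integral\<^sup>L (lebesgue_on \<Omega>) (\<lambda>x. w x \<bullet> \<phi> x - v x \<bullet> curl \<phi> x)"

definition H0_curl :: "(real^3) set \<Rightarrow> field3 set" where
  "H0_curl \<Omega> = {v. L2_field \<Omega> v \<and>
     (\<exists>w. L2_field \<Omega> w \<and> has_weak_curl \<Omega> v w \<and>
        (\<forall>\<phi>. smooth_field \<phi> \<longrightarrow> tangential_trace \<Omega> v w \<phi> = 0))}"

section \<open>Meshes\<close>

definition tetrahedron :: "(real^3) set \<Rightarrow> bool" where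
  "tetrahedron K \<longleftrightarrow> 3 simplex K"

text \<open>A convex polyhedron with six faces, all of them quadrilaterals, is combinatorially a cube.\<close>

definition hexahedron :: "(real^3) set \<Rightarrow> bool" where
  "hexahedron K \<longleftrightarrow> polytope K \<and> aff_dim K = 3 \<and> card {F. F facet_of K} = 6 \<and>
     (\<forall>F. F facet_of K \<longrightarrow> card {x. x extreme_point_of F} = 4)"

text \<open>
  Elements are closed sets. Hanging nodes are allowed. In the last clause, \<open>\<rho>\<close> is the
  diameter of a ball contained in the element.
\<close>

definition shape_regular_partition :: "real \<Rightarrow> (real^3) set \<Rightarrow> (real^3) set set \<Rightarrow> bool" where
  "shape_regular_partition \<sigma> \<Omega> \<T> \<longleftrightarrow>
     finite \<T> \<and> \<Union>\<T> = closure \<Omega> \<and>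
     (\<forall>K\<in>\<T>. tetrahedron K \<or> hexahedron K) \<and>
     (\<forall>K\<in>\<T>. \<forall>K'\<in>\<T>. K \<noteq> K' \<longrightarrow> interior K \<inter> interior K' = {}) \<and>
     (\<forall>K\<in>\<T>. \<exists>c \<rho>. 0 < \<rho> \<and> ball c (\<rho> / 2) \<subseteq> K \<and> diameter K \<le> \<sigma> * \<rho>)"

text \<open>
  Surface measure on the plane spanned by \<open>f\<close>: the area of a planar set is the volume of the right
  prism of height 1 having that set as its mid-section.
\<close>

definition area_measure :: "(real^3) set \<Rightarrow> (real^3) measure" where
  "area_measure f =
     distr (restrict_space lborel {x. infdist x (affine hull f) \<le> 1 / 2}) borel
       (closest_point (affine hull f))"

definition face_integral :: "(real^3) set \<Rightarrow> (real^3 \<Rightarrow> real) \<Rightarrow> real" where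
  "face_integral f g = set_lebesgue_integral (area_measure f) f g"

definition face_norm :: "(real^3) set \<Rightarrow> field3 \<Rightarrow> real" where
  "face_norm f v = sqrt (face_integral f (\<lambda>x. (norm (v x))\<^sup>2))"

definition interior_faces :: "(real^3) set set \<Rightarrow> (real^3) set set" where
  "interior_faces \<T> = {K \<inter> K' | K K'. K \<in> \<T> \<and> K' \<in> \<T> \<and> K \<noteq> K' \<and> aff_dim (K \<inter> K') = 2}"

definition boundary_faces :: "(real^3) set \<Rightarrow> (real^3) set set \<Rightarrow> (real^3) set set" where
  "boundary_faces \<Omega> \<T> = {F \<inter> frontier \<Omega> | F K. K \<in> \<T> \<and> F facet_of K \<and>
     0 < emeasure (area_measure F) (F \<inter> frontier \<Omega>)}"

definition faces :: "(real^3) set \<Rightarrow> (real^3) set set \<Rightarrow> (real^3) set set" where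
  "faces \<Omega> \<T> = interior_faces \<T> \<union> boundary_faces \<Omega> \<T>"

text \<open>
  The elements adjacent to a face: two for an interior face, one for a boundary face. Sums and means
  over this set give the jumps, averages and the local mesh size in both cases at once.
\<close>

definition adjacent :: "(real^3) set set \<Rightarrow> (real^3) set \<Rightarrow> (real^3) set set" where
  "adjacent \<T> f = {K\<in>\<T>. f \<subseteq> K}"

definition face_size :: "(real^3) set set \<Rightarrow> (real^3) set \<Rightarrow> real" where
  "face_size \<T> f = Min (diameter ` adjacent \<T> f)"

definition outward_normal :: "(real^3) set \<Rightarrow> (real^3) set \<Rightarrow> real^3" where
  "outward_normal K f = (THE n. norm n = 1 \<and> (\<forall>x\<in>K. \<forall>y\<in>f. n \<bullet> x \<le> n \<bullet> y))"

section \<open>Traces, jumps and averages\<close>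

text \<open>
  The trace on the boundary of \<open>K\<close> of a function given almost everywhere in \<open>K\<close> is the limit of its
  means over \<open>K \<inter> ball x r\<close>. For a function that is continuous up to the boundary it is the
  boundary value. The upper limit makes the trace total: a coefficient that is merely bounded and
  measurable need not have a limit at the points of a face.
\<close>

definition local_mean :: "(real^3) set \<Rightarrow> (real^3 \<Rightarrow> real) \<Rightarrow> real^3 \<Rightarrow> real \<Rightarrow> real" where
  "local_mean K g x r =
     integral\<^sup>L (lebesgue_on (K \<inter> ball x r)) g / measure lebesgue (K \<inter> ball x r)"

definition scalar_trace :: "(real^3) set \<Rightarrow> (real^3 \<Rightarrow> real) \<Rightarrow> real^3 \<Rightarrow> real" where
  "scalar_trace K g x = real_of_ereal (Limsup (at_right 0) (\<lambda>r. ereal (local_mean K g x r)))"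

definition field_trace :: "(real^3) set \<Rightarrow> field3 \<Rightarrow> field3" where
  "field_trace K v x = (\<chi> i. scalar_trace K (\<lambda>y. v y $ i) x)"

definition tangential_jump :: "(real^3) set set \<Rightarrow> (real^3) set \<Rightarrow> field3 \<Rightarrow> field3" where
  "tangential_jump \<T> f v x =
     (\<Sum>K\<in>adjacent \<T> f. cross3 (outward_normal K f) (field_trace K v x))"

definition average :: "(real^3) set set \<Rightarrow> (real^3) set \<Rightarrow> field3 \<Rightarrow> field3" where
  "average \<T> f v x = (\<Sum>K\<in>adjacent \<T> f. field_trace K v x) /\<^sub>R real (card (adjacent \<T> f))"

section \<open>Discrete spaces\<close>

definition poly_le :: "nat \<Rightarrow> (real^3 \<Rightarrow> real) \<Rightarrow> bool" where
  "poly_le l p \<longleftrightarrow> (\<exists>c :: (3 \<Rightarrow> nat) \<Rightarrow> real.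
     \<forall>x. p x = (\<Sum>a | (\<Sum>i\<in>UNIV. a i) \<le> l. c a * (\<Prod>i\<in>UNIV. (x $ i) ^ a i)))"

definition dg_space :: "(real^3) set \<Rightarrow> (real^3) set set \<Rightarrow> nat \<Rightarrow> field3 set" where
  "dg_space \<Omega> \<T> l = {v. L2_field \<Omega> v \<and>
     (\<forall>K\<in>\<T>. \<exists>p. (\<forall>i. poly_le l (\<lambda>x. p x $ i)) \<and> (AE x in lebesgue_on K. v x = p x))}"

definition sum_space :: "(real^3) set \<Rightarrow> (real^3) set set \<Rightarrow> nat \<Rightarrow> field3 set" where
  "sum_space \<Omega> \<T> l = {(\<lambda>x. v x + w x) | v w. v \<in> H0_curl \<Omega> \<and> w \<in> dg_space \<Omega> \<T> l}"

text \<open>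
  The elementwise curl and the \<open>L\<^sup>2\<close>-projection are unique only up to null sets, hence the choice of
  a representative.
\<close>

definition elementwise_curl :: "(real^3) set \<Rightarrow> (real^3) set set \<Rightarrow> field3 \<Rightarrow> field3" where
  "elementwise_curl \<Omega> \<T> v = (SOME w. L2_field \<Omega> w \<and> (\<forall>K\<in>\<T>. has_weak_curl (interior K) v w))"

definition L2_projection :: "(real^3) set \<Rightarrow> (real^3) set set \<Rightarrow> nat \<Rightarrow> field3 \<Rightarrow> field3" where
  "L2_projection \<Omega> \<T> l w = (SOME q. q \<in> dg_space \<Omega> \<T> l \<and>
     (\<forall>\<phi>\<in>dg_space \<Omega> \<T> l. integral\<^sup>L (lebesgue_on \<Omega>) (\<lambda>x. (w x - q x) \<bullet> \<phi> x) = 0))"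

text \<open>
  An element of \<open>H_0(curl)\<close> has no pointwise tangential trace; its tangential jumps are zero. The jump
  of \<open>v\<close> in the sum space is therefore the jump of its piecewise polynomial part. Two such parts
  of the same \<open>v\<close> differ by an element of \<open>H_0(curl)\<close>, so up to null sets the jump does not
  depend on the choice.
\<close>

definition dg_part :: "(real^3) set \<Rightarrow> (real^3) set set \<Rightarrow> nat \<Rightarrow> field3 \<Rightarrow> field3" where
  "dg_part \<Omega> \<T> l v = (SOME w. w \<in> dg_space \<Omega> \<T> l \<and> (\<lambda>x. v x - w x) \<in> H0_curl \<Omega>)"

definition jump :: "(real^3) set \<Rightarrow> (real^3) set set \<Rightarrow> nat \<Rightarrow> (real^3) set \<Rightarrow> field3 \<Rightarrow> field3" where
  "jump \<Omega> \<T> l f v = tangential_jump \<T> f (dg_part \<Omega> \<T> l v)"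

section \<open>Norm and bilinear form\<close>

definition penalty :: "(real^3) set set \<Rightarrow> real \<Rightarrow> (real^3) set \<Rightarrow> real" where
  "penalty \<T> \<eta> f = \<eta> / face_size \<T> f"

definition dg_seminorm :: "(real^3) set \<Rightarrow> (real^3) set set \<Rightarrow> nat \<Rightarrow> real \<Rightarrow> field3 \<Rightarrow> real" where
  "dg_seminorm \<Omega> \<T> l \<eta> v = sqrt (
     (\<Sum>K\<in>\<T>. (L2_norm K (elementwise_curl \<Omega> \<T> v))\<^sup>2) +
     (\<Sum>f\<in>faces \<Omega> \<T>. (face_norm f (\<lambda>x. sqrt (penalty \<T> \<eta> f) *\<^sub>R jump \<Omega> \<T> l f v x))\<^sup>2))"

definition dg_norm :: "(real^3) set \<Rightarrow> (real^3) set set \<Rightarrow> nat \<Rightarrow> real \<Rightarrow> field3 \<Rightarrow> real" where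
  "dg_norm \<Omega> \<T> l \<eta> v = sqrt ((L2_norm \<Omega> v)\<^sup>2 + (dg_seminorm \<Omega> \<T> l \<eta> v)\<^sup>2)"

definition dg_flux ::
  "(real^3) set \<Rightarrow> (real^3) set set \<Rightarrow> nat \<Rightarrow> (real^3 \<Rightarrow> real) \<Rightarrow> (real^3) set \<Rightarrow> field3 \<Rightarrow> field3" where
  "dg_flux \<Omega> \<T> l \<mu> f v =
     average \<T> f (\<lambda>x. L2_projection \<Omega> \<T> l (elementwise_curl \<Omega> \<T> v) x /\<^sub>R \<mu> x)"

definition dg_form ::
  "(real^3) set \<Rightarrow> (real^3) set set \<Rightarrow> nat \<Rightarrow> real \<Rightarrow> (real^3 \<Rightarrow> real) \<Rightarrow> (real^3 \<Rightarrow> real)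
     \<Rightarrow> field3 \<Rightarrow> field3 \<Rightarrow> real" where
  "dg_form \<Omega> \<T> l \<eta> \<epsilon> \<mu> E v =
     integral\<^sup>L (lebesgue_on \<Omega>) (\<lambda>x. \<epsilon> x * (E x \<bullet> v x))
     + (\<Sum>K\<in>\<T>. integral\<^sup>L (lebesgue_on K)
          (\<lambda>x. inverse (\<mu> x) * (elementwise_curl \<Omega> \<T> E x \<bullet> elementwise_curl \<Omega> \<T> v x)))
     - (\<Sum>f\<in>faces \<Omega> \<T>. face_integral f (\<lambda>x. jump \<Omega> \<T> l f E x \<bullet> dg_flux \<Omega> \<T> l \<mu> f v x))
     - (\<Sum>f\<in>faces \<Omega> \<T>. face_integral f (\<lambda>x. jump \<Omega> \<T> l f v x \<bullet> dg_flux \<Omega> \<T> l \<mu> f E x))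
     + (\<Sum>f\<in>faces \<Omega> \<T>. face_integral f
          (\<lambda>x. penalty \<T> \<eta> f * (jump \<Omega> \<T> l f E x \<bullet> jump \<Omega> \<T> l f v x)))"

end

theory Submission
  imports Defs "HOL-Computational_Algebra.Polynomial"
begin

text \<open>
  Three of the five terms of the form are bounded by the Cauchy-Schwarz inequality alone: the mass
  term, the curl term and the penalty term are products of quantities that occur in the norm, up to
  the bounds on the coefficients. The substance is in the two flux terms, in which a jump is
  integrated over a face against the average of \<open>\<mu>\<^sup>-\<^sup>1 q\<close>, where the piecewise polynomial field \<open>q\<close> is the
  \<open>L\<^sup>2\<close>-projection of the elementwise curl. With the weight \<open>\<alpha>\<close> distributed as \<open>\<alpha>\<^sup>1\<^sup>/\<^sup>2\<close> on the jump and
  \<open>\<alpha>\<^sup>-\<^sup>1\<^sup>/\<^sup>2\<close> on the flux, the jump factor is part of the norm, and the flux factor is bounded in three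
  steps. On a face, the trace of \<open>\<mu>\<^sup>-\<^sup>1 q\<close>, an upper limit of local means, is dominated by \<open>\<bar>q\<bar>\<close> divided
  by the lower bound of \<open>\<mu>\<close> (\<open>norm_field_trace_weighted_le\<close>). The discrete trace inequality
  \<open>sum_face_integrals_le\<close> bounds \<open>h\<^sub>K\<close> times the sum of the integrals of \<open>\<bar>q\<bar>\<^sup>2\<close> over all faces in an
  element \<open>K\<close> by a multiple of the integral of \<open>\<bar>q\<bar>\<^sup>2\<close> over \<open>K\<close>, the factor depending only on the degree
  and on the shape regularity. Finally the \<open>L\<^sup>2\<close>-projection does not increase the \<open>L\<^sup>2\<close>-norm.

  For the trace inequality, let \<open>c\<close> be the centre of the ball inscribed in \<open>K\<close> and \<open>f\<close> a face. A
  polynomial of degree at most \<open>l\<close> on a segment is bounded at the end point by its values at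
  \<open>l + 1\<close> further equidistant points, uniformly in the step (\<open>poly_extrapolation\<close>). Since the surface
  integral over \<open>f\<close> is a volume integral over the prism of height 1 over \<open>f\<close>, the normal coordinate
  of the prism is available as the step size: each sample point then maps the prism
  injectively into the cone with apex \<open>c\<close> over \<open>f\<close>, with Jacobian at least a multiple of the
  distance of \<open>c\<close> from the plane of \<open>f\<close>. The change of variables formula turns this into a bound for the
  integral over \<open>f\<close> by the integral over the cone (\<open>polynomial_trace_inequality\<close>). The distance is at least the
  radius of the inscribed ball. It remains that the cones over the faces in \<open>K\<close> overlap boundedly
  often. As hanging nodes are allowed, a face need not be a facet of \<open>K\<close>; what is used instead is
  that three distinct elements, and also two distinct facets of one element, meet in a set of
  dimension at most one (\<open>three_elements_meet_in_line\<close>, \<open>distinct_facets_meet_in_line\<close>).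

  The elementwise curl and the projection are chosen by a description, so suitable candidates have to
  exist: classical curls of the polynomial pieces, by partial integration, and a projection obtained by
  orthogonalisation. A further point is that an integral is zero when the integrand is not integrable;
  the jumps are therefore shown to be restrictions of continuous fields, so that the face norms have
  their intended meaning.
\<close>

section \<open>Polynomials along lines\<close>

lemma degree_forward_difference:
  fixes P :: "real poly"
  assumes "degree P \<le> Suc l"
  shows "degree (pcompose P [:d, 1:] - P) \<le> l"
proof (cases "degree P = 0")
  case True
  then obtain c where "P = [:c:]" using degree_eq_zeroE by blast
  then show ?thesis by simp
next
  case False
  have e: "degree (pcompose P [:d, 1:]) = degree P" by (simp add: degree_pcompose)
  have "coeff (pcompose P [:d, 1:]) (degree P) = coeff P (degree P)"
    using lead_coeff_comp[of "[:d,1:]" P] e by simp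
  then have z: "coeff (pcompose P [:d, 1:] - P) (degree P) = 0" by simp
  have le: "degree (pcompose P [:d, 1:] - P) \<le> degree P"
    by (rule degree_diff_le) (simp_all add: e)
  have "degree (pcompose P [:d, 1:] - P) \<noteq> degree P"
  proof
    assume d: "degree (pcompose P [:d, 1:] - P) = degree P"
    then have "lead_coeff (pcompose P [:d, 1:] - P) = 0" using z by simp
    then have "pcompose P [:d, 1:] - P = 0" by (simp only: leading_coeff_0_iff)
    with d False show False by simp
  qed
  with le show ?thesis using assms by linarith
qed

text \<open>
  Induction on the degree: the forward difference of \<open>P\<close> has smaller degree, and
  \<open>P a\<close> is \<open>P (a + d)\<close> minus that difference. The factor is independent of the step \<open>d\<close>, which allows a
  step that varies with the point at which the inequality is used.
\<close>

lemma poly_extrapolation: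
  fixes P :: "real poly"
  assumes "degree P \<le> l"
  shows "\<bar>poly P a\<bar> \<le> 3 ^ l * (\<Sum>j=1..Suc l. \<bar>poly P (a + real j * d)\<bar>)"
  using assms
proof (induction l arbitrary: P)
  case 0
  then obtain c where "P = [:c:]" using degree_eq_zeroE by blast
  then show ?case by simp
next
  case (Suc l)
  define Q where "Q = pcompose P [:d, 1:] - P"
  have Q: "poly Q x = poly P (x + d) - poly P x" for x
    by (simp add: Q_def poly_pcompose add.commute)
  let ?p = "\<lambda>j::nat. \<bar>poly P (a + real j * d)\<bar>"
  have "(\<Sum>j=1..Suc l. \<bar>poly Q (a + real j * d)\<bar>) \<le> (\<Sum>j=1..Suc l. ?p (Suc j) + ?p j)"
    by (intro sum_mono) (auto simp: Q algebra_simps intro: order_trans[OF abs_triangle_ineq4])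
  also have "\<dots> = (\<Sum>j=Suc 1..Suc (Suc l). ?p j) + (\<Sum>j=1..Suc l. ?p j)"
    by (simp only: sum.distrib sum.shift_bounds_cl_Suc_ivl)
  also have "\<dots> \<le> (\<Sum>j=1..Suc (Suc l). ?p j) + (\<Sum>j=1..Suc (Suc l). ?p j)"
    by (intro add_mono sum_mono2) auto
  finally have s: "(\<Sum>j=1..Suc l. \<bar>poly Q (a + real j * d)\<bar>) \<le> 2 * (\<Sum>j=1..Suc (Suc l). ?p j)"
    by simp
  define S where "S = (\<Sum>j=1..Suc (Suc l). ?p j)"
  have p1: "?p 1 \<le> S" unfolding S_def by (rule member_le_sum) auto
  have "\<bar>poly P a\<bar> \<le> ?p 1 + \<bar>poly Q a\<bar>" by (simp add: Q)
  also have "\<bar>poly Q a\<bar> \<le> 3 ^ l * (\<Sum>j=1..Suc l. \<bar>poly Q (a + real j * d)\<bar>)"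
    by (rule Suc.IH) (simp add: Q_def degree_forward_difference Suc.prems)
  also have "\<dots> \<le> 3 ^ l * (2 * S)"
    using s unfolding S_def by (intro mult_left_mono) auto
  finally have "\<bar>poly P a\<bar> \<le> S + 3 ^ l * (2 * S)" using p1 by linarith
  moreover have "S \<le> 3 ^ l * S"
    using mult_right_mono[of 1 "3 ^ l" S] by (simp add: S_def sum_nonneg)
  ultimately have "\<bar>poly P a\<bar> \<le> 3 ^ Suc l * S" by simp
  then show ?case unfolding S_def .
qed

lemma finite_multi_indices: "finite {a :: 3 \<Rightarrow> nat. (\<Sum>i\<in>UNIV. a i) \<le> l}"
proof (rule finite_subset)
  show "{a :: 3 \<Rightarrow> nat. (\<Sum>i\<in>UNIV. a i) \<le> l} \<subseteq> (UNIV \<rightarrow>\<^sub>E {..l})"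
  proof clarify
    fix a :: "3 \<Rightarrow> nat" assume "(\<Sum>i\<in>UNIV. a i) \<le> l"
    moreover have "a i \<le> (\<Sum>i\<in>UNIV. a i)" for i by (rule member_le_sum) auto
    ultimately have "a i \<le> l" for i using order_trans by blast
    then show "a \<in> (UNIV \<rightarrow>\<^sub>E {..l})" by (auto simp: PiE_def)
  qed
qed (simp add: finite_PiE)

lemma poly_le_on_line:
  assumes "poly_le l p"
  shows "\<exists>P. degree P \<le> l \<and> (\<forall>t. p (c + t *\<^sub>R u) = poly P t)"
proof -
  obtain k :: "(3 \<Rightarrow> nat) \<Rightarrow> real" where
    k: "\<And>x. p x = (\<Sum>a | (\<Sum>i\<in>UNIV. a i) \<le> l. k a * (\<Prod>i\<in>UNIV. (x $ i) ^ a i))"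
    using assms by (auto simp: poly_le_def)
  define P where "P = (\<Sum>a | (\<Sum>i\<in>UNIV. a i) \<le> l. smult (k a) (\<Prod>i\<in>UNIV. [:c $ i, u $ i:] ^ a i))"
  have "degree P \<le> l"
    unfolding P_def
  proof (rule degree_sum_le[OF finite_multi_indices])
    fix a :: "3 \<Rightarrow> nat" assume "a \<in> {a. (\<Sum>i\<in>UNIV. a i) \<le> l}"
    have "degree (smult (k a) (\<Prod>i\<in>UNIV. [:c $ i, u $ i:] ^ a i)) \<le> degree (\<Prod>i\<in>UNIV. [:c $ i, u $ i:] ^ a i)"
      by (rule degree_smult_le)
    also have "\<dots> \<le> (\<Sum>i\<in>UNIV. degree ([:c $ i, u $ i:] ^ a i))"
      using degree_prod_sum_le[of "UNIV::3 set" "\<lambda>i. [:c $ i, u $ i:] ^ a i"] by (simp add: o_def)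
    also have "\<dots> \<le> (\<Sum>i\<in>UNIV. a i)"
    proof (rule sum_mono)
      fix i
      have "degree ([:c $ i, u $ i:] ^ a i) \<le> degree [:c $ i, u $ i:] * a i" by (rule degree_power_le)
      also have "\<dots> \<le> 1 * a i" by (rule mult_right_mono) auto
      finally show "degree ([:c $ i, u $ i:] ^ a i) \<le> a i" by simp
    qed
    also have "\<dots> \<le> l" using \<open>a \<in> _\<close> by simp
    finally show "degree (smult (k a) (\<Prod>i\<in>UNIV. [:c $ i, u $ i:] ^ a i)) \<le> l" .
  qed
  moreover have "p (c + t *\<^sub>R u) = poly P t" for t
    by (simp add: k P_def poly_sum poly_prod)
  ultimately show ?thesis by blast
qed

definition poly_field :: "nat \<Rightarrow> field3 \<Rightarrow> bool" where
  "poly_field l q \<longleftrightarrow> (\<forall>i. poly_le l (\<lambda>x. q x $ i))"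

text \<open>
  The samples lie on the segment from \<open>y\<close> towards the apex \<open>c\<close>. The factor \<open>Suc l\<close> is the number of
  samples, from the comparison of the square of a sum with the sum of the squares.
\<close>

lemma poly_field_extrapolation:
  assumes "poly_field l q"
  shows "(norm (q y))\<^sup>2 \<le> 9 ^ l * real (Suc l) *
    (\<Sum>j=1..Suc l. (norm (q (c + (1 - real j * d) *\<^sub>R (y - c))))\<^sup>2)"
proof -
  have nine: "((3::real) ^ l)\<^sup>2 = 9 ^ l"
    by (simp add: power2_eq_square flip: power_mult_distrib)
  have comp: "(q y $ i)\<^sup>2 \<le> 9 ^ l * real (Suc l) * (\<Sum>j=1..Suc l. (q (c + (1 - real j * d) *\<^sub>R (y - c)) $ i)\<^sup>2)" for i
  proof -
    obtain P where P: "degree P \<le> l" "\<And>t. q (c + t *\<^sub>R (y - c)) $ i = poly P t"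
      using poly_le_on_line[of l "\<lambda>x. q x $ i" c "y - c"] assms unfolding poly_field_def by blast
    have "q y $ i = poly P 1" using P(2)[of 1] by simp
    then have "\<bar>q y $ i\<bar> \<le> 3 ^ l * (\<Sum>j=1..Suc l. \<bar>poly P (1 + real j * (- d))\<bar>)"
      using poly_extrapolation[OF P(1), of 1 "- d"] by simp
    then have "\<bar>q y $ i\<bar>\<^sup>2 \<le> (3 ^ l * (\<Sum>j=1..Suc l. \<bar>poly P (1 - real j * d)\<bar>))\<^sup>2"
      by (intro power_mono) auto
    also have "\<dots> = 9 ^ l * (\<Sum>j=1..Suc l. \<bar>poly P (1 - real j * d)\<bar>)\<^sup>2"
      by (simp only: power_mult_distrib nine)
    also have "\<dots> \<le> 9 ^ l * (real (card {1..Suc l}) * (\<Sum>j=1..Suc l. \<bar>poly P (1 - real j * d)\<bar>\<^sup>2))"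
      using sum_squared_le_sum_of_squares[of "\<lambda>j. \<bar>poly P (1 - real j * d)\<bar>" "{1..Suc l}"]
      by (intro mult_left_mono) (auto simp: mult.commute)
    finally show ?thesis by (simp add: P(2))
  qed
  have "(norm (q y))\<^sup>2 = (\<Sum>i\<in>UNIV. (q y $ i)\<^sup>2)"
    by (simp add: norm_vec_def L2_set_def sum_nonneg)
  also have "\<dots> \<le> (\<Sum>i\<in>UNIV. 9 ^ l * real (Suc l) * (\<Sum>j=1..Suc l. (q (c + (1 - real j * d) *\<^sub>R (y - c)) $ i)\<^sup>2))"
    by (intro sum_mono comp)
  also have "\<dots> = 9 ^ l * real (Suc l) * (\<Sum>j=1..Suc l. \<Sum>i\<in>UNIV. (q (c + (1 - real j * d) *\<^sub>R (y - c)) $ i)\<^sup>2)"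
    by (subst sum.swap) (simp add: sum_distrib_left)
  also have "\<dots> = 9 ^ l * real (Suc l) * (\<Sum>j=1..Suc l. (norm (q (c + (1 - real j * d) *\<^sub>R (y - c))))\<^sup>2)"
    by (simp add: norm_vec_def L2_set_def sum_nonneg)
  finally show ?thesis .
qed

section \<open>Continuously differentiable functions and the weak curl\<close>

abbreviation C1 :: "(real^3 \<Rightarrow> real) \<Rightarrow> bool" where
  "C1 f \<equiv> C_k (Suc 0) f"

lemma C1_D:
  assumes "C1 f"
  shows "f differentiable (at x)" "continuous_on UNIV (partial i f)" "continuous_on UNIV f"
  using assms by (auto simp: continuous_on_eq_continuous_at differentiable_imp_continuous_within)

lemma partial_const: "partial i (\<lambda>x. c) x = 0"
  by (simp add: partial_def)

lemma partial_coord: "partial i (\<lambda>x. x $ k) x = (if i = k then 1 else 0)"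
proof -
  have "((\<lambda>x::real^3. x $ k) has_derivative (\<lambda>h. h $ k)) (at x)"
    by (intro bounded_linear_imp_has_derivative bounded_linear_vec_nth)
  then have "frechet_derivative (\<lambda>x::real^3. x $ k) (at x) = (\<lambda>h. h $ k)"
    using frechet_derivative_at by metis
  then show ?thesis by (simp add: partial_def axis_def)
qed

lemma partial_add:
  assumes "f differentiable (at x)" "g differentiable (at x)"
  shows "partial i (\<lambda>x. f x + g x) x = partial i f x + partial i g x"
proof -
  have "((\<lambda>x. f x + g x) has_derivative
      (\<lambda>h. frechet_derivative f (at x) h + frechet_derivative g (at x) h)) (at x)"
    using assms by (intro has_derivative_add) (simp_all add: frechet_derivative_works)
  from frechet_derivative_at[OF this, symmetric] show ?thesis by (simp add: partial_def)
qed

lemma partial_mult: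
  assumes "f differentiable (at x)" "g differentiable (at x)"
  shows "partial i (\<lambda>x. f x * g x) x = f x * partial i g x + partial i f x * g x"
proof -
  have "((\<lambda>x. f x * g x) has_derivative
      (\<lambda>h. f x * frechet_derivative g (at x) h + frechet_derivative f (at x) h * g x)) (at x)"
    using assms by (intro has_derivative_mult) (simp_all add: frechet_derivative_works)
  from frechet_derivative_at[OF this, symmetric] show ?thesis by (simp add: partial_def)
qed

lemma C1_const: "C1 (\<lambda>x. c)"
proof -
  have "partial i (\<lambda>x. c) = (\<lambda>x. 0)" for i by (simp add: partial_const fun_eq_iff)
  then show ?thesis by simp
qed

lemma C1_coord: "C1 (\<lambda>x. x $ k)"
proof -
  have "partial i (\<lambda>x. x $ k) = (\<lambda>x. if i = k then 1 else 0)" for i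
    by (simp add: partial_coord fun_eq_iff)
  moreover have "(\<lambda>x::real^3. x $ k) differentiable (at x)" for x
    by (intro bounded_linear_imp_differentiable bounded_linear_vec_nth)
  ultimately show ?thesis by simp
qed

lemma C1_add:
  assumes "C1 f" "C1 g" shows "C1 (\<lambda>x. f x + g x)"
proof -
  have "partial i (\<lambda>x. f x + g x) = (\<lambda>x. partial i f x + partial i g x)" for i
    using assms by (auto simp: partial_add)
  then show ?thesis using assms by (simp add: continuous_on_add)
qed

lemma C1_mult:
  assumes "C1 f" "C1 g" shows "C1 (\<lambda>x. f x * g x)"
proof -
  have "partial i (\<lambda>x. f x * g x) = (\<lambda>x. f x * partial i g x + partial i f x * g x)" for i
    using assms by (auto simp: partial_mult)
  then show ?thesis using assms C1_D(3)[OF assms(1)] C1_D(3)[OF assms(2)]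
    by (simp add: continuous_intros)
qed

lemma C1_sum: "finite A \<Longrightarrow> (\<And>a. a \<in> A \<Longrightarrow> C1 (f a)) \<Longrightarrow> C1 (\<lambda>x. \<Sum>a\<in>A. f a x)"
  by (induction A rule: finite_induct) (simp_all only: sum.empty sum.insert C1_const C1_add insert_iff simp_thms)

lemma C1_prod: "finite A \<Longrightarrow> (\<And>a. a \<in> A \<Longrightarrow> C1 (f a)) \<Longrightarrow> C1 (\<lambda>x. \<Prod>a\<in>A. f a x)"
  by (induction A rule: finite_induct) (simp_all only: prod.empty prod.insert C1_const C1_mult insert_iff simp_thms)

lemma C1_power: "C1 f \<Longrightarrow> C1 (\<lambda>x. f x ^ n)"
  by (induction n) (simp_all only: power_0 power_Suc C1_const C1_mult)

lemma C1_poly_le: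
  assumes "poly_le l p" shows "C1 p"
proof -
  obtain k :: "(3 \<Rightarrow> nat) \<Rightarrow> real" where
    "p = (\<lambda>x. \<Sum>a | (\<Sum>i\<in>UNIV. a i) \<le> l. k a * (\<Prod>i\<in>UNIV. (x $ i) ^ a i))"
    using assms unfolding poly_le_def by blast
  moreover have "C1 (\<lambda>x. \<Sum>a | (\<Sum>i\<in>UNIV. a i) \<le> l. k a * (\<Prod>i\<in>UNIV. (x $ i) ^ a i))"
  proof (cases "finite {a :: 3 \<Rightarrow> nat. (\<Sum>i\<in>UNIV. a i) \<le> l}")
    case True
    then show ?thesis by (intro C1_sum C1_mult C1_const C1_prod C1_power C1_coord finite)
  next
    case False
    then show ?thesis by (simp only: sum.infinite C1_const not_False_eq_True)
  qed
  ultimately show ?thesis by simp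
qed

lemma partial_zero_outside_support:
  assumes "x \<notin> closure {x. f x \<noteq> 0}"
  shows "partial i f x = 0"
proof -
  have "(f has_derivative (\<lambda>h. 0)) (at x)"
  proof (rule has_derivative_transform_within_open)
    show "((\<lambda>x. 0) has_derivative (\<lambda>h. 0)) (at x)" by simp
    show "open (- closure {x. f x \<noteq> 0})" by (intro open_Compl closed_closure)
    show "x \<in> - closure {x. f x \<noteq> 0}" using assms by simp
    show "\<And>y. y \<in> - closure {x. f x \<noteq> 0} \<Longrightarrow> 0 = f y" using closure_subset[of "{x. f x \<noteq> 0}"] by auto
  qed
  from frechet_derivative_at[OF this, symmetric] show ?thesis by (simp add: partial_def)
qed

lemma partial_has_real_derivative:
  assumes "f differentiable (at (x + t *\<^sub>R axis i 1))"
  shows "((\<lambda>t. f (x + t *\<^sub>R axis i 1)) has_real_derivative partial i f (x + t *\<^sub>R axis i 1)) (at t)"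
proof -
  let ?D = "frechet_derivative f (at (x + t *\<^sub>R axis i 1))"
  have "((\<lambda>t. x + t *\<^sub>R axis i 1) has_derivative (\<lambda>h. h *\<^sub>R axis i 1)) (at t)"
    by (auto intro!: derivative_eq_intros)
  moreover have "(f has_derivative ?D) (at (x + t *\<^sub>R axis i 1))"
    using assms by (simp add: frechet_derivative_works)
  ultimately have "((\<lambda>t. f (x + t *\<^sub>R axis i 1)) has_derivative (\<lambda>h. ?D (h *\<^sub>R axis i 1))) (at t)"
    using has_derivative_compose by fastforce
  moreover have "?D (h *\<^sub>R axis i 1) = h * partial i f (x + t *\<^sub>R axis i 1)" for h
    using linear_frechet_derivative[OF assms] by (simp add: linear_cmul partial_def)
  ultimately show ?thesis
    by (simp add: has_field_derivative_def mult_commute_abs)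
qed

lemma integrable_continuous_compact_support:
  fixes g :: "'a::euclidean_space \<Rightarrow> real"
  assumes "continuous_on UNIV g" "compact S" "\<And>x. x \<notin> S \<Longrightarrow> g x = 0"
  shows "integrable lborel g"
proof -
  have "integrable lborel (\<lambda>x. indicator S x *\<^sub>R g x)"
    using borel_integrable_compact[OF assms(2) continuous_on_subset[OF assms(1) subset_UNIV]] .
  moreover have "(\<lambda>x. indicator S x *\<^sub>R g x) = g" using assms(3) by (auto simp: indicator_def fun_eq_iff)
  ultimately show ?thesis by simp
qed

text \<open>
  Difference quotients of \<open>f\<close> have integral zero because Lebesgue measure is invariant under translations,
  and they converge to the partial derivative, dominated by its maximum on a compact set.
\<close>

lemma integral_partial_eq_0:
  assumes "C1 f" "compact (closure {x. f x \<noteq> 0})"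
  shows "integral\<^sup>L lborel (partial i f) = 0"
proof -
  define S where "S = closure {x. f x \<noteq> 0}"
  \<comment> \<open>The difference quotients with steps at most 1 vanish outside \<open>T\<close>.\<close>
  define T where "T = (\<lambda>(x, t). x + t *\<^sub>R axis i 1) ` (S \<times> {-1..0::real})"
  define D where "D = (\<lambda>n x. (f (x + inverse (real (Suc n)) *\<^sub>R axis i 1) - f x) * real (Suc n))"
  have cS: "compact S" using assms by (simp add: S_def)
  have cT: "compact T" unfolding T_def
    by (intro compact_continuous_image compact_Times cS compact_Icc)
      (auto intro!: continuous_intros simp: split_beta)
  have ST: "S \<subseteq> T"
  proof
    fix x assume "x \<in> S"
    then show "x \<in> T" unfolding T_def by (intro rev_image_eqI[of "(x, 0)"]) auto
  qed
  have f0: "f x = 0" if "x \<notin> S" for x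
    using that closure_subset[of "{x. f x \<noteq> 0}"] by (auto simp: S_def)
  have p0: "partial i f x = 0" if "x \<notin> S" for x using that partial_zero_outside_support by (simp add: S_def)
  have "compact (partial i f ` S)"
    by (intro compact_continuous_image cS continuous_on_subset[OF C1_D(2)[OF assms(1)]]) auto
  then obtain B where B: "\<And>x. x \<in> S \<Longrightarrow> \<bar>partial i f x\<bar> \<le> B"
    by (force dest: compact_imp_bounded simp: bounded_iff)
  have B': "\<bar>partial i f x\<bar> \<le> \<bar>B\<bar>" for x
    using B[of x] p0[of x] by (cases "x \<in> S") auto
  have cf: "continuous_on UNIV f" using C1_D(3)[OF assms(1)] .
  have intf: "integrable lborel f"
    by (rule integrable_continuous_compact_support[OF cf cS f0])
  have shift: "integrable lborel (\<lambda>x. f (x + a))" "integral\<^sup>L lborel (\<lambda>x. f (x + a)) = integral\<^sup>L lborel f" for a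
  proof -
    have m: "f \<in> borel_measurable borel" using borel_measurable_integrable[OF intf] by simp
    have e: "lborel = distr lborel borel ((+) a)" by (rule lborel_distr_plus[symmetric])
    show "integrable lborel (\<lambda>x. f (x + a))"
      using intf m by (subst (asm) e) (simp add: integrable_distr_eq add.commute)
    show "integral\<^sup>L lborel (\<lambda>x. f (x + a)) = integral\<^sup>L lborel f"
      using m by (subst (2) e) (simp add: integral_distr add.commute)
  qed
  have "(\<lambda>n. integral\<^sup>L lborel (D n)) \<longlonglongrightarrow> integral\<^sup>L lborel (partial i f)"
  proof (rule integral_dominated_convergence)
    show "partial i f \<in> borel_measurable lborel"
      using borel_measurable_continuous_onI[OF C1_D(2)[OF assms(1)]] by simp
    have "f \<in> borel_measurable borel" using borel_measurable_continuous_onI[OF cf] by simp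
    then show "D n \<in> borel_measurable lborel" for n unfolding D_def by measurable
    show "integrable lborel (\<lambda>x. indicator T x *\<^sub>R \<bar>B\<bar>)"
      using borel_integrable_compact[OF cT, of "\<lambda>x. \<bar>B\<bar>"] by simp
    show "AE x in lborel. (\<lambda>n. D n x) \<longlonglongrightarrow> partial i f x"
    proof (rule AE_I2)
      fix x
      have "((\<lambda>t. f (x + t *\<^sub>R axis i 1)) has_real_derivative partial i f x) (at 0)"
        using partial_has_real_derivative[of f x 0 i] C1_D(1)[OF assms(1)] by simp
      then have "((\<lambda>h. (f (x + h *\<^sub>R axis i 1) - f x) / h) \<longlongrightarrow> partial i f x) (at 0)"
        by (simp add: DERIV_def)
      moreover have "filterlim (\<lambda>n. inverse (real (Suc n))) (at 0) sequentially"
        using LIMSEQ_inverse_real_of_nat by (auto simp: filterlim_at)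
      ultimately have "(\<lambda>n. (f (x + inverse (real (Suc n)) *\<^sub>R axis i 1) - f x) / inverse (real (Suc n))) \<longlonglongrightarrow> partial i f x"
        by (rule filterlim_compose)
      then show "(\<lambda>n. D n x) \<longlonglongrightarrow> partial i f x" by (simp add: D_def divide_inverse)
    qed
    show "AE x in lborel. norm (D n x) \<le> indicator T x *\<^sub>R \<bar>B\<bar>" for n
    proof (rule AE_I2)
      fix x :: "real^3"
      let ?h = "inverse (real (Suc n))"
      show "norm (D n x) \<le> indicator T x *\<^sub>R \<bar>B\<bar>"
      proof (cases "x \<in> T")
        case True
        obtain z where "0 < z" "z < ?h"
          "f (x + ?h *\<^sub>R axis i 1) - f (x + 0 *\<^sub>R axis i 1) = (?h - 0) * partial i f (x + z *\<^sub>R axis i 1)"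
          using MVT2[of 0 ?h "\<lambda>t. f (x + t *\<^sub>R axis i 1)" "\<lambda>t. partial i f (x + t *\<^sub>R axis i 1)"]
            partial_has_real_derivative C1_D(1)[OF assms(1)] by auto
        then have "D n x = partial i f (x + z *\<^sub>R axis i 1)" by (simp add: D_def)
        then show ?thesis using B' True by simp
      next
        case False
        then have "x \<notin> S" using ST by blast
        moreover have "x + ?h *\<^sub>R axis i 1 \<notin> S"
        proof
          assume a: "x + ?h *\<^sub>R axis i 1 \<in> S"
          have "- ?h \<in> {-1..0}" by (simp add: field_simps)
          then have "x \<in> T" using a unfolding T_def
            by (intro rev_image_eqI[of "(x + ?h *\<^sub>R axis i 1, - ?h)"]) auto
          with False show False by simp
        qed
        ultimately show ?thesis using False by (simp add: D_def f0)
      qed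
    qed
  qed
  moreover have "integral\<^sup>L lborel (D n) = 0" for n
    unfolding D_def by (simp add: shift intf)
  ultimately show ?thesis by (simp add: LIMSEQ_const_iff)
qed

lemma integral_lebesgue_on_supported:
  fixes g :: "'a::euclidean_space \<Rightarrow> real"
  assumes "open U" "continuous_on UNIV g" "\<And>x. x \<notin> U \<Longrightarrow> g x = 0"
  shows "integral\<^sup>L (lebesgue_on U) g = integral\<^sup>L lborel g"
proof -
  have "integral\<^sup>L (lebesgue_on U) g = integral\<^sup>L lebesgue (\<lambda>x. indicator U x *\<^sub>R g x)"
    using assms(1) by (intro integral_restrict_space) auto
  also have "(\<lambda>x. indicator U x *\<^sub>R g x) = g" using assms(3) by (auto simp: indicator_def fun_eq_iff)
  also have "integral\<^sup>L lebesgue g = integral\<^sup>L lborel g"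
    using borel_measurable_continuous_onI[OF assms(2)] by (intro integral_completion) simp
  finally show ?thesis .
qed

lemma curl_nth:
  "curl p x $ 1 = partial 2 (\<lambda>y. p y $ 3) x - partial 3 (\<lambda>y. p y $ 2) x"
  "curl p x $ 2 = partial 3 (\<lambda>y. p y $ 1) x - partial 1 (\<lambda>y. p y $ 3) x"
  "curl p x $ 3 = partial 1 (\<lambda>y. p y $ 2) x - partial 2 (\<lambda>y. p y $ 1) x"
  by (simp_all add: curl_def Let_def)

lemma continuous_on_vec3:
  assumes "\<And>i::3. continuous_on S (\<lambda>x. f x $ i)"
  shows "continuous_on S (f :: 'a::topological_space \<Rightarrow> real^3)"
  using continuous_on_vec_lambda[of S "\<lambda>i x. f x $ i"] assms by simp

lemma continuous_on_curl:
  assumes "\<And>j. C1 (\<lambda>x. p x $ j)"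
  shows "continuous_on UNIV (curl p)"
proof (rule continuous_on_vec3)
  fix i :: 3
  have "i = 1 \<or> i = 2 \<or> i = 3" using exhaust_3 by blast
  then show "continuous_on UNIV (\<lambda>x. curl p x $ i)"
    by (elim disjE; simp only: curl_nth; intro continuous_on_diff C1_D(2) assms)
qed

lemma curl_zero_outside_support:
  assumes "x \<notin> closure {x. \<phi> x \<noteq> 0}"
  shows "curl \<phi> x = 0"
proof -
  have "x \<notin> closure {x. \<phi> x $ j \<noteq> 0}" for j
    using assms closure_mono[of "{x. \<phi> x $ j \<noteq> 0}" "{x. \<phi> x \<noteq> 0}"] by force
  then have "partial i (\<lambda>y. \<phi> y $ j) x = 0" for i j by (rule partial_zero_outside_support)
  then show ?thesis by (simp add: vec_eq_iff forall_3 curl_nth)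
qed

text \<open>
  The difference \<open>p \<bullet> curl \<phi> - curl p \<bullet> \<phi>\<close> is the divergence of \<open>\<phi> \<times> p\<close>, a sum of partial derivatives
  of products that have compact support.
\<close>

lemma has_weak_curl_C1:
  assumes U: "open U" and p: "\<And>j. C1 (\<lambda>x. p x $ j)"
    and v: "v \<in> borel_measurable (lebesgue_on U)" "AE x in lebesgue_on U. v x = p x"
    and w: "w \<in> borel_measurable (lebesgue_on U)" "AE x in lebesgue_on U. w x = curl p x"
  shows "has_weak_curl U v w"
  unfolding has_weak_curl_def
proof (intro allI impI, elim conjE)
  fix \<phi> assume sm: "smooth_field \<phi>" and c: "compact (closure {x. \<phi> x \<noteq> 0})"
    and sub: "closure {x. \<phi> x \<noteq> 0} \<subseteq> U"
  define S where "S = closure {x. \<phi> x \<noteq> 0}"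
  have \<phi>: "C1 (\<lambda>x. \<phi> x $ j)" for j using sm by (auto simp: smooth_field_def)
  have z: "\<phi> x = 0" if "x \<notin> S" for x
    using that closure_subset[of "{x. \<phi> x \<noteq> 0}"] by (auto simp: S_def)
  have cz: "curl \<phi> x = 0" if "x \<notin> S" for x using that curl_zero_outside_support by (simp add: S_def)
  have cont: "continuous_on UNIV \<phi>" "continuous_on UNIV p" "continuous_on UNIV (curl \<phi>)" "continuous_on UNIV (curl p)"
    using \<phi> p by (auto intro!: continuous_on_vec3 continuous_on_curl C1_D(3) simp del: C_k.simps)
  have meas: "f \<in> borel_measurable (lebesgue_on U)" if "continuous_on UNIV f" for f :: "real^3 \<Rightarrow> real^3"
    using continuous_imp_measurable_on_sets_lebesgue[OF continuous_on_subset[OF that subset_UNIV]] U by simp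
  have g1: "continuous_on UNIV (\<lambda>x. p x \<bullet> curl \<phi> x)" and g2: "continuous_on UNIV (\<lambda>x. curl p x \<bullet> \<phi> x)"
    using cont by (auto intro!: continuous_intros)
  have cS: "compact S" and SU: "S \<subseteq> U" using c sub by (simp_all add: S_def)
  have out: "p x \<bullet> curl \<phi> x = 0" "curl p x \<bullet> \<phi> x = 0" if "x \<notin> U" for x
  proof -
    have "x \<notin> S" using that SU by blast
    then have "\<phi> x = 0" "curl \<phi> x = 0" by (rule z, rule cz)
    then show "p x \<bullet> curl \<phi> x = 0" "curl p x \<bullet> \<phi> x = 0" by (metis inner_zero_right)+
  qed
  have i1: "integrable lborel (\<lambda>x. p x \<bullet> curl \<phi> x)"
    by (rule integrable_continuous_compact_support[OF g1 cS]) (simp add: cz)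
  have i2: "integrable lborel (\<lambda>x. curl p x \<bullet> \<phi> x)"
    by (rule integrable_continuous_compact_support[OF g2 cS]) (simp add: z)
  define F where "F = (\<lambda>i j x. \<phi> x $ i * p x $ j)"
  have F1: "C1 (F i j)" for i j unfolding F_def by (intro C1_mult \<phi> p)
  have Fz: "closure {x. F i j x \<noteq> 0} \<subseteq> S" for i j
    unfolding S_def by (intro closure_mono) (auto simp: F_def)
  have cF: "compact (closure {x. F i j x \<noteq> 0})" for i j
    using compact_Int_closed[OF cS closed_closure, of "{x. F i j x \<noteq> 0}"] Fz[of i j] by (simp add: Int_absorb1)
  have F0: "integral\<^sup>L lborel (partial k (F i j)) = 0" for i j k
    by (rule integral_partial_eq_0[OF F1 cF])
  have Fi: "integrable lborel (partial k (F i j))" for i j k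
    using Fz by (intro integrable_continuous_compact_support[OF C1_D(2)[OF F1] cS] partial_zero_outside_support) auto
  have dF: "partial k (F i j) x = \<phi> x $ i * partial k (\<lambda>y. p y $ j) x + partial k (\<lambda>y. \<phi> y $ i) x * p x $ j" for i j k x
    unfolding F_def by (intro partial_mult C1_D(1) \<phi> p)
  have green: "p x \<bullet> curl \<phi> x - curl p x \<bullet> \<phi> x =
      (partial 1 (F 2 3) x - partial 1 (F 3 2) x) + (partial 2 (F 3 1) x - partial 2 (F 1 3) x)
      + (partial 3 (F 1 2) x - partial 3 (F 2 1) x)" for x
    by (simp only: dF inner_vec_def sum_3 curl_nth inner_real_def) (simp add: algebra_simps)
  have "integral\<^sup>L lborel (\<lambda>x. p x \<bullet> curl \<phi> x) - integral\<^sup>L lborel (\<lambda>x. curl p x \<bullet> \<phi> x)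
      = integral\<^sup>L lborel (\<lambda>x. p x \<bullet> curl \<phi> x - curl p x \<bullet> \<phi> x)"
    using i1 i2 by simp
  also have "\<dots> = 0" unfolding green by (simp add: Fi F0)
  finally have eq: "integral\<^sup>L lborel (\<lambda>x. p x \<bullet> curl \<phi> x) = integral\<^sup>L lborel (\<lambda>x. curl p x \<bullet> \<phi> x)" by simp
  have "integral\<^sup>L (lebesgue_on U) (\<lambda>x. v x \<bullet> curl \<phi> x) = integral\<^sup>L (lebesgue_on U) (\<lambda>x. p x \<bullet> curl \<phi> x)"
    using v meas[OF cont(2)] meas[OF cont(3)] by (intro integral_cong_AE) auto
  also have "\<dots> = integral\<^sup>L lborel (\<lambda>x. p x \<bullet> curl \<phi> x)"
    by (rule integral_lebesgue_on_supported[OF U g1 out(1)])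
  also have "\<dots> = integral\<^sup>L (lebesgue_on U) (\<lambda>x. curl p x \<bullet> \<phi> x)"
    unfolding eq by (rule integral_lebesgue_on_supported[OF U g2 out(2), symmetric])
  also have "\<dots> = integral\<^sup>L (lebesgue_on U) (\<lambda>x. w x \<bullet> \<phi> x)"
    using w meas[OF cont(1)] meas[OF cont(4)] by (intro integral_cong_AE) auto
  finally show "integral\<^sup>L (lebesgue_on U) (\<lambda>x. v x \<bullet> curl \<phi> x) = integral\<^sup>L (lebesgue_on U) (\<lambda>x. w x \<bullet> \<phi> x)" .
qed

section \<open>Convex elements, supporting planes and cones\<close>

lemma negligible_aff_dim_less:
  fixes S :: "(real^3) set"
  assumes "aff_dim S < 3"
  shows "negligible S"
proof -
  have "interior (affine hull S) = {}" using assms by (intro low_dim_interior) simp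
  then have "negligible (affine hull S)"
    by (simp add: negligible_convex_interior affine_imp_convex)
  then show ?thesis by (rule negligible_subset) (rule hull_subset)
qed

lemma affine_hull_eq_plane:
  fixes f :: "(real^3) set"
  assumes "\<And>y. y \<in> f \<Longrightarrow> n \<bullet> y = b" "n \<noteq> 0" "aff_dim f = 2"
  shows "affine hull f = {y. n \<bullet> y = b}"
proof (rule affine_dim_equal)
  show "affine (affine hull f)" by simp
  show "affine {y. n \<bullet> y = b}" by (rule affine_hyperplane)
  show "affine hull f \<noteq> {}" using assms(3) by (metis affine_hull_eq_empty aff_dim_empty_eq zero_neq_numeral aff_dim_empty neg_equal_zero zero_neq_neg_one numeral_neq_neg_one)
  show "affine hull f \<subseteq> {y. n \<bullet> y = b}" by (rule hull_minimal) (auto simp: assms affine_hyperplane)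
  show "aff_dim (affine hull f) = aff_dim {y. n \<bullet> y = b}" using assms by simp
qed

text \<open>
  A hyperplane that separates \<open>G\<close> from the interior of \<open>K\<close> contains \<open>G\<close>, since \<open>G\<close> also lies in the
  closure of that interior.
\<close>

lemma supporting_plane:
  fixes K :: "'a::euclidean_space set"
  assumes "convex K" "interior K \<noteq> {}" "convex G" "G \<noteq> {}" "G \<subseteq> K" "G \<inter> interior K = {}"
  obtains n b where "norm n = 1" "\<And>x. x \<in> K \<Longrightarrow> n \<bullet> x \<le> b" "\<And>y. y \<in> G \<Longrightarrow> n \<bullet> y = b"
proof -
  obtain a b where a: "a \<noteq> 0" "\<And>x. x \<in> interior K \<Longrightarrow> a \<bullet> x \<le> b" "\<And>y. y \<in> G \<Longrightarrow> b \<le> a \<bullet> y"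
    using separating_hyperplane_sets[OF convex_interior[OF assms(1)] assms(3,2,4)] assms(6)
    by (metis Int_commute)
  have "closure (interior K) \<subseteq> {x. a \<bullet> x \<le> b}"
    using a(2) by (intro closure_minimal) (auto simp: closed_halfspace_le)
  then have K: "a \<bullet> x \<le> b" if "x \<in> K" for x
    using that convex_closure_interior[OF assms(1,2)] closure_subset by fastforce
  show ?thesis
  proof (rule that[of "a /\<^sub>R norm a" "b / norm a"])
    show "norm (a /\<^sub>R norm a) = 1" using a by simp
    show "(a /\<^sub>R norm a) \<bullet> x \<le> b / norm a" if "x \<in> K" for x
      using K[OF that] by (simp add: field_simps divide_right_mono)
    show "(a /\<^sub>R norm a) \<bullet> y = b / norm a" if "y \<in> G" for y
      using K[of y] a(3)[OF that] that assms(5) by (auto simp: field_simps)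
  qed
qed

lemma ball_depth_below_plane:
  fixes c :: "'a::euclidean_space"
  assumes "norm n = 1" "\<And>x. x \<in> ball c r \<Longrightarrow> n \<bullet> x \<le> b" "0 < r"
  shows "n \<bullet> c + r \<le> b"
proof (rule field_le_epsilon)
  fix e :: real assume "0 < e"
  define s where "s = max 0 (r - e)"
  have s: "0 \<le> s" "s < r" "r - e \<le> s" using \<open>0 < e\<close> assms by (auto simp: s_def)
  have "c + s *\<^sub>R n \<in> ball c r" using s assms by (simp add: dist_norm)
  then have "n \<bullet> (c + s *\<^sub>R n) \<le> b" using assms by blast
  then have "n \<bullet> c + s \<le> b" using assms(1) by (simp add: inner_add_right norm_eq_1)
  then show "n \<bullet> c + r \<le> b + e" using s by simp
qed

lemma disjoint_interiors_imp_avoids_interior: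
  fixes K K' :: "'a::euclidean_space set"
  assumes "convex K'" "interior K' \<noteq> {}" "interior K \<inter> interior K' = {}"
  shows "K' \<inter> interior K = {}"
proof -
  have "interior K \<inter> closure (interior K') = {}"
    using assms by (simp add: open_Int_closure_eq_empty)
  then show ?thesis using convex_closure_interior[OF assms(1,2)] closure_subset[of K'] by auto
qed

text \<open>
  Points of the segment from \<open>y\<close> to \<open>c\<close> are interior to \<open>K\<close>. Close to \<open>y\<close> they also lie on a segment
  from \<open>c'\<close> to a point of \<open>G\<close>, because \<open>y\<close> is relatively interior to \<open>G\<close>, and hence are interior to \<open>K'\<close>.
\<close>

lemma same_side_interiors_meet:
  fixes K K' :: "'a::euclidean_space set"
  assumes K: "convex K" "c \<in> interior K" "G \<subseteq> K" and K': "convex K'" "c' \<in> interior K'" "G \<subseteq> K'"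
    and H: "affine hull G = {x. n \<bullet> x = b}" and y: "y \<in> rel_interior G"
    and side: "0 < (n \<bullet> c - b) * (n \<bullet> c' - b)"
  shows "interior K \<inter> interior K' \<noteq> {}"
proof -
  define q where "q = (n \<bullet> c - b) / (n \<bullet> c' - b)"
  have nz: "n \<bullet> c' - b \<noteq> 0" using side by auto
  have q: "0 < q" using side by (auto simp: q_def zero_less_mult_iff zero_less_divide_iff)
  \<comment> \<open>The line through \<open>c'\<close> and the point at parameter \<open>t\<close> of the segment from \<open>y\<close> to \<open>c\<close> meets the plane in \<open>z t\<close>.\<close>
  define z where "z = (\<lambda>t. y + inverse (1 - t * q) *\<^sub>R (t *\<^sub>R (c - y) - (t * q) *\<^sub>R (c' - y)))"
  obtain e where e: "0 < e" "ball y e \<inter> affine hull G \<subseteq> G" and yG: "y \<in> G"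
    using y by (auto simp: mem_rel_interior_ball)
  have "(z \<longlongrightarrow> y + inverse (1 - 0 * q) *\<^sub>R (0 *\<^sub>R (c - y) - (0 * q) *\<^sub>R (c' - y))) (at_right 0)"
    unfolding z_def by (intro tendsto_intros) auto
  then have "eventually (\<lambda>t. dist (z t) y < e) (at_right 0)"
    using e(1) by (auto dest: tendstoD)
  moreover have "eventually (\<lambda>t. t \<in> {0<..<min 1 (1 / q)}) (at_right (0::real))"
    using q by (intro eventually_at_right_real) auto
  ultimately have "eventually (\<lambda>t. dist (z t) y < e \<and> t \<in> {0<..<min 1 (1 / q)}) (at_right 0)"
    by (rule eventually_conj)
  then obtain t where t: "dist (z t) y < e" "0 < t" "t < 1" "t < 1 / q"
    using eventually_happens'[of "at_right (0::real)"] by (auto simp: trivial_limit_at_right_real)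
  have tq: "0 < t * q" "t * q < 1" using t q by (auto simp: field_simps)
  have ny: "n \<bullet> y = b" using yG hull_subset[of G affine] H by auto
  have "n \<bullet> (t *\<^sub>R (c - y) - (t * q) *\<^sub>R (c' - y)) = t * ((n \<bullet> c - b) - q * (n \<bullet> c' - b))"
    by (simp add: inner_diff_right ny algebra_simps)
  also have "\<dots> = 0" using nz by (simp add: q_def)
  finally have "n \<bullet> z t = b" by (simp add: z_def inner_add_right ny)
  then have zG: "z t \<in> G" using e(2) t(1) H by (auto simp: dist_commute)
  have "y - t *\<^sub>R (y - c) \<in> interior K"
    using mem_interior_convex_shrink[OF K(1,2), of y t] yG K(3) t by auto
  moreover have "z t - (t * q) *\<^sub>R (z t - c') \<in> interior K'"
    using mem_interior_convex_shrink[OF K'(1,2), of "z t" "t * q"] zG K'(3) tq by auto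
  moreover have "z t - (t * q) *\<^sub>R (z t - c') = y - t *\<^sub>R (y - c)"
  proof -
    have "(1 - t * q) *\<^sub>R (z t - y) = t *\<^sub>R (c - y) - (t * q) *\<^sub>R (c' - y)"
      using tq by (simp add: z_def)
    then show ?thesis by (simp add: algebra_simps)
  qed
  ultimately show ?thesis by auto
qed

text \<open>
  A two-dimensional intersection would span a plane that none of the three bodies crosses. Two of the
  bodies would lie on the same side of it, and their interiors would meet.
\<close>

lemma three_elements_meet_in_line:
  fixes K :: "nat \<Rightarrow> (real^3) set"
  assumes K: "\<And>i. i < 3 \<Longrightarrow> convex (K i)" "\<And>i. i < 3 \<Longrightarrow> interior (K i) \<noteq> {}"
    and dis: "\<And>i j. i < 3 \<Longrightarrow> j < 3 \<Longrightarrow> i \<noteq> j \<Longrightarrow> interior (K i) \<inter> interior (K j) = {}"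
  shows "aff_dim (K 0 \<inter> K 1 \<inter> K 2) \<le> 1"
proof (rule ccontr)
  define G where "G = K 0 \<inter> K 1 \<inter> K 2"
  assume "\<not> aff_dim (K 0 \<inter> K 1 \<inter> K 2) \<le> 1"
  then have d: "2 \<le> aff_dim G" by (simp add: G_def)
  have GK: "G \<subseteq> K i" if "i < 3" for i
    using that by (auto simp: G_def numeral_3_eq_3 less_Suc_eq numeral_2_eq_2)
  have cG: "convex G" using K(1) by (auto simp: G_def intro!: convex_Int)
  have "G \<noteq> {}" using d by (auto simp: aff_dim_empty)
  then obtain y where y: "y \<in> rel_interior G" using rel_interior_eq_empty[OF cG] by blast
  have av: "G \<inter> interior (K i) = {}" if "i < 3" for i
  proof -
    obtain j where j: "j < 3" "j \<noteq> i" using that by (metis zero_less_numeral one_less_numeral_iff semiring_norm(77) zero_neq_one)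
    have "K j \<inter> interior (K i) = {}"
      using disjoint_interiors_imp_avoids_interior[OF K(1,2)[OF j(1)] dis] that j by auto
    then show ?thesis using GK[OF j(1)] by blast
  qed
  have pl: "\<exists>n b. norm n = 1 \<and> (\<forall>x\<in>interior (K i). n \<bullet> x < b) \<and> (\<forall>y\<in>G. n \<bullet> y = b)" if i: "i < 3" for i
  proof -
    obtain n b where n: "norm n = 1" "\<And>x. x \<in> K i \<Longrightarrow> n \<bullet> x \<le> b" "\<And>y. y \<in> G \<Longrightarrow> n \<bullet> y = b"
      using supporting_plane[OF K(1,2)[OF i] cG \<open>G \<noteq> {}\<close> GK[OF i] av[OF i]] by blast
    have "n \<bullet> x < b" if xi: "x \<in> interior (K i)" for x
    proof -
      obtain r where "0 < r" "ball x r \<subseteq> K i" using xi by (auto simp: mem_interior)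
      then show ?thesis using ball_depth_below_plane[of n x r b] n by fastforce
    qed
    then show ?thesis using n by blast
  qed
  obtain n b where n: "norm n = 1" "\<forall>y\<in>G. n \<bullet> y = b" using pl[of 0] by auto
  have n0: "n \<noteq> 0" using n by auto
  have "aff_dim G \<le> aff_dim {x. n \<bullet> x = b}" using n by (intro aff_dim_subset) auto
  then have d2: "aff_dim G = 2" using n0 d by simp
  have H: "affine hull G = {x. n \<bullet> x = b}" using affine_hull_eq_plane[of G n b] n n0 d2 by auto
  have off: "\<exists>c. c \<in> interior (K i) \<and> n \<bullet> c \<noteq> b" if i: "i < 3" for i
  proof -
    obtain c where c: "c \<in> interior (K i)" using K(2)[OF i] by blast
    obtain m d where m: "norm m = 1" "\<forall>x\<in>interior (K i). m \<bullet> x < d" "\<forall>y\<in>G. m \<bullet> y = d"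
      using pl[OF i] by blast
    then have "m \<noteq> 0" by auto
    then have "affine hull G = {x. m \<bullet> x = d}" using affine_hull_eq_plane[of G m d] m d2 by auto
    then have "{x. n \<bullet> x = b} = {x. m \<bullet> x = d}" using H by simp
    then show ?thesis using m(2) c by (metis (mono_tags, lifting) less_irrefl mem_Collect_eq)
  qed
  obtain c where c: "\<And>i. i < 3 \<Longrightarrow> c i \<in> interior (K i)" "\<And>i. i < 3 \<Longrightarrow> n \<bullet> c i \<noteq> b"
    using off by metis
  \<comment> \<open>Three nonzero reals cannot have pairwise opposite signs.\<close>
  have no: "(n \<bullet> c i - b) * (n \<bullet> c j - b) < 0" if "i < 3" "j < 3" "i \<noteq> j" for i j
  proof (rule ccontr)
    assume "\<not> ?thesis"
    then have "0 < (n \<bullet> c i - b) * (n \<bullet> c j - b)" using c(2)[OF that(1)] c(2)[OF that(2)]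
      by (metis linorder_neqE_linordered_idom mult_eq_0_iff right_minus_eq)
    then show False
      using same_side_interiors_meet[OF K(1)[OF that(1)] c(1)[OF that(1)] GK[OF that(1)]
        K(1)[OF that(2)] c(1)[OF that(2)] GK[OF that(2)] H y] dis[OF that] by blast
  qed
  from no[of 0 1] no[of 0 2] no[of 1 2] show False
    by (auto simp: mult_less_0_iff)
qed

text \<open>
  The intersection is a face of both facets, and a proper face of at least one of them.
\<close>

lemma distinct_facets_meet_in_line:
  fixes K :: "'a::euclidean_space set"
  assumes "convex K" "F facet_of K" "F' facet_of K" "F \<noteq> F'"
  shows "aff_dim (F \<inter> F') < aff_dim K - 1"
proof -
  have f: "F face_of K" "F' face_of K" "aff_dim F = aff_dim K - 1" "aff_dim F' = aff_dim K - 1"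
    using assms by (auto simp: facet_of_def)
  have c: "convex F" "convex F'" using f assms(1) face_of_imp_convex by auto
  have fi: "F \<inter> F' face_of K" using f face_of_Int by blast
  show ?thesis
  proof (cases "F \<inter> F' = F")
    case True
    then have "F \<inter> F' \<noteq> F'" using assms(4) by blast
    moreover have "F \<inter> F' face_of F'" using face_of_subset[OF fi] f(2) face_of_imp_subset by blast
    ultimately show ?thesis using face_of_aff_dim_lt[OF c(2)] f by metis
  next
    case False
    moreover have "F \<inter> F' face_of F" using face_of_subset[OF fi] f(1) face_of_imp_subset by blast
    ultimately show ?thesis using face_of_aff_dim_lt[OF c(1)] f by metis
  qed
qed

text \<open>
  For convex \<open>f\<close> this is the convex hull of \<open>f\<close> and \<open>c\<close>; a face on the boundary of the domain need not be convex.
\<close>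

definition apex_cone :: "'a::real_vector \<Rightarrow> 'a set \<Rightarrow> 'a set" where
  "apex_cone c f = (\<lambda>(t, y). c + t *\<^sub>R (y - c)) ` ({0..1} \<times> f)"

lemma compact_apex_cone:
  fixes f :: "'a::real_normed_vector set"
  assumes "compact f" shows "compact (apex_cone c f)"
  unfolding apex_cone_def
  by (intro compact_continuous_image compact_Times assms compact_Icc)
    (auto intro!: continuous_intros simp: split_beta)

lemma apex_cone_subset:
  assumes "convex K" "c \<in> K" "f \<subseteq> K" shows "apex_cone c f \<subseteq> K"
proof
  fix z assume "z \<in> apex_cone c f"
  then obtain t y where ty: "0 \<le> t" "t \<le> 1" "y \<in> f" "z = c + t *\<^sub>R (y - c)" by (auto simp: apex_cone_def)
  then have "z = (1 - t) *\<^sub>R c + t *\<^sub>R y" by (simp add: algebra_simps)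
  then show "z \<in> K" using ty assms convexD[OF assms(1,2), of y "1 - t" t] by auto
qed

text \<open>
  A ray from the interior point \<open>c\<close> leaves \<open>K\<close> at a single point, so the two cones have in common only
  the cone over \<open>f \<inter> f'\<close>, which lies in a plane.
\<close>

lemma negligible_apex_cone_overlap:
  fixes f :: "(real^3) set"
  assumes K: "convex K" "c \<in> interior K" "f \<subseteq> K" "f' \<subseteq> K" "f \<inter> interior K = {}" "f' \<inter> interior K = {}"
    and d: "aff_dim (f \<inter> f') \<le> 1"
  shows "negligible (apex_cone c f \<inter> apex_cone c f')"
proof (rule negligible_subset)
  show "negligible (affine hull (insert c (f \<inter> f')))"
    using d by (intro negligible_aff_dim_less) (simp add: aff_dim_insert)
  have shrink: False
    if "y \<in> K" "0 \<le> s" "s < 1" "y' - c = s *\<^sub>R (y - c)" "y' \<notin> interior K" for y y' s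
  proof -
    have "y - (1 - s) *\<^sub>R (y - c) \<in> interior K"
      using mem_interior_convex_shrink[OF K(1,2) that(1), of "1 - s"] that by auto
    moreover have "y - (1 - s) *\<^sub>R (y - c) = y'" using that(4) by (simp add: algebra_simps)
    ultimately show False using that by simp
  qed
  show "apex_cone c f \<inter> apex_cone c f' \<subseteq> affine hull (insert c (f \<inter> f'))"
  proof
    fix z assume "z \<in> apex_cone c f \<inter> apex_cone c f'"
    then obtain t y t' y' where z: "0 \<le> t" "t \<le> 1" "y \<in> f" "z = c + t *\<^sub>R (y - c)"
      "0 \<le> t'" "t' \<le> 1" "y' \<in> f'" "z = c + t' *\<^sub>R (y' - c)" by (auto simp: apex_cone_def)
    have eq: "t *\<^sub>R (y - c) = t' *\<^sub>R (y' - c)" using z by simp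
    have nc: "y \<notin> interior K" "y' \<notin> interior K" "y \<in> K" "y' \<in> K" using z K by auto
    have chull: "c \<in> affine hull (insert c (f \<inter> f'))" by (simp add: hull_inc)
    show "z \<in> affine hull (insert c (f \<inter> f'))"
    proof (cases "t = 0 \<or> t' = 0")
      case True
      then have "z = c" using z by auto
      then show ?thesis using chull by simp
    next
      case False
      then have pos: "0 < t" "0 < t'" using z by auto
      have "t = t'"
      proof (rule linorder_cases[of t t'])
        assume "t < t'"
        have "y' - c = (t / t') *\<^sub>R (y - c)"
          using arg_cong[OF eq, of "\<lambda>v. (1 / t') *\<^sub>R v"] pos by simp
        then show ?thesis using shrink[OF nc(3), of "t / t'" y'] nc pos \<open>t < t'\<close> by auto
      next
        assume "t' < t"
        have "y - c = (t' / t) *\<^sub>R (y' - c)"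
          using arg_cong[OF eq, of "\<lambda>v. (1 / t) *\<^sub>R v"] pos by simp
        then show ?thesis using shrink[OF nc(4), of "t' / t" y] nc pos \<open>t' < t\<close> by auto
      qed
      then have "y = y'" using eq pos by simp
      then have "y \<in> affine hull (insert c (f \<inter> f'))" using z by (intro hull_inc) auto
      then show ?thesis
        using mem_affine_3_minus[OF affine_affine_hull chull _ chull, of y t] z(4) by simp
    qed
  qed
qed

section \<open>Surface integrals and the trace inequality on one face\<close>

lemma absolutely_integrable_continuous_compact:
  fixes g :: "'a::euclidean_space \<Rightarrow> 'b::euclidean_space"
  assumes "compact S" "continuous_on S g"
  shows "g absolutely_integrable_on S"
proof -
  have i: "integrable lborel (\<lambda>x. indicator S x *\<^sub>R g x)"
    by (rule borel_integrable_compact[OF assms])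
  then show ?thesis
    unfolding set_integrable_def by (subst integrable_completion) auto
qed

lemma det_rank_one_update:
  fixes w n :: "real^3"
  shows "det (matrix (\<lambda>h. s *\<^sub>R h + (n \<bullet> h) *\<^sub>R w)) = s ^ 3 + s\<^sup>2 * (n \<bullet> w)"
  by (simp add: det_3 matrix_def inner_vec_def sum_3 axis_def power3_eq_cube power2_eq_square algebra_simps)

definition plane_proj :: "real^3 \<Rightarrow> real \<Rightarrow> real^3 \<Rightarrow> real^3" where
  "plane_proj n b x = x - (n \<bullet> x - b) *\<^sub>R n"

definition prism :: "real^3 \<Rightarrow> (real^3) set \<Rightarrow> (real^3) set" where
  "prism n f = (\<lambda>(s, y). y + s *\<^sub>R n) ` ({-1/2..1/2} \<times> f)"

context
  fixes n :: "real^3" and b :: real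
  assumes n: "norm n = 1"
begin

lemma inner_plane_proj: "n \<bullet> plane_proj n b x = b"
  using n by (simp add: plane_proj_def inner_diff_right norm_eq_1)

lemma closest_point_plane: "closest_point {y. n \<bullet> y = b} x = plane_proj n b x"
proof (rule closest_point_unique[symmetric])
  show "plane_proj n b x \<in> {y. n \<bullet> y = b}" by (simp add: inner_plane_proj)
  show "\<forall>z\<in>{y. n \<bullet> y = b}. dist x (plane_proj n b x) \<le> dist x z"
  proof clarify
    fix z assume z: "b = n \<bullet> z"
    have "dist x (plane_proj n b x) = \<bar>n \<bullet> (x - z)\<bar>"
      using n z by (simp add: plane_proj_def dist_norm inner_diff_right)
    also have "\<dots> \<le> norm n * norm (x - z)" by (rule Cauchy_Schwarz_ineq2)
    finally show "dist x (plane_proj n (n \<bullet> z) x) \<le> dist x z" using n z by (simp add: dist_norm)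
  qed
qed (auto intro: convex_hyperplane closed_hyperplane)

lemma plane_nonempty: "{y. n \<bullet> y = b} \<noteq> {}"
  using inner_plane_proj[of 0] by blast

lemma infdist_plane: "infdist x {y. n \<bullet> y = b} = \<bar>n \<bullet> x - b\<bar>"
proof -
  have "infdist x {y. n \<bullet> y = b} = dist x (closest_point {y. n \<bullet> y = b} x)"
    using plane_nonempty by (simp add: infdist_eq_setdist setdist_closest_point closed_hyperplane)
  then show ?thesis using n by (simp add: closest_point_plane plane_proj_def dist_norm)
qed

lemma mem_prism_iff:
  assumes "f \<subseteq> {y. n \<bullet> y = b}"
  shows "x \<in> prism n f \<longleftrightarrow> \<bar>n \<bullet> x - b\<bar> \<le> 1 / 2 \<and> plane_proj n b x \<in> f"
proof
  assume "x \<in> prism n f"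
  then obtain s y where s: "-1/2 \<le> s" "s \<le> 1/2" "y \<in> f" "x = y + s *\<^sub>R n"
    by (auto simp: prism_def)
  have "n \<bullet> y = b" using s assms by auto
  then have "n \<bullet> x = b + s" using s n by (simp add: inner_add_right norm_eq_1)
  then show "\<bar>n \<bullet> x - b\<bar> \<le> 1 / 2 \<and> plane_proj n b x \<in> f" using s by (auto simp: plane_proj_def)
next
  assume h: "\<bar>n \<bullet> x - b\<bar> \<le> 1 / 2 \<and> plane_proj n b x \<in> f"
  then have "-1/2 \<le> n \<bullet> x - b" "n \<bullet> x - b \<le> 1/2" by linarith+
  with h show "x \<in> prism n f" unfolding prism_def
    by (intro rev_image_eqI[of "(n \<bullet> x - b, plane_proj n b x)"]) (auto simp: plane_proj_def)
qed

lemma compact_prism: "compact f \<Longrightarrow> compact (prism n f)"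
  unfolding prism_def
  by (intro compact_continuous_image compact_Times compact_Icc)
    (auto intro!: continuous_intros simp: split_beta)

lemma continuous_plane_proj: "continuous_on A (plane_proj n b)"
  unfolding plane_proj_def by (intro continuous_intros)

lemma
  assumes f: "affine hull f = {y. n \<bullet> y = b}" "compact f"
    and g: "(\<lambda>x. indicator f x *\<^sub>R g x :: real) \<in> borel_measurable borel"
  shows face_integral_eq_prism:
      "face_integral f g = integral\<^sup>L lborel (\<lambda>x. indicator (prism n f) x *\<^sub>R g (plane_proj n b x))"
    and set_integrable_area_iff_prism: "set_integrable (area_measure f) f g \<longleftrightarrow>
      integrable lborel (\<lambda>x. indicator (prism n f) x *\<^sub>R g (plane_proj n b x))"
proof -
  define S where "S = {x. \<bar>n \<bullet> x - b\<bar> \<le> 1 / 2}"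
  have S: "S \<in> sets lborel" "S \<inter> space lborel \<in> sets lborel" unfolding S_def by measurable
  have am: "area_measure f = distr (restrict_space lborel S) borel (plane_proj n b)"
    unfolding area_measure_def f infdist_plane S_def
    by (rule arg_cong[where f = "distr _ _"]) (simp add: closest_point_plane fun_eq_iff)
  have mp: "plane_proj n b \<in> measurable (restrict_space lborel S) borel"
    using borel_measurable_continuous_onI[OF continuous_plane_proj] by (intro measurable_restrict_space1) simp
  have fH: "f \<subseteq> {y. n \<bullet> y = b}" using f hull_subset by metis
  have ind: "indicator S x *\<^sub>R (indicator f (plane_proj n b x) *\<^sub>R g (plane_proj n b x)) =
      indicator (prism n f) x *\<^sub>R g (plane_proj n b x)" for x
    using mem_prism_iff[OF fH, of x] by (auto simp: indicator_def S_def)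
  show "face_integral f g = integral\<^sup>L lborel (\<lambda>x. indicator (prism n f) x *\<^sub>R g (plane_proj n b x))"
    unfolding face_integral_def set_lebesgue_integral_def am integral_distr[OF mp g]
      integral_restrict_space[OF S(2)] ind ..
  show "set_integrable (area_measure f) f g \<longleftrightarrow>
      integrable lborel (\<lambda>x. indicator (prism n f) x *\<^sub>R g (plane_proj n b x))"
    unfolding set_integrable_def am integrable_distr_eq[OF mp g]
      integrable_restrict_space[OF S(2)] ind ..
qed

lemma indicator_continuous_measurable:
  fixes g :: "real^3 \<Rightarrow> real"
  assumes "compact f" "continuous_on UNIV g"
  shows "(\<lambda>x. indicator f x *\<^sub>R g x) \<in> borel_measurable borel"
proof -
  have "g \<in> borel_measurable borel" using borel_measurable_continuous_onI[OF assms(2)] .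
  moreover have "f \<in> sets borel" using assms(1) by (simp add: compact_imp_closed)
  ultimately show ?thesis by measurable
qed

lemma set_integrable_area_continuous:
  assumes f: "affine hull f = {y. n \<bullet> y = b}" "compact f" and g: "continuous_on UNIV g"
  shows "set_integrable (area_measure f) f (g :: real^3 \<Rightarrow> real)"
proof -
  have "continuous_on (prism n f) (\<lambda>x. g (plane_proj n b x))"
    by (rule continuous_on_compose2[OF g continuous_plane_proj]) auto
  then show ?thesis
    using set_integrable_area_iff_prism[OF f indicator_continuous_measurable[OF f(2) g]]
      borel_integrable_compact[OF compact_prism[OF f(2)]] by blast
qed

lemma face_integral_continuous:
  assumes f: "affine hull f = {y. n \<bullet> y = b}" "compact f" and g: "continuous_on UNIV g"
  shows "face_integral f g = integral (prism n f) (\<lambda>x. g (plane_proj n b x))"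
proof -
  have c: "continuous_on (prism n f) (\<lambda>x. g (plane_proj n b x))"
    by (rule continuous_on_compose2[OF g continuous_plane_proj]) auto
  have i: "set_integrable lborel (prism n f) (\<lambda>x. g (plane_proj n b x))"
    unfolding set_integrable_def by (rule borel_integrable_compact[OF compact_prism[OF f(2)] c])
  show ?thesis
    unfolding face_integral_eq_prism[OF f indicator_continuous_measurable[OF f(2) g]]
    using set_borel_integral_eq_integral(2)[OF i] by (simp add: set_lebesgue_integral_def)
qed

text \<open>
  The map \<open>T\<close> below sends the point over \<open>y\<close> in \<open>f\<close> with normal coordinate \<open>h\<close> to the point of the segment from
  \<open>c\<close> to \<open>y\<close> at parameter \<open>s = 1 - a (h + 1/2)\<close>. Its derivative is a rank-one perturbation of \<open>s\<close> times the
  identity, with determinant of modulus \<open>a s\<^sup>2 (b - n \<bullet> c)\<close>, and \<open>s\<close> is at least \<open>1/2\<close>.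
\<close>

lemma integral_prism_le_cone:
  assumes f: "f \<subseteq> {y. n \<bullet> y = b}" "compact f" and c: "n \<bullet> c < b"
    and a: "0 < a" "a \<le> 1 / 2" and G: "continuous_on UNIV G" "\<And>x. 0 \<le> G x"
  shows "integral (prism n f) (\<lambda>x. G (c + (1 - a * (n \<bullet> x - b + 1 / 2)) *\<^sub>R (plane_proj n b x - c)))
    \<le> 4 / (a * (b - n \<bullet> c)) * integral (apex_cone c f) (G :: real^3 \<Rightarrow> real)"
proof -
  define s where "s = (\<lambda>x. 1 - a * (n \<bullet> x - b + 1 / 2))"
  define T where "T = (\<lambda>x. c + s x *\<^sub>R (plane_proj n b x - c))"
  define S where "S = prism n f"
  define d where "d = b - n \<bullet> c"
  define w where "w = (\<lambda>x. - a *\<^sub>R (plane_proj n b x - c) - s x *\<^sub>R n)"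
  define T' where "T' = (\<lambda>x h. s x *\<^sub>R h + (n \<bullet> h) *\<^sub>R w x)"
  have d: "0 < d" using c by (simp add: d_def)
  have cS: "compact S" unfolding S_def by (rule compact_prism[OF f(2)])
  have mS: "\<bar>n \<bullet> x - b\<bar> \<le> 1 / 2" "plane_proj n b x \<in> f" if "x \<in> S" for x
    using that mem_prism_iff[OF f(1)] by (auto simp: S_def)
  have s: "1 / 2 \<le> s x" "s x \<le> 1" if "x \<in> S" for x
  proof -
    have t: "0 \<le> n \<bullet> x - b + 1 / 2" "n \<bullet> x - b + 1 / 2 \<le> 1" using mS(1)[OF that] by linarith+
    have "a * (n \<bullet> x - b + 1 / 2) \<le> 1 / 2 * 1" using a t by (intro mult_mono) auto
    then show "1 / 2 \<le> s x" "s x \<le> 1" using a t by (auto simp: s_def)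
  qed
  have nT: "n \<bullet> (T x - c) = s x * d" for x
    by (simp add: T_def inner_diff_right inner_plane_proj d_def)
  have der: "(T has_derivative T' x) (at x within S)" for x
  proof -
    have "(T has_derivative (\<lambda>h. s x *\<^sub>R (h - (n \<bullet> h) *\<^sub>R n) + (- (a * (n \<bullet> h))) *\<^sub>R (plane_proj n b x - c))) (at x within S)"
      unfolding T_def s_def plane_proj_def by (auto intro!: derivative_eq_intros)
    then show ?thesis
      by (rule has_derivative_eq_rhs) (auto simp: T'_def w_def fun_eq_iff algebra_simps)
  qed
  have det: "det (matrix (T' x)) = - (a * (s x)\<^sup>2 * d)" for x
  proof -
    have "n \<bullet> w x = - a * d - s x"
      using n by (simp add: w_def inner_diff_right inner_plane_proj d_def norm_eq_1)
    then have nw: "s x + n \<bullet> w x = - (a * d)" by simp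
    have "det (matrix (T' x)) = (s x)\<^sup>2 * (s x + n \<bullet> w x)"
      unfolding T'_def det_rank_one_update by (simp add: distrib_left power3_eq_cube power2_eq_square)
    then show ?thesis unfolding nw by simp
  qed
  have inj: "inj_on T S"
  proof (rule inj_onI)
    fix x y assume x: "x \<in> S" and y: "y \<in> S" and eq: "T x = T y"
    have "s x * d = s y * d" using nT eq by metis
    then have sxy: "s x = s y" using d by simp
    then have "n \<bullet> x = n \<bullet> y" using a by (simp add: s_def)
    moreover have "plane_proj n b x = plane_proj n b y" using eq sxy s(1)[OF y] by (auto simp: T_def)
    ultimately show "x = y" by (simp add: plane_proj_def)
  qed
  have cT: "continuous_on A T" for A
    unfolding T_def s_def by (intro continuous_intros continuous_plane_proj)
  have cTS: "compact (T ` S)" by (rule compact_continuous_image[OF cT cS])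
  have sub: "T ` S \<subseteq> apex_cone c f"
  proof (rule image_subsetI)
    fix x assume x: "x \<in> S"
    show "T x \<in> apex_cone c f"
      using s[OF x] mS(2)[OF x] unfolding apex_cone_def T_def
      by (intro rev_image_eqI[of "(s x, plane_proj n b x)"]) auto
  qed
  have cG: "continuous_on A G" for A using G(1) continuous_on_subset by blast
  have iT: "G absolutely_integrable_on (T ` S)"
    by (rule absolutely_integrable_continuous_compact[OF cTS cG])
  have iC: "G integrable_on apex_cone c f"
    using absolutely_integrable_continuous_compact[OF compact_apex_cone[OF f(2)] cG]
    by (rule set_lebesgue_integral_eq_integral)
  \<comment> \<open>The change of variables formula is stated for vector-valued functions.\<close>
  define G1 where "G1 = (\<lambda>x. vec (G x) :: real^1)"
  have "continuous_on A G1" for A unfolding G1_def vec_def by (intro continuous_intros cG)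
  then have iG1: "G1 absolutely_integrable_on (T ` S)"
    by (intro absolutely_integrable_continuous_compact[OF cTS])
  then have cv: "(\<lambda>x. \<bar>det (matrix (T' x))\<bar> *\<^sub>R G1 (T x)) absolutely_integrable_on S"
    "integral S (\<lambda>x. \<bar>det (matrix (T' x))\<bar> *\<^sub>R G1 (T x)) = integral (T ` S) G1"
    using has_absolute_integral_change_of_variables_compact[OF cS der inj, of G1 "integral (T ` S) G1"] by auto
  have "integral (T ` S) G1 $ 1 = integral (T ` S) (\<lambda>x. G1 x $ 1)"
    using integral_component_eq_cart[of G1 "T ` S" 1] iG1 set_lebesgue_integral_eq_integral(1) by fastforce
  then have r: "integral (T ` S) G1 $ 1 = integral (T ` S) G" by (simp add: G1_def)
  have "integral S (\<lambda>x. \<bar>det (matrix (T' x))\<bar> *\<^sub>R G1 (T x)) $ 1 =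
      integral S (\<lambda>x. (\<bar>det (matrix (T' x))\<bar> *\<^sub>R G1 (T x)) $ 1)"
    using integral_component_eq_cart[of "\<lambda>x. \<bar>det (matrix (T' x))\<bar> *\<^sub>R G1 (T x)" S 1] cv(1)
      set_lebesgue_integral_eq_integral(1) by fastforce
  then have eq: "integral S (\<lambda>x. a * (s x)\<^sup>2 * d * G (T x)) = integral (T ` S) G"
    using cv(2) r a d by (simp add: G1_def det abs_mult)
  have cGT: "continuous_on S (\<lambda>x. G (T x))" by (rule continuous_on_compose2[OF G(1) cT]) auto
  have i1: "(\<lambda>x. a * d / 4 * G (T x)) integrable_on S"
    by (intro set_lebesgue_integral_eq_integral(1) absolutely_integrable_continuous_compact[OF cS]
        continuous_intros cGT)
  have cs: "continuous_on S s" unfolding s_def by (intro continuous_intros)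
  have i2: "(\<lambda>x. a * (s x)\<^sup>2 * d * G (T x)) integrable_on S"
    by (intro set_lebesgue_integral_eq_integral(1) absolutely_integrable_continuous_compact[OF cS]
        continuous_intros cGT cs)
  have "a * d / 4 * integral S (\<lambda>x. G (T x)) = integral S (\<lambda>x. a * d / 4 * G (T x))" by simp
  also have "\<dots> \<le> integral S (\<lambda>x. a * (s x)\<^sup>2 * d * G (T x))"
  proof (rule integral_le[OF i1 i2])
    fix x assume "x \<in> S"
    have "(1 / 2)\<^sup>2 \<le> (s x)\<^sup>2" using s[OF \<open>x \<in> S\<close>] by (intro power_mono) auto
    then have "a * d * (1 / 4) * G (T x) \<le> a * d * (s x)\<^sup>2 * G (T x)"
      using a d G(2) by (intro mult_right_mono mult_left_mono) (auto simp: power2_eq_square)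
    then show "a * d / 4 * G (T x) \<le> a * (s x)\<^sup>2 * d * G (T x)" by (simp add: mult_ac)
  qed
  also have "\<dots> \<le> integral (apex_cone c f) G"
    unfolding eq using iT iC sub G(2)
    by (intro integral_subset_le) (auto intro: set_lebesgue_integral_eq_integral)
  finally have "integral S (\<lambda>x. G (T x)) \<le> 4 / (a * d) * integral (apex_cone c f) G"
    using a d by (simp add: field_simps)
  then show ?thesis by (simp add: S_def T_def s_def d_def)
qed

text \<open>
  At each point of the prism, \<open>\<bar>q\<bar>\<^sup>2\<close> at the foot point is extrapolated from \<open>l + 1\<close> samples towards \<open>c\<close>, with
  a step proportional to the normal coordinate. The \<open>j\<close>-th sample has the form treated by
  \<open>integral_prism_le_cone\<close> with \<open>a = j / (2 (l + 1))\<close>. The three factors \<open>l + 1\<close> come from the extrapolation, from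
  the number of samples and from the smallest value of \<open>a\<close>.
\<close>

lemma polynomial_trace_inequality:
  assumes f: "affine hull f = {y. n \<bullet> y = b}" "compact f" and c: "n \<bullet> c < b"
    and q: "poly_field l q" "continuous_on UNIV q"
  shows "face_integral f (\<lambda>x. (norm (q x))\<^sup>2)
    \<le> 8 * 9 ^ l * real (Suc l) ^ 3 / (b - n \<bullet> c) * integral (apex_cone c f) (\<lambda>x. (norm (q x))\<^sup>2)"
proof -
  define N where "N = real (Suc l)"
  define a where "a = (\<lambda>j::nat. real j / (2 * N))"
  define G where "G = (\<lambda>x. (norm (q x))\<^sup>2)"
  define T where "T = (\<lambda>j x. c + (1 - a j * (n \<bullet> x - b + 1 / 2)) *\<^sub>R (plane_proj n b x - c))"
  define I where "I = integral (apex_cone c f) G"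
  have N: "1 \<le> N" by (simp add: N_def)
  have fH: "f \<subseteq> {y. n \<bullet> y = b}" using f hull_subset by metis
  have cG: "continuous_on UNIV G" unfolding G_def by (intro continuous_intros q)
  have cS: "compact (prism n f)" by (rule compact_prism[OF f(2)])
  have cGP: "continuous_on (prism n f) (\<lambda>x. G (plane_proj n b x))"
    by (rule continuous_on_compose2[OF cG continuous_plane_proj]) auto
  have cGT: "continuous_on (prism n f) (\<lambda>x. G (T j x))" for j
    by (rule continuous_on_compose2[OF cG]) (auto simp: T_def intro!: continuous_intros continuous_plane_proj)
  have int: "h integrable_on (prism n f)" if "continuous_on (prism n f) h" for h :: "real^3 \<Rightarrow> real"
    by (rule set_lebesgue_integral_eq_integral(1)[OF absolutely_integrable_continuous_compact[OF cS that]])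
  have I0: "0 \<le> I" unfolding I_def
    by (rule integral_nonneg) (auto simp: G_def intro!: set_lebesgue_integral_eq_integral(1)
        absolutely_integrable_continuous_compact compact_apex_cone f continuous_intros continuous_on_subset[OF q(2)])
  have "face_integral f G = integral (prism n f) (\<lambda>x. G (plane_proj n b x))"
    by (rule face_integral_continuous[OF f cG])
  also have "\<dots> \<le> integral (prism n f) (\<lambda>x. 9 ^ l * N * (\<Sum>j=1..Suc l. G (T j x)))"
  proof (rule integral_le[OF int[OF cGP] int])
    show "continuous_on (prism n f) (\<lambda>x. 9 ^ l * N * (\<Sum>j=1..Suc l. G (T j x)))"
      by (intro continuous_intros cGT)
    fix x
    show "G (plane_proj n b x) \<le> 9 ^ l * N * (\<Sum>j=1..Suc l. G (T j x))"
      using poly_field_extrapolation[OF q(1), of "plane_proj n b x" c "(n \<bullet> x - b + 1 / 2) / (2 * N)"]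
      by (simp add: G_def T_def a_def N_def)
  qed
  also have "\<dots> = 9 ^ l * N * (\<Sum>j=1..Suc l. integral (prism n f) (\<lambda>x. G (T j x)))"
    by (simp add: integral_sum int cGT del: sum.cl_ivl_Suc)
  also have "\<dots> \<le> 9 ^ l * N * (\<Sum>j=1..Suc l. 8 * N / (b - n \<bullet> c) * I)"
  proof (intro mult_left_mono sum_mono)
    fix j assume j: "j \<in> {1..Suc l}"
    have "real j \<le> N" using j by (simp add: N_def)
    then have aj: "0 < a j" "a j \<le> 1 / 2" "1 / (2 * N) \<le> a j" using j N by (auto simp: a_def field_simps)
    have "integral (prism n f) (\<lambda>x. G (T j x)) \<le> 4 / (a j * (b - n \<bullet> c)) * I"
      unfolding T_def I_def by (rule integral_prism_le_cone[OF fH f(2) c aj(1,2) cG]) (simp add: G_def)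
    also have "\<dots> \<le> 4 / (1 / (2 * N) * (b - n \<bullet> c)) * I"
      using aj c N I0 by (intro mult_right_mono divide_left_mono mult_pos_pos) auto
    also have "\<dots> = 8 * N / (b - n \<bullet> c) * I" by simp
    finally show "integral (prism n f) (\<lambda>x. G (T j x)) \<le> 8 * N / (b - n \<bullet> c) * I" .
  qed (use N in auto)
  also have "\<dots> = 8 * 9 ^ l * N ^ 3 / (b - n \<bullet> c) * I"
    by (simp add: power3_eq_cube N_def del: sum.cl_ivl_Suc)
  finally show ?thesis by (simp add: G_def I_def N_def)
qed

lemma negligible_prism_thin:
  fixes f :: "(real^3) set"
  assumes "f \<subseteq> {y. n \<bullet> y = b}" "aff_dim f \<le> 1"
  shows "negligible (prism n f)"
proof (cases "f = {}")
  case True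
  then show ?thesis by (simp add: prism_def)
next
  case False
  then obtain y0 where y0: "y0 \<in> f" by blast
  let ?A = "affine hull (insert (y0 + n) f)"
  show ?thesis
  proof (rule negligible_subset)
    show "negligible ?A" using assms(2) by (intro negligible_aff_dim_less) (simp add: aff_dim_insert)
    show "prism n f \<subseteq> ?A"
    proof
      fix x assume "x \<in> prism n f"
      then obtain s y where x: "y \<in> f" "x = y + s *\<^sub>R n" by (auto simp: prism_def)
      have "y + s *\<^sub>R ((y0 + n) - y0) \<in> ?A"
        using x y0 by (intro mem_affine_3_minus affine_affine_hull hull_inc) auto
      then show "x \<in> ?A" using x by simp
    qed
  qed
qed

text \<open>
  Sets of positive area in a plane are two-dimensional: the prism over a thinner set lies in a plane.
\<close>

lemma emeasure_area_measure_thin: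
  assumes F: "affine hull F = {y. n \<bullet> y = b}" and f: "compact f" "f \<subseteq> affine hull F" "aff_dim f \<le> 1"
  shows "emeasure (area_measure F) f = 0"
proof -
  define S where "S = {x. \<bar>n \<bullet> x - b\<bar> \<le> 1 / 2}"
  have S: "S \<in> sets lborel" unfolding S_def by measurable
  have am: "area_measure F = distr (restrict_space lborel S) borel (plane_proj n b)"
    unfolding area_measure_def F infdist_plane S_def
    by (rule arg_cong[where f = "distr _ _"]) (simp add: closest_point_plane fun_eq_iff)
  have mp: "plane_proj n b \<in> measurable (restrict_space lborel S) borel"
    using borel_measurable_continuous_onI[OF continuous_plane_proj] by (intro measurable_restrict_space1) simp
  have fb: "f \<in> sets borel" using f(1) by (simp add: compact_imp_closed)
  have fH: "f \<subseteq> {y. n \<bullet> y = b}" using f(2) F by simp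
  have "plane_proj n b -` f \<inter> space (restrict_space lborel S) = prism n f"
    using mem_prism_iff[OF fH] by (auto simp: S_def space_restrict_space)
  then have "emeasure (area_measure F) f = emeasure (restrict_space lborel S) (prism n f)"
    unfolding am emeasure_distr[OF mp fb] by simp
  also have "\<dots> = emeasure lborel (prism n f)"
    using mem_prism_iff[OF fH] S by (intro emeasure_restrict_space) (auto simp: S_def)
  also have "\<dots> = emeasure lebesgue (prism n f)"
    using compact_prism[OF f(1)] by (simp add: compact_imp_closed)
  also have "\<dots> = 0"
    using negligible_prism_thin[OF fH f(3)] by (simp add: negligible_iff_null_sets null_sets_def)
  finally show ?thesis .
qed

end

section \<open>Traces as limits of local means\<close>

text \<open>
  The integral of a function that is not integrable is zero, so the bound holds for every \<open>g\<close>. It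
  serves for traces of the coefficient \<open>\<mu>\<close>, of which only a pointwise bound is known.
\<close>

lemma abs_integral_le_dominating:
  fixes g G :: "'a \<Rightarrow> real"
  assumes "integrable M G" "AE x in M. \<bar>g x\<bar> \<le> G x"
  shows "\<bar>integral\<^sup>L M g\<bar> \<le> integral\<^sup>L M G"
proof (cases "integrable M g")
  case True
  have "\<bar>integral\<^sup>L M g\<bar> \<le> integral\<^sup>L M (\<lambda>x. \<bar>g x\<bar>)"
    using integral_norm_bound[of M g] by simp
  also have "\<dots> \<le> integral\<^sup>L M G"
    using True assms by (intro integral_mono_AE) auto
  finally show ?thesis .
next
  case False
  have "0 \<le> integral\<^sup>L M G"
    using assms(2) by (intro integral_nonneg_AE) (auto elim!: eventually_mono)
  with False show ?thesis by (simp add: not_integrable_integral_eq)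
qed

lemma
  fixes f g :: "'a \<Rightarrow> real"
  assumes m: "f \<in> borel_measurable M" "g \<in> borel_measurable M"
    and i: "integrable M (\<lambda>x. (f x)\<^sup>2)" "integrable M (\<lambda>x. (g x)\<^sup>2)"
  shows integrable_product_of_squares: "integrable M (\<lambda>x. f x * g x)"
    and Cauchy_Schwarz_integral:
      "\<bar>integral\<^sup>L M (\<lambda>x. f x * g x)\<bar> \<le> sqrt (integral\<^sup>L M (\<lambda>x. (f x)\<^sup>2)) * sqrt (integral\<^sup>L M (\<lambda>x. (g x)\<^sup>2))"
proof -
  have amgm: "\<bar>a * b\<bar> \<le> a\<^sup>2 + b\<^sup>2" for a b :: real
  proof -
    have "2 * (\<bar>a\<bar> * \<bar>b\<bar>) \<le> a\<^sup>2 + b\<^sup>2" using sum_squares_bound[of "\<bar>a\<bar>" "\<bar>b\<bar>"] by simp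
    moreover have "0 \<le> \<bar>a\<bar> * \<bar>b\<bar>" by simp
    ultimately show ?thesis unfolding abs_mult by linarith
  qed
  show fg: "integrable M (\<lambda>x. f x * g x)"
    by (rule Bochner_Integration.integrable_bound[OF Bochner_Integration.integrable_add[OF i]])
      (use m amgm in \<open>auto simp: abs_of_nonneg\<close>)
  define A B C where "A = integral\<^sup>L M (\<lambda>x. (f x)\<^sup>2)" and "B = integral\<^sup>L M (\<lambda>x. (g x)\<^sup>2)"
    and "C = integral\<^sup>L M (\<lambda>x. f x * g x)"
  have AB: "0 \<le> A" "0 \<le> B" by (simp_all add: A_def B_def)
  have q: "0 \<le> A - 2 * t * C + t\<^sup>2 * B" for t
  proof -
    have "0 \<le> integral\<^sup>L M (\<lambda>x. (f x - t * g x)\<^sup>2)" by simp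
    also have "\<dots> = integral\<^sup>L M (\<lambda>x. (f x)\<^sup>2 - (2 * t) * (f x * g x) + t\<^sup>2 * (g x)\<^sup>2)"
      by (simp add: power2_eq_square algebra_simps)
    also have "\<dots> = A - 2 * t * C + t\<^sup>2 * B" using i fg by (simp add: A_def B_def C_def)
    finally show ?thesis .
  qed
  have "C\<^sup>2 \<le> A * B"
  proof (cases "B = 0")
    case True
    have "C = 0"
    proof (rule ccontr)
      assume "C \<noteq> 0"
      then show False using q[of "(A + 1) / (2 * C)"] True AB by (simp add: field_simps)
    qed
    then show ?thesis using AB by simp
  next
    case False
    then have "0 < B" using AB by simp
    then show ?thesis using q[of "C / B"] by (simp add: field_simps power2_eq_square)
  qed
  then have "sqrt (C\<^sup>2) \<le> sqrt (A * B)" by (rule real_sqrt_le_mono)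
  then show "\<bar>C\<bar> \<le> sqrt A * sqrt B" by (simp add: real_sqrt_mult)
qed

lemma measure_convex_Int_ball_pos:
  fixes K :: "'a::euclidean_space set"
  assumes "compact K" "convex K" "interior K \<noteq> {}" "x \<in> K" "0 < r"
  shows "0 < measure lebesgue (K \<inter> ball x r)"
proof -
  have lm: "K \<inter> ball x r \<in> lmeasurable"
    using assms(1) by (intro bounded_set_imp_lmeasurable) (auto simp: compact_imp_closed bounded_Int)
  have "x \<in> closure (interior K)"
    using convex_closure_interior[OF assms(2,3)] assms(4) closure_subset by blast
  then obtain y where "y \<in> interior K" "dist y x < r"
    using assms(5) unfolding closure_approachable by blast
  then have "interior K \<inter> ball x r \<noteq> {}" by (auto simp: dist_commute)
  moreover have "open (interior K \<inter> ball x r)" by (intro open_Int) auto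
  ultimately have "\<not> negligible (K \<inter> ball x r)"
    using open_not_negligible negligible_subset interior_subset by (metis Int_mono subset_refl)
  then show ?thesis
    using lm negligible_iff_measure[of "K \<inter> ball x r"] by (simp add: zero_less_measure_iff measure_nonneg less_le)
qed

lemma AE_lebesgue_on_subset:
  assumes "AE x in lebesgue_on S. P x" "T \<subseteq> S" "S \<in> sets lebesgue" "T \<in> sets lebesgue"
  shows "AE x in lebesgue_on T. P x"
  using assms by (auto simp: AE_restrict_space_iff elim!: eventually_mono)

lemma abs_local_mean_le:
  assumes K: "compact K" "convex K" "interior K \<noteq> {}" "x \<in> K" "0 < r"
    and g: "AE y in lebesgue_on K. dist x y < r \<longrightarrow> \<bar>g y\<bar> \<le> B"
  shows "\<bar>local_mean K g x r\<bar> \<le> B"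
proof -
  have lm: "K \<inter> ball x r \<in> lmeasurable"
    using K(1) by (intro bounded_set_imp_lmeasurable) (auto simp: compact_imp_closed bounded_Int)
  have KL: "K \<in> sets lebesgue" using K(1) by (simp add: compact_imp_closed)
  have "AE y in lebesgue_on (K \<inter> ball x r). \<bar>g y\<bar> \<le> B"
    using g KL lm by (auto simp: AE_restrict_space_iff fmeasurableD elim!: eventually_mono)
  moreover have "integrable (lebesgue_on (K \<inter> ball x r)) (\<lambda>y. B)"
    by (rule finite_measure.integrable_const[OF finite_measure_lebesgue_on[OF lm]])
  ultimately have "\<bar>integral\<^sup>L (lebesgue_on (K \<inter> ball x r)) g\<bar> \<le> integral\<^sup>L (lebesgue_on (K \<inter> ball x r)) (\<lambda>y. B)"
    by (intro abs_integral_le_dominating)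
  also have "\<dots> = B * measure lebesgue (K \<inter> ball x r)"
    using lm by (simp add: measure_restrict_space fmeasurableD)
  finally show ?thesis
    using measure_convex_Int_ball_pos[OF K] by (simp add: local_mean_def abs_divide pos_divide_le_eq)
qed

lemma measurable_lebesgue_on_AE_eq:
  fixes g :: "'a::euclidean_space \<Rightarrow> 'b::euclidean_space"
  assumes "p \<in> borel_measurable (lebesgue_on S)" "AE x in lebesgue_on S. g x = p x" "S \<in> sets lebesgue"
  shows "g \<in> borel_measurable (lebesgue_on S)"
proof -
  have "AE x in lebesgue. x \<in> S \<longrightarrow> g x = p x"
    using assms(2,3) by (simp add: AE_restrict_space_iff)
  then have "AE x in lebesgue. (if x \<in> S then p x else 0) = (if x \<in> S then g x else 0)"
    by eventually_elim auto
  then have "(\<lambda>x. if x \<in> S then g x else 0) \<in> borel_measurable lebesgue"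
    by (rule borel_measurable_AE[OF borel_measurable_if_I[OF assms(1,3)]])
  then show ?thesis by (rule borel_measurable_if_D)
qed

lemma
  fixes f :: "'a::euclidean_space \<Rightarrow> 'b::euclidean_space"
  assumes S: "S \<in> sets lebesgue" "T \<in> sets lebesgue" and n: "negligible (S - T)" "negligible (T - S)"
  shows measurable_lebesgue_on_spike:
      "f \<in> borel_measurable (lebesgue_on S) \<Longrightarrow> f \<in> borel_measurable (lebesgue_on T)"
    and AE_lebesgue_on_spike: "(AE x in lebesgue_on S. P x) \<Longrightarrow> (AE x in lebesgue_on T. P x)"
    and integrable_lebesgue_on_spike:
      "integrable (lebesgue_on S) f \<Longrightarrow> integrable (lebesgue_on T) f"
proof -
  have nn: "AE x in lebesgue. x \<notin> S - T" "AE x in lebesgue. x \<notin> T - S"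
    using n by (simp_all only: negligible_iff_null_sets AE_not_in)
  then have st: "AE x in lebesgue. x \<in> S \<longleftrightarrow> x \<in> T" by eventually_elim blast
  then have ae: "AE x in lebesgue. (if x \<in> S then f x else 0) = (if x \<in> T then f x else 0)"
    by eventually_elim auto
  show m: "f \<in> borel_measurable (lebesgue_on T)" if "f \<in> borel_measurable (lebesgue_on S)"
    using borel_measurable_AE[OF borel_measurable_if_I[OF that S(1)] ae] by (rule borel_measurable_if_D)
  show "AE x in lebesgue_on T. P x" if "AE x in lebesgue_on S. P x"
  proof -
    have "AE x in lebesgue. x \<in> S \<longrightarrow> P x" using that S by (simp add: AE_restrict_space_iff)
    with st have "AE x in lebesgue. x \<in> T \<longrightarrow> P x" by eventually_elim auto
    then show ?thesis using S by (simp add: AE_restrict_space_iff)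
  qed
  show i: "integrable (lebesgue_on T) f" if "integrable (lebesgue_on S) f"
  proof -
    have "integrable lebesgue (\<lambda>x. if x \<in> T then f x else 0)"
    proof (rule Bochner_Integration.integrable_cong_AE_imp[OF _ _ ae])
      show "integrable lebesgue (\<lambda>x. if x \<in> S then f x else 0)"
        using that S by (simp add: Lebesgue_Measure.integrable_restrict_UNIV)
      show "(\<lambda>x. if x \<in> T then f x else 0) \<in> borel_measurable lebesgue"
        by (rule borel_measurable_if_I[OF m[OF borel_measurable_integrable[OF that]] S(2)])
    qed
    then show ?thesis using S by (simp add: Lebesgue_Measure.integrable_restrict_UNIV)
  qed
qed

lemma measurable_lebesgue_on_subset:
  "f \<in> borel_measurable (lebesgue_on S) \<Longrightarrow> T \<subseteq> S \<Longrightarrow> f \<in> borel_measurable (lebesgue_on T)"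
  by (rule measurable_restrict_mono)

text \<open>
  The means of \<open>p - p x\<close> over small neighbourhoods of \<open>x\<close> are small by continuity of \<open>p\<close>.
\<close>

lemma local_mean_tendsto:
  assumes K: "compact K" "convex K" "interior K \<noteq> {}" "x \<in> K"
    and p: "continuous_on UNIV p" and g: "AE y in lebesgue_on K. g y = p y"
  shows "((\<lambda>r. local_mean K g x r) \<longlongrightarrow> p x) (at_right 0)"
proof (rule tendstoI)
  fix e :: real assume e: "0 < e"
  obtain d where d: "0 < d" "\<And>y. dist y x < d \<Longrightarrow> dist (p y) (p x) < e / 2"
    using p[unfolded continuous_on_iff, rule_format, of x "e / 2"] e by auto
  have KL: "K \<in> sets lebesgue" using K(1) by (simp add: compact_imp_closed)
  have gm: "g \<in> borel_measurable (lebesgue_on K)"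
    by (rule measurable_lebesgue_on_AE_eq[OF continuous_imp_measurable_on_sets_lebesgue[OF _ KL] g KL])
      (rule continuous_on_subset[OF p subset_UNIV])
  obtain P where P: "\<And>y. y \<in> K \<Longrightarrow> \<bar>p y\<bar> \<le> P"
    using compact_imp_bounded[OF compact_continuous_image[OF continuous_on_subset[OF p subset_UNIV] K(1)]]
    by (auto simp: bounded_iff)
  have "dist (local_mean K g x r) (p x) < e" if r: "0 < r" "r < d" for r
  proof -
    define S where "S = K \<inter> ball x r"
    have lm: "S \<in> lmeasurable" unfolding S_def
      using K(1) by (intro bounded_set_imp_lmeasurable) (auto simp: compact_imp_closed bounded_Int)
    have SK: "S \<subseteq> K" "S \<in> sets lebesgue" using lm by (auto simp: S_def)
    have ci: "integrable (lebesgue_on S) (\<lambda>y. a)" for a :: real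
      by (rule finite_measure.integrable_const[OF finite_measure_lebesgue_on[OF lm]])
    have "AE y in lebesgue_on S. norm (g y) \<le> norm P"
      using AE_lebesgue_on_subset[OF g SK(1) KL SK(2)] SK P
      by (auto simp: AE_restrict_space_iff elim!: eventually_mono) (smt (verit) subsetD)
    moreover have "g \<in> borel_measurable (lebesgue_on S)"
      by (rule measurable_lebesgue_on_subset[OF gm SK(1)])
    ultimately have gi: "integrable (lebesgue_on S) g"
      using Bochner_Integration.integrable_bound[OF ci[of P]] by blast
    have "\<bar>local_mean K (\<lambda>y. g y - p x) x r\<bar> \<le> e / 2"
      using g d(2) r by (intro abs_local_mean_le K r(1))
        (auto elim!: eventually_mono simp: dist_commute dist_real_def intro: less_imp_le)
    moreover have "local_mean K (\<lambda>y. g y - p x) x r = local_mean K g x r - p x"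
      using gi ci[of "p x"] measure_convex_Int_ball_pos[OF K r(1)] lm
      by (simp add: local_mean_def S_def measure_restrict_space fmeasurableD field_simps)
    ultimately show ?thesis using e by (simp add: dist_real_def)
  qed
  then show "\<forall>\<^sub>F r in at_right 0. dist (local_mean K g x r) (p x) < e"
    unfolding eventually_at_right_field using d(1) by (intro exI[of _ d]) auto
qed

lemma scalar_trace_eq:
  assumes "compact K" "convex K" "interior K \<noteq> {}" "x \<in> K"
    and "continuous_on UNIV p" "AE y in lebesgue_on K. g y = p y"
  shows "scalar_trace K g x = p x"
proof -
  have "((\<lambda>r. ereal (local_mean K g x r)) \<longlongrightarrow> ereal (p x)) (at_right 0)"
    using local_mean_tendsto[OF assms] by simp
  then have "Limsup (at_right 0) (\<lambda>r. ereal (local_mean K g x r)) = ereal (p x)"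
    by (intro lim_imp_Limsup) (auto simp: trivial_limit_at_right_real)
  then show ?thesis by (simp add: scalar_trace_def)
qed

text \<open>
  Here \<open>g\<close> need not have a limit at \<open>x\<close>, but its means eventually stay in an interval slightly larger
  than \<open>[- p x, p x]\<close>, and so does their upper limit.
\<close>

lemma abs_scalar_trace_le:
  assumes K: "compact K" "convex K" "interior K \<noteq> {}" "x \<in> K"
    and p: "continuous_on UNIV p" and g: "AE y in lebesgue_on K. \<bar>g y\<bar> \<le> p y"
  shows "\<bar>scalar_trace K g x\<bar> \<le> p x"
proof (rule field_le_epsilon)
  fix e :: real assume e: "0 < e"
  obtain d where d: "0 < d" "\<And>y. dist y x < d \<Longrightarrow> dist (p y) (p x) < e"
    using p[unfolded continuous_on_iff, rule_format, of x e] e by auto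
  define L where "L = Limsup (at_right 0) (\<lambda>r. ereal (local_mean K g x r))"
  have "\<bar>local_mean K g x r\<bar> \<le> p x + e" if r: "0 < r" "r < d" for r
    using g
  proof (intro abs_local_mean_le K r(1), elim eventually_mono, intro impI)
    fix y assume "\<bar>g y\<bar> \<le> p y" "dist x y < r"
    moreover from this r d(2)[of y] have "dist (p y) (p x) < e" by (simp add: dist_commute)
    ultimately show "\<bar>g y\<bar> \<le> p x + e" by (simp add: dist_real_def abs_less_iff)
  qed
  then have ev: "\<forall>\<^sub>F r in at_right 0. \<bar>local_mean K g x r\<bar> \<le> p x + e"
    using d(1) by (auto simp: eventually_at_right_field)
  have "L \<le> ereal (p x + e)" unfolding L_def
    by (rule Limsup_bounded) (use ev in \<open>auto elim!: eventually_mono\<close>)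
  moreover have "ereal (- (p x + e)) \<le> L"
  proof -
    have "ereal (- (p x + e)) \<le> Liminf (at_right 0) (\<lambda>r. ereal (local_mean K g x r))"
      by (rule Liminf_bounded) (use ev in \<open>auto elim!: eventually_mono\<close>)
    also have "\<dots> \<le> L" unfolding L_def
      by (rule Liminf_le_Limsup) (simp add: trivial_limit_at_right_real)
    finally show ?thesis .
  qed
  ultimately have "\<bar>real_of_ereal L\<bar> \<le> p x + e" by (cases L) auto
  then show "\<bar>scalar_trace K g x\<bar> \<le> p x + e" by (simp add: scalar_trace_def L_def)
qed

lemma field_trace_eq:
  assumes "compact K" "convex K" "interior K \<noteq> {}" "x \<in> K"
    and p: "continuous_on UNIV p" and "AE y in lebesgue_on K. v y = p y"
  shows "field_trace K v x = p x"
proof -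
  have "scalar_trace K (\<lambda>y. v y $ i) x = p x $ i" for i
    using assms(6) by (intro scalar_trace_eq assms continuous_intros p) (auto elim!: eventually_mono)
  then show ?thesis by (simp add: field_trace_def vec_eq_iff)
qed

lemma norm_field_trace_weighted_le:
  assumes K: "compact K" "convex K" "interior K \<noteq> {}" "x \<in> K"
    and q: "continuous_on UNIV q" "AE y in lebesgue_on K. Q y = q y"
    and m: "0 < m" "AE y in lebesgue_on K. m \<le> \<mu> y"
  shows "norm (field_trace K (\<lambda>y. Q y /\<^sub>R \<mu> y) x) \<le> norm (q x) / m"
proof -
  have "\<bar>scalar_trace K (\<lambda>y. (Q y /\<^sub>R \<mu> y) $ i) x\<bar> \<le> \<bar>q x $ i\<bar> / m" for i
  proof (rule abs_scalar_trace_le[OF K])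
    show "continuous_on UNIV (\<lambda>x. \<bar>q x $ i\<bar> / m)" by (intro continuous_intros q) (use m in auto)
    show "AE y in lebesgue_on K. \<bar>(Q y /\<^sub>R \<mu> y) $ i\<bar> \<le> \<bar>q y $ i\<bar> / m"
      using q(2) m(2)
    proof eventually_elim
      case (elim y)
      then show ?case using m(1) by (simp add: abs_mult field_simps mult_right_mono)
    qed
  qed
  then have "norm (field_trace K (\<lambda>y. Q y /\<^sub>R \<mu> y) x) \<le> norm ((1 / m) *\<^sub>R q x)"
    using m by (intro norm_le_componentwise_cart) (simp add: field_trace_def abs_mult)
  then show ?thesis using m by simp
qed

section \<open>Square-integrable fields and projection onto a finite span\<close>

lemma L2_field_integrable_inner:
  assumes "L2_field D v" "L2_field D w"
  shows "integrable (lebesgue_on D) (\<lambda>x. v x \<bullet> w x)"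
    and "integrable (lebesgue_on D) (\<lambda>x. norm (v x) * norm (w x))"
proof -
  have m: "v \<in> borel_measurable (lebesgue_on D)" "w \<in> borel_measurable (lebesgue_on D)"
    using assms by (auto simp: L2_field_def)
  show n: "integrable (lebesgue_on D) (\<lambda>x. norm (v x) * norm (w x))"
    using assms m by (intro integrable_product_of_squares) (auto simp: L2_field_def)
  show "integrable (lebesgue_on D) (\<lambda>x. v x \<bullet> w x)"
    by (rule Bochner_Integration.integrable_bound[OF n]) (use m in \<open>auto simp: Cauchy_Schwarz_ineq2\<close>)
qed

lemma L2_norm_nonneg: "0 \<le> L2_norm D v"
  by (simp add: L2_norm_def)

lemma L2_norm_square: "(L2_norm D v)\<^sup>2 = integral\<^sup>L (lebesgue_on D) (\<lambda>x. (norm (v x))\<^sup>2)"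
  by (simp add: L2_norm_def)

lemma abs_integral_weighted_inner_le:
  assumes "L2_field D v" "L2_field D w" "AE x in lebesgue_on D. \<bar>c x\<bar> \<le> C" "0 \<le> C"
  shows "\<bar>integral\<^sup>L (lebesgue_on D) (\<lambda>x. c x * (v x \<bullet> w x))\<bar> \<le> C * (L2_norm D v * L2_norm D w)"
proof -
  have m: "v \<in> borel_measurable (lebesgue_on D)" "w \<in> borel_measurable (lebesgue_on D)"
    using assms by (auto simp: L2_field_def)
  have "\<bar>integral\<^sup>L (lebesgue_on D) (\<lambda>x. c x * (v x \<bullet> w x))\<bar>
      \<le> integral\<^sup>L (lebesgue_on D) (\<lambda>x. C * (norm (v x) * norm (w x)))"
  proof (rule abs_integral_le_dominating)
    show "integrable (lebesgue_on D) (\<lambda>x. C * (norm (v x) * norm (w x)))"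
      using L2_field_integrable_inner(2)[OF assms(1,2)] by simp
    show "AE x in lebesgue_on D. \<bar>c x * (v x \<bullet> w x)\<bar> \<le> C * (norm (v x) * norm (w x))"
      using assms(3)
      by eventually_elim (auto simp: abs_mult intro!: mult_mono Cauchy_Schwarz_ineq2 assms(4))
  qed
  also have "\<dots> = C * integral\<^sup>L (lebesgue_on D) (\<lambda>x. norm (v x) * norm (w x))" by simp
  also have "\<dots> \<le> C * (L2_norm D v * L2_norm D w)"
    using Cauchy_Schwarz_integral[of "\<lambda>x. norm (v x)" "lebesgue_on D" "\<lambda>x. norm (w x)"] assms m
    by (intro mult_left_mono) (auto simp: L2_field_def L2_norm_def)
  finally show ?thesis .
qed

lemma L2_field_zero: "L2_field D (\<lambda>x. 0)"
  by (simp add: L2_field_def)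

lemma L2_field_add:
  assumes "L2_field D v" "L2_field D w"
  shows "L2_field D (\<lambda>x. v x + w x)"
proof -
  have m: "v \<in> borel_measurable (lebesgue_on D)" "w \<in> borel_measurable (lebesgue_on D)"
    using assms by (auto simp: L2_field_def)
  have "(norm (v x + w x))\<^sup>2 = (norm (v x))\<^sup>2 + 2 * (v x \<bullet> w x) + (norm (w x))\<^sup>2" for x
    by (simp add: power2_norm_eq_inner inner_add_left inner_add_right inner_commute)
  then show ?thesis
    using assms m L2_field_integrable_inner(1)[OF assms] by (simp add: L2_field_def)
qed

lemma L2_field_scale: "L2_field D v \<Longrightarrow> L2_field D (\<lambda>x. k *\<^sub>R v x)"
  by (auto simp: L2_field_def power_mult_distrib intro!: borel_measurable_scaleR)

lemma L2_field_diff: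
  assumes "L2_field D v" "L2_field D w"
  shows "L2_field D (\<lambda>x. v x - w x)"
  using L2_field_add[OF assms(1) L2_field_scale[OF assms(2), of "-1"]] by simp

lemma L2_field_sum:
  "finite A \<Longrightarrow> (\<And>a. a \<in> A \<Longrightarrow> L2_field D (f a)) \<Longrightarrow> L2_field D (\<lambda>x. \<Sum>a\<in>A. f a x)"
  by (induction A rule: finite_induct) (simp_all add: L2_field_zero L2_field_add)

lemma L2_field_continuous_piece:
  assumes "bounded D" "D \<in> sets lebesgue" "open U" "continuous_on UNIV p"
  shows "L2_field D (\<lambda>x. indicator U x *\<^sub>R p x)"
proof -
  have "compact (closure D)" using assms(1) by simp
  then have "compact (p ` closure D)"
    by (intro compact_continuous_image continuous_on_subset[OF assms(4)]) auto
  then obtain B where "\<forall>y\<in>p ` closure D. norm y \<le> B"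
    by (metis bounded_iff compact_imp_bounded)
  then have B: "norm (p x) \<le> B" if "x \<in> closure D" for x using that by blast
  have lm: "D \<in> lmeasurable" using assms by (intro bounded_set_imp_lmeasurable)
  have pm: "p \<in> borel_measurable borel" using borel_measurable_continuous_onI[OF assms(4)] .
  have "(\<lambda>x. indicator U x *\<^sub>R p x) \<in> borel_measurable borel"
    using assms(3) by (intro borel_measurable_scaleR borel_measurable_indicator pm) simp
  then have m: "(\<lambda>x. indicator U x *\<^sub>R p x) \<in> borel_measurable (lebesgue_on D)"
    by (intro measurable_restrict_space1 measurable_completion) simp
  have "integrable (lebesgue_on D) (\<lambda>x. (norm (indicator U x *\<^sub>R p x))\<^sup>2)"
  proof (rule Bochner_Integration.integrable_bound)
    show "integrable (lebesgue_on D) (\<lambda>x. B\<^sup>2)"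
      by (rule finite_measure.integrable_const[OF finite_measure_lebesgue_on[OF lm]])
    show "AE x in lebesgue_on D. norm ((norm (indicator U x *\<^sub>R p x))\<^sup>2) \<le> norm (B\<^sup>2)"
    proof (rule AE_I2)
      fix x assume "x \<in> space (lebesgue_on D)"
      then have "norm (p x) \<le> B" using B closure_subset by auto
      then have "norm (indicator U x *\<^sub>R p x) \<le> B"
        by (auto simp: indicator_def intro: order_trans[OF norm_ge_zero])
      then show "norm ((norm (indicator U x *\<^sub>R p x))\<^sup>2) \<le> norm (B\<^sup>2)"
        by (simp add: power_mono)
    qed
  qed (use m in measurable)
  with m show ?thesis by (simp add: L2_field_def)
qed

lemma L2_field_continuous:
  assumes "bounded D" "D \<in> sets lebesgue" "continuous_on UNIV p"
  shows "L2_field D p"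
  using L2_field_continuous_piece[OF assms(1,2) open_UNIV assms(3)] by simp

definition L2_inner :: "(real^3) set \<Rightarrow> field3 \<Rightarrow> field3 \<Rightarrow> real" where
  "L2_inner D v w = integral\<^sup>L (lebesgue_on D) (\<lambda>x. v x \<bullet> w x)"

lemma L2_inner_add_right:
  "L2_field D v \<Longrightarrow> L2_field D w \<Longrightarrow> L2_field D w' \<Longrightarrow>
    L2_inner D v (\<lambda>x. w x + w' x) = L2_inner D v w + L2_inner D v w'"
  by (simp add: L2_inner_def inner_add_right L2_field_integrable_inner)

lemma L2_inner_diff_left:
  "L2_field D v \<Longrightarrow> L2_field D v' \<Longrightarrow> L2_field D w \<Longrightarrow>
    L2_inner D (\<lambda>x. v x - v' x) w = L2_inner D v w - L2_inner D v' w"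
  by (simp add: L2_inner_def inner_diff_left L2_field_integrable_inner)

lemma L2_inner_scale_left: "L2_inner D (\<lambda>x. k *\<^sub>R v x) w = k * L2_inner D v w"
  by (simp add: L2_inner_def)

lemma L2_inner_scale_right: "L2_inner D v (\<lambda>x. k *\<^sub>R w x) = k * L2_inner D v w"
  by (simp add: L2_inner_def)

lemma abs_L2_inner_le:
  assumes "L2_field D v" "L2_field D w"
  shows "\<bar>L2_inner D v w\<bar> \<le> L2_norm D v * L2_norm D w"
  using abs_integral_weighted_inner_le[OF assms, of "\<lambda>x. 1" 1] by (simp add: L2_inner_def)

lemma L2_inner_self: "L2_inner D v v = (L2_norm D v)\<^sup>2"
  by (simp add: L2_inner_def L2_norm_square power2_norm_eq_inner)

text \<open>
  The linear span, generated one summand at a time because the fields are plain functions.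
\<close>

inductive_set field_span :: "field3 set \<Rightarrow> field3 set" for B where
  zero: "(\<lambda>x. 0) \<in> field_span B"
| add: "q \<in> field_span B \<Longrightarrow> b \<in> B \<Longrightarrow> (\<lambda>x. q x + k *\<^sub>R b x) \<in> field_span B"

lemma field_span_add:
  assumes "r \<in> field_span B" "q \<in> field_span B"
  shows "(\<lambda>x. q x + r x) \<in> field_span B"
  using assms
proof (induction rule: field_span.induct)
  case (add r b k)
  have "(\<lambda>x. (q x + r x) + k *\<^sub>R b x) \<in> field_span B"
    by (rule field_span.add) (use add in auto)
  then show ?case by (simp add: add.assoc)
qed simp

lemma field_span_scale:
  assumes "r \<in> field_span B"
  shows "(\<lambda>x. c *\<^sub>R r x) \<in> field_span B"
  using assms
proof (induction rule: field_span.induct)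
  case (add r b k)
  have "(\<lambda>x. c *\<^sub>R r x + (c * k) *\<^sub>R b x) \<in> field_span B"
    by (rule field_span.add) (use add in auto)
  then show ?case by (simp add: scaleR_add_right)
qed (simp add: field_span.zero)

lemma field_span_base: "b \<in> B \<Longrightarrow> b \<in> field_span B"
  using field_span.add[OF field_span.zero, of b B 1] by simp

lemma field_span_sum:
  "finite A \<Longrightarrow> (\<And>a. a \<in> A \<Longrightarrow> f a \<in> field_span B) \<Longrightarrow> (\<lambda>x. \<Sum>a\<in>A. f a x) \<in> field_span B"
  by (induction A rule: finite_induct) (simp_all add: field_span.zero field_span_add)

lemma field_span_mono:
  assumes "r \<in> field_span B" "B \<subseteq> C" shows "r \<in> field_span C"
  using assms by (induction rule: field_span.induct) (auto intro: field_span.intros)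

lemma L2_field_span:
  assumes "r \<in> field_span B" "\<And>b. b \<in> B \<Longrightarrow> L2_field D b" shows "L2_field D r"
  using assms by (induction rule: field_span.induct) (auto intro: L2_field_zero L2_field_add[OF _ L2_field_scale])

lemma L2_inner_span_eq_0:
  assumes "r \<in> field_span B" "\<And>b. b \<in> B \<Longrightarrow> L2_field D b" "L2_field D w"
    and "\<And>b. b \<in> B \<Longrightarrow> L2_inner D w b = 0"
  shows "L2_inner D w r = 0"
  using assms
proof (induction rule: field_span.induct)
  case zero
  then show ?case by (simp add: L2_inner_def)
next
  case (add q b k)
  have q: "L2_field D q" by (rule L2_field_span[OF add.hyps(1) add.prems(1)])
  have b: "L2_field D b" by (rule add.prems(1)[OF add.hyps(2)])
  show ?case
    using add.IH[OF add.prems] add.prems(3)[OF add.hyps(2)]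
    by (simp only: L2_inner_add_right[OF add.prems(2) q L2_field_scale[OF b]] L2_inner_scale_right)
qed

text \<open>
  Orthogonalisation: the part \<open>e\<close> of the new field \<open>b\<close> orthogonal to the old ones is used to correct the projection
  on the old span.
\<close>

lemma exists_L2_projection_on_span:
  assumes "finite B" "\<And>b. b \<in> B \<Longrightarrow> L2_field D b" "L2_field D w"
  shows "\<exists>q\<in>field_span B. \<forall>b\<in>B. L2_inner D (\<lambda>x. w x - q x) b = 0"
  using assms
proof (induction arbitrary: w rule: finite_induct)
  case empty
  then show ?case using field_span.zero by auto
next
  case (insert b B)
  have LB: "L2_field D b'" if "b' \<in> B" for b' using insert.prems that by simp
  have Lb: "L2_field D b" using insert.prems by simp
  obtain p where p: "p \<in> field_span B" "\<And>b'. b' \<in> B \<Longrightarrow> L2_inner D (\<lambda>x. b x - p x) b' = 0"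
    using insert.IH[OF LB Lb] by blast
  obtain q where q: "q \<in> field_span B" "\<And>b'. b' \<in> B \<Longrightarrow> L2_inner D (\<lambda>x. w x - q x) b' = 0"
    using insert.IH[OF LB insert.prems(2)] by blast
  define e where "e = (\<lambda>x. b x - p x)"
  \<comment> \<open>If \<open>e\<close> vanishes almost everywhere then \<open>c\<close> is zero, the value of division by zero, and no correction is due.\<close>
  define c where "c = L2_inner D (\<lambda>x. w x - q x) e / L2_inner D e e"
  define r where "r = (\<lambda>x. q x + c *\<^sub>R e x)"
  note Lp = L2_field_span[OF p(1) LB] and Lq = L2_field_span[OF q(1) LB]
  have Le: "L2_field D e" unfolding e_def by (intro L2_field_diff Lb Lp)
  have Lwq: "L2_field D (\<lambda>x. w x - q x)" by (intro L2_field_diff Lq insert.prems)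
  have wr: "(\<lambda>x. w x - r x) = (\<lambda>x. (w x - q x) - c *\<^sub>R e x)" by (simp add: r_def fun_eq_iff algebra_simps)
  have Lwr: "L2_field D (\<lambda>x. w x - r x)" unfolding wr by (intro L2_field_diff Lwq L2_field_scale Le)
  have ip: "L2_inner D (\<lambda>x. w x - r x) u = L2_inner D (\<lambda>x. w x - q x) u - c * L2_inner D e u"
    if "L2_field D u" for u
    unfolding wr using L2_inner_diff_left[OF Lwq L2_field_scale[OF Le] that] by (simp add: L2_inner_scale_left)
  have oB: "L2_inner D (\<lambda>x. w x - r x) b' = 0" if "b' \<in> B" for b'
    using ip[OF LB[OF that]] q(2)[OF that] p(2)[OF that] by (simp add: e_def)
  have oe: "L2_inner D (\<lambda>x. w x - r x) e = 0"
  proof (cases "L2_inner D e e = 0")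
    case True
    then have "L2_norm D e = 0" by (simp add: L2_inner_self)
    then have "L2_inner D (\<lambda>x. w x - q x) e = 0" using abs_L2_inner_le[OF Lwq Le] by simp
    then show ?thesis using ip[OF Le] True by simp
  next
    case False
    then show ?thesis using ip[OF Le] by (simp add: c_def)
  qed
  have "L2_inner D (\<lambda>x. w x - r x) (\<lambda>x. e x + p x) = 0"
    using L2_inner_add_right[OF Lwr Le Lp] oe L2_inner_span_eq_0[OF p(1) LB Lwr oB] by simp
  then have ob: "L2_inner D (\<lambda>x. w x - r x) b = 0" by (simp add: e_def)
  have pq: "p \<in> field_span (insert b B)" "q \<in> field_span (insert b B)"
    using field_span_mono p(1) q(1) by blast+
  moreover have "e = (\<lambda>x. b x + (-1) *\<^sub>R p x)" by (simp add: e_def)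
  ultimately have "e \<in> field_span (insert b B)"
    using field_span_add[OF field_span_scale[of p _ "-1"] field_span_base[OF insertI1]] by simp
  then have "r \<in> field_span (insert b B)"
    unfolding r_def using pq(2) by (intro field_span_add field_span_scale)
  moreover have "\<forall>b'\<in>insert b B. L2_inner D (\<lambda>x. w x - r x) b' = 0"
    unfolding ball_simps using ob oB by simp
  ultimately show ?case by (intro bexI[of _ r])
qed

lemma has_weak_curl_subset:
  assumes w: "has_weak_curl \<Omega> v w" and U: "U \<subseteq> \<Omega>" "U \<in> sets lebesgue" "\<Omega> \<in> sets lebesgue"
  shows "has_weak_curl U v w"
  unfolding has_weak_curl_def
proof (intro allI impI, elim conjE)
  fix \<phi> assume \<phi>: "smooth_field \<phi>" "compact (closure {x. \<phi> x \<noteq> 0})" "closure {x. \<phi> x \<noteq> 0} \<subseteq> U"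
  have z: "\<phi> x = 0" "curl \<phi> x = 0" if "x \<notin> U" for x
  proof -
    have "x \<notin> closure {x. \<phi> x \<noteq> 0}" using that \<phi>(3) by blast
    then show "\<phi> x = 0" "curl \<phi> x = 0"
      using closure_subset[of "{x. \<phi> x \<noteq> 0}"] curl_zero_outside_support[of x \<phi>] by auto
  qed
  have eq: "integral\<^sup>L (lebesgue_on U) f = integral\<^sup>L (lebesgue_on \<Omega>) f"
    if "\<And>x. x \<notin> U \<Longrightarrow> f x = 0" for f :: "real^3 \<Rightarrow> real"
  proof -
    have "(\<lambda>x. if x \<in> U then f x else 0) = (\<lambda>x. if x \<in> \<Omega> then f x else 0)"
      using that U(1) by (auto simp: fun_eq_iff)
    then show ?thesis
      using Lebesgue_Measure.integral_restrict_UNIV[OF U(2), of f]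
        Lebesgue_Measure.integral_restrict_UNIV[OF U(3), of f] by simp
  qed
  have "integral\<^sup>L (lebesgue_on \<Omega>) (\<lambda>x. v x \<bullet> curl \<phi> x) = integral\<^sup>L (lebesgue_on \<Omega>) (\<lambda>x. w x \<bullet> \<phi> x)"
    using w \<phi> U(1) unfolding has_weak_curl_def by blast
  then show "integral\<^sup>L (lebesgue_on U) (\<lambda>x. v x \<bullet> curl \<phi> x) = integral\<^sup>L (lebesgue_on U) (\<lambda>x. w x \<bullet> \<phi> x)"
    by (simp add: eq z)
qed

lemma has_weak_curl_add:
  assumes U: "bounded U" "U \<in> sets lebesgue"
    and L: "L2_field U v" "L2_field U w" "L2_field U v'" "L2_field U w'"
    and c: "has_weak_curl U v w" "has_weak_curl U v' w'"
  shows "has_weak_curl U (\<lambda>x. v x + v' x) (\<lambda>x. w x + w' x)"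
  unfolding has_weak_curl_def
proof (intro allI impI, elim conjE)
  fix \<phi> assume \<phi>: "smooth_field \<phi>" "compact (closure {x. \<phi> x \<noteq> 0})" "closure {x. \<phi> x \<noteq> 0} \<subseteq> U"
  have C: "C1 (\<lambda>x. \<phi> x $ j)" for j using \<phi>(1) by (auto simp: smooth_field_def)
  have "continuous_on UNIV \<phi>" by (rule continuous_on_vec3) (rule C1_D(3)[OF C])
  then have L1: "L2_field U \<phi>" by (rule L2_field_continuous[OF U])
  have L2: "L2_field U (curl \<phi>)" by (rule L2_field_continuous[OF U continuous_on_curl[OF C]])
  show "integral\<^sup>L (lebesgue_on U) (\<lambda>x. (v x + v' x) \<bullet> curl \<phi> x) =
      integral\<^sup>L (lebesgue_on U) (\<lambda>x. (w x + w' x) \<bullet> \<phi> x)"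
    using c \<phi> unfolding has_weak_curl_def
    by (simp add: inner_add_left L2_field_integrable_inner L1 L2 L)
qed

section \<open>Elements of a mesh\<close>

text \<open>
  Moving a boundary point in the direction \<open>e\<close> leads strictly above the graph, into an open set that is
  disjoint from the domain. Hence boundary points are not interior to the closure. This puts the
  interior of every element inside the domain.
\<close>

lemma lipschitz_domain_interior_closure:
  assumes "lipschitz_domain \<Omega>"
  shows "interior (closure \<Omega>) \<subseteq> \<Omega>"
proof (rule subsetI, rule ccontr)
  fix p assume p: "p \<in> interior (closure \<Omega>)" "p \<notin> \<Omega>"
  have op: "open \<Omega>" using assms by (simp add: lipschitz_domain_def)
  have "p \<in> frontier \<Omega>"
    using p op interior_subset[of "closure \<Omega>"] by (auto simp: frontier_def interior_open)
  then obtain e :: "real^3" and r L :: real and g :: "real^3 \<Rightarrow> real" where e: "norm e = 1" "0 < r" "L-lipschitz_on UNIV g" "\<And>x t. g (x + t *\<^sub>R e) = g x"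
    "\<And>x. x \<in> ball p r \<Longrightarrow> x \<in> \<Omega> \<longleftrightarrow> x \<bullet> e < g x"
    using assms unfolding lipschitz_domain_def by blast
  obtain d where d: "0 < d" "ball p d \<subseteq> closure \<Omega>" using p(1) by (auto simp: mem_interior)
  define t where "t = min d r / 2"
  have t: "0 < t" "t < d" "t < r" using d e(2) by (auto simp: t_def)
  define x where "x = p + t *\<^sub>R e"
  define U where "U = ball p r \<inter> {x. g x < x \<bullet> e}"
  have "dist p x = t" using t e(1) by (simp add: x_def dist_norm)
  then have xb: "x \<in> ball p d" "x \<in> ball p r" using t by auto
  have "continuous_on UNIV g" using e(3) by (rule lipschitz_on_continuous_on)
  then have oU: "open U" unfolding U_def
    by (intro open_Int open_ball open_Collect_less continuous_intros)
  have "g p \<le> p \<bullet> e" using e(5)[of p] e(2) p(2) by simp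
  then have "x \<in> U"
    using xb(2) t e(1,4) by (simp add: U_def x_def inner_add_left norm_eq_1)
  moreover have "U \<inter> \<Omega> = {}" using e(5) by (auto simp: U_def)
  then have "U \<inter> closure \<Omega> = {}" using open_Int_closure_eq_empty[OF oU] by blast
  ultimately show False using xb d by blast
qed

locale mesh =
  fixes \<sigma> :: real and \<Omega> :: "(real^3) set" and \<T> :: "(real^3) set set"
  assumes lip: "lipschitz_domain \<Omega>" and partition: "shape_regular_partition \<sigma> \<Omega> \<T>"
begin

abbreviation "faces_h \<equiv> faces \<Omega> \<T>"
abbreviation "curl_h \<equiv> elementwise_curl \<Omega> \<T>"
abbreviation "V_h \<equiv> dg_space \<Omega> \<T>"
abbreviation "V_sum \<equiv> sum_space \<Omega> \<T>"
abbreviation "Pi_h \<equiv> L2_projection \<Omega> \<T>"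
abbreviation "jump_h \<equiv> jump \<Omega> \<T>"
abbreviation "norm_h \<equiv> dg_norm \<Omega> \<T>"

lemma domain_bounded: "open \<Omega>" "bounded \<Omega>" "\<Omega> \<in> sets lebesgue"
  using lip by (auto simp: lipschitz_domain_def)

lemma finite_mesh: "finite \<T>" and Union_mesh: "\<Union>\<T> = closure \<Omega>"
  using partition by (auto simp: shape_regular_partition_def)

lemma disjoint_interiors:
  "K \<in> \<T> \<Longrightarrow> K' \<in> \<T> \<Longrightarrow> K \<noteq> K' \<Longrightarrow> interior K \<inter> interior K' = {}"
  using partition by (auto simp: shape_regular_partition_def)

lemma inscribed_ball:
  assumes "K \<in> \<T>"
  obtains c \<rho> where "0 < \<rho>" "ball c (\<rho> / 2) \<subseteq> K" "diameter K \<le> \<sigma> * \<rho>"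
proof -
  have "\<exists>c \<rho>. 0 < \<rho> \<and> ball c (\<rho> / 2) \<subseteq> K \<and> diameter K \<le> \<sigma> * \<rho>"
    using partition assms unfolding shape_regular_partition_def by metis
  then show ?thesis using that by metis
qed

lemma polytope_element:
  assumes "K \<in> \<T>" shows "polytope K"
proof -
  have "tetrahedron K \<or> hexahedron K" using assms partition by (simp add: shape_regular_partition_def)
  then show ?thesis by (auto simp: tetrahedron_def hexahedron_def intro: simplex_imp_polytope)
qed

lemma element_body:
  assumes "K \<in> \<T>"
  shows "compact K" "convex K" "interior K \<noteq> {}" "K \<in> sets lebesgue"
proof -
  show c: "compact K" "convex K"
    using polytope_element[OF assms] by (auto simp: polytope_imp_compact polytope_imp_convex)
  then show "K \<in> sets lebesgue" by (simp add: compact_imp_closed)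
  obtain c \<rho> where "0 < \<rho>" "ball c (\<rho> / 2) \<subseteq> K" using inscribed_ball[OF assms] .
  then have "c \<in> interior K" by (intro interiorI[of "ball c (\<rho> / 2)"]) auto
  then show "interior K \<noteq> {}" by blast
qed

lemma diameter_pos:
  assumes "K \<in> \<T>" shows "0 < diameter K"
proof -
  obtain c \<rho> where c: "0 < \<rho>" "ball c (\<rho> / 2) \<subseteq> K" using inscribed_ball[OF assms] .
  have "diameter (ball c (\<rho> / 2)) \<le> diameter K"
    using c element_body(1)[OF assms] by (intro diameter_subset) (auto simp: compact_imp_bounded)
  then show ?thesis using c by simp
qed

lemma interior_element_subset:
  assumes "K \<in> \<T>" shows "interior K \<subseteq> \<Omega>"
proof -
  have "interior K \<subseteq> interior (closure \<Omega>)" using assms Union_mesh by (intro interior_mono) auto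
  then show ?thesis using lipschitz_domain_interior_closure[OF lip] by blast
qed

lemma negligible_element_boundary:
  assumes "K \<in> \<T>" shows "negligible (K - interior K)"
  using negligible_convex_frontier[OF element_body(2)[OF assms]] element_body(1)[OF assms]
  by (simp add: frontier_def compact_imp_closed)

lemma elements_avoid_interior:
  "K \<in> \<T> \<Longrightarrow> K' \<in> \<T> \<Longrightarrow> K \<noteq> K' \<Longrightarrow> K' \<inter> interior K = {}"
  using disjoint_interiors_imp_avoids_interior element_body disjoint_interiors by metis

lemma interior_lebesgue: "interior K \<in> sets lebesgue" by simp

lemma element_spike:
  assumes "K \<in> \<T>"
  shows "negligible (K - interior K)" "negligible (interior K - K)"
  using negligible_element_boundary[OF assms] interior_subset[of K]
  by (auto simp: Diff_eq_empty_iff[THEN iffD2])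

lemma measurable_on_element:
  fixes f :: "real^3 \<Rightarrow> 'b::euclidean_space"
  assumes "K \<in> \<T>" "f \<in> borel_measurable (lebesgue_on \<Omega>)"
  shows "f \<in> borel_measurable (lebesgue_on K)"
  by (rule measurable_lebesgue_on_spike[OF interior_lebesgue element_body(4)[OF assms(1)]
      element_spike(2,1)[OF assms(1)] measurable_lebesgue_on_subset[OF assms(2) interior_element_subset[OF assms(1)]]])

lemma AE_on_element:
  assumes "K \<in> \<T>" "AE x in lebesgue_on \<Omega>. P x"
  shows "AE x in lebesgue_on K. P x"
  by (rule AE_lebesgue_on_spike[OF interior_lebesgue element_body(4)[OF assms(1)] element_spike(2,1)[OF assms(1)]
      AE_lebesgue_on_subset[OF assms(2) interior_element_subset[OF assms(1)] domain_bounded(3) interior_lebesgue]])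

lemma integrable_on_interior:
  fixes f :: "real^3 \<Rightarrow> real"
  assumes "K \<in> \<T>" "integrable (lebesgue_on \<Omega>) f"
  shows "integrable (lebesgue_on (interior K)) f"
proof -
  have "set_integrable lebesgue \<Omega> f"
    using assms(2) domain_bounded(3) by (simp add: set_integrable_def integrable_restrict_space)
  then have "set_integrable lebesgue (interior K) f"
    by (rule set_integrable_subset) (simp_all add: interior_element_subset assms)
  then show ?thesis by (simp add: set_integrable_def integrable_restrict_space)
qed

lemma integrable_on_element:
  fixes f :: "real^3 \<Rightarrow> real"
  assumes "K \<in> \<T>" "integrable (lebesgue_on \<Omega>) f"
  shows "integrable (lebesgue_on K) f"
  by (rule integrable_lebesgue_on_spike[OF interior_lebesgue element_body(4)[OF assms(1)]
      element_spike(2,1)[OF assms(1)] integrable_on_interior[OF assms]])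

lemma L2_field_on_element: "K \<in> \<T> \<Longrightarrow> L2_field \<Omega> v \<Longrightarrow> L2_field K v"
  by (simp add: L2_field_def measurable_on_element integrable_on_element)

lemma L2_field_on_interior: "K \<in> \<T> \<Longrightarrow> L2_field \<Omega> v \<Longrightarrow> L2_field (interior K) v"
  by (auto simp: L2_field_def integrable_on_interior
      intro: measurable_lebesgue_on_subset[OF _ interior_element_subset])

lemma negligible_closure_diff: "negligible (closure \<Omega> - \<Omega>)"
proof (rule negligible_subset)
  show "negligible (\<Union>K\<in>\<T>. K - interior K)"
    using finite_mesh negligible_element_boundary by (intro negligible_Union) auto
  show "closure \<Omega> - \<Omega> \<subseteq> (\<Union>K\<in>\<T>. K - interior K)"
  proof
    fix x assume x: "x \<in> closure \<Omega> - \<Omega>"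
    then obtain K where K: "K \<in> \<T>" "x \<in> K" unfolding Union_mesh[symmetric] by auto
    then show "x \<in> (\<Union>K\<in>\<T>. K - interior K)" using x interior_element_subset[OF K(1)] by auto
  qed
qed

lemma sum_integral_elements:
  fixes f :: "real^3 \<Rightarrow> real"
  assumes "integrable (lebesgue_on \<Omega>) f"
  shows "(\<Sum>K\<in>\<T>. integral\<^sup>L (lebesgue_on K) f) = integral\<^sup>L (lebesgue_on \<Omega>) f"
proof -
  have "(f has_integral (\<Sum>K\<in>\<T>. integral\<^sup>L (lebesgue_on K) f)) (\<Union>\<T>)"
  proof (rule has_integral_Union[OF finite_mesh])
    show "(f has_integral integral\<^sup>L (lebesgue_on K) f) K" if "K \<in> \<T>" for K
      by (rule has_integral_integral_lebesgue_on[OF integrable_on_element[OF that assms] element_body(4)[OF that]])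
    show "pairwise (\<lambda>S S'. negligible (S \<inter> S')) \<T>"
    proof (rule pairwiseI)
      fix K K' assume "K \<in> \<T>" "K' \<in> \<T>" "K \<noteq> K'"
      then have "K \<inter> K' \<subseteq> K - interior K" using elements_avoid_interior[of K K'] by blast
      then show "negligible (K \<inter> K')"
        by (rule negligible_subset[OF negligible_element_boundary[OF \<open>K \<in> \<T>\<close>]])
    qed
  qed
  moreover have "(f has_integral integral\<^sup>L (lebesgue_on \<Omega>) f) (closure \<Omega>)"
  proof (rule iffD1[OF has_integral_spike_set_eq has_integral_integral_lebesgue_on[OF assms domain_bounded(3)]])
    show "negligible {x \<in> \<Omega> - closure \<Omega>. f x \<noteq> 0}"
      using closure_subset[of \<Omega>] by (intro negligible_subset[OF negligible_empty]) blast
    show "negligible {x \<in> closure \<Omega> - \<Omega>. f x \<noteq> 0}"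
      by (rule negligible_subset[OF negligible_closure_diff]) blast
  qed
  ultimately show ?thesis unfolding Union_mesh by (rule has_integral_unique)
qed

text \<open>
  Almost every point of the domain is interior to an element, because the boundaries of the finitely many convex
  elements are null sets.
\<close>

lemma AE_domain_from_elements:
  assumes "\<And>K. K \<in> \<T> \<Longrightarrow> AE x in lebesgue_on K. P K x"
  shows "AE x in lebesgue_on \<Omega>. \<exists>K\<in>\<T>. x \<in> interior K \<and> P K x"
proof -
  have "AE x in lebesgue. \<forall>K\<in>\<T>. x \<in> K \<longrightarrow> P K x \<and> x \<notin> K - interior K"
  proof (rule AE_finite_allI[OF finite_mesh])
    fix K assume K: "K \<in> \<T>"
    have "AE x in lebesgue. x \<in> K \<longrightarrow> P K x"
      using assms[OF K] element_body(4)[OF K] by (simp add: AE_restrict_space_iff)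
    moreover have "AE x in lebesgue. x \<notin> K - interior K"
      using negligible_element_boundary[OF K] unfolding negligible_iff_null_sets by (rule AE_not_in)
    ultimately show "AE x in lebesgue. x \<in> K \<longrightarrow> P K x \<and> x \<notin> K - interior K"
      by eventually_elim auto
  qed
  then have "AE x in lebesgue. x \<in> \<Omega> \<longrightarrow> (\<exists>K\<in>\<T>. x \<in> interior K \<and> P K x)"
  proof eventually_elim
    case (elim x)
    show ?case
    proof
      assume "x \<in> \<Omega>"
      then have "x \<in> \<Union>\<T>" unfolding Union_mesh by (rule subsetD[OF closure_subset])
      then obtain K where K: "K \<in> \<T>" "x \<in> K" by auto
      then have "x \<in> interior K \<and> P K x" using elim by auto
      then show "\<exists>K\<in>\<T>. x \<in> interior K \<and> P K x" using K(1) by auto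
    qed
  qed
  then show ?thesis using domain_bounded(3) by (simp add: AE_restrict_space_iff)
qed

lemma AE_interior_element:
  assumes "K \<in> \<T>" shows "AE x in lebesgue_on K. x \<in> interior K"
  using AE_not_in[OF negligible_element_boundary[OF assms, unfolded negligible_iff_null_sets]] element_body(4)[OF assms]
  by (simp add: AE_restrict_space_iff)

lemma sum_indicator_interior:
  assumes "K \<in> \<T>" "x \<in> interior K"
  shows "(\<Sum>K'\<in>\<T>. indicator (interior K') x *\<^sub>R f K') = (f K :: real^3)"
proof -
  have "indicator (interior K') x *\<^sub>R f K' = 0" if "K' \<in> \<T> - {K}" for K'
    using disjoint_interiors[of K K'] that assms by (auto simp: indicator_def)
  then have "(\<Sum>K'\<in>\<T> - {K}. indicator (interior K') x *\<^sub>R f K') = 0"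
    by (intro sum.neutral) blast
  then show ?thesis using assms by (simp add: sum.remove[OF finite_mesh assms(1)])
qed

end

section \<open>Piecewise polynomial fields on a mesh\<close>

definition monomial :: "(3 \<Rightarrow> nat) \<Rightarrow> real^3 \<Rightarrow> real" where
  "monomial a x = (\<Prod>i\<in>UNIV. (x $ i) ^ a i)"

lemma poly_le_expand:
  "poly_le l p \<longleftrightarrow> (\<exists>c. \<forall>x. p x = (\<Sum>a | (\<Sum>i\<in>UNIV. a i) \<le> l. c a * monomial a x))"
  by (simp add: poly_le_def monomial_def)

lemma poly_le_zero: "poly_le l (\<lambda>x. 0)"
  unfolding poly_le_expand by (rule exI[of _ "\<lambda>a. 0"]) simp

lemma poly_le_add:
  assumes "poly_le l p" "poly_le l q" shows "poly_le l (\<lambda>x. p x + q x)"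
proof -
  obtain c where c: "\<forall>x. p x = (\<Sum>a | (\<Sum>i\<in>UNIV. a i) \<le> l. c a * monomial a x)"
    using assms(1)[unfolded poly_le_expand] by (rule exE)
  obtain d where "\<forall>x. q x = (\<Sum>a | (\<Sum>i\<in>UNIV. a i) \<le> l. d a * monomial a x)"
    using assms(2)[unfolded poly_le_expand] by (rule exE)
  with c show ?thesis unfolding poly_le_expand
    by (intro exI[of _ "\<lambda>a. c a + d a"]) (simp add: distrib_right sum.distrib)
qed

lemma poly_le_scale:
  assumes "poly_le l p" shows "poly_le l (\<lambda>x. k * p x)"
proof -
  obtain c where "\<forall>x. p x = (\<Sum>a | (\<Sum>i\<in>UNIV. a i) \<le> l. c a * monomial a x)"
    using assms[unfolded poly_le_expand] by (rule exE)
  then show ?thesis unfolding poly_le_expand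
    by (intro exI[of _ "\<lambda>a. k * c a"]) (simp add: sum_distrib_left mult.assoc)
qed

lemma poly_le_monomial:
  assumes "(\<Sum>i\<in>UNIV. a i) \<le> l" shows "poly_le l (monomial a)"
  unfolding poly_le_expand
proof (rule exI[of _ "\<lambda>b. if b = a then 1 else 0"], rule allI)
  fix x
  have "(\<Sum>b | (\<Sum>i\<in>UNIV. b i) \<le> l. (if b = a then 1 else 0) * monomial b x)
      = (\<Sum>b | (\<Sum>i\<in>UNIV. b i) \<le> l. if b = a then monomial b x else 0)"
    by (intro sum.cong) auto
  also have "\<dots> = monomial a x" using assms by (subst sum.delta[OF finite_multi_indices]) simp
  finally show "monomial a x = (\<Sum>b | (\<Sum>i\<in>UNIV. b i) \<le> l. (if b = a then 1 else 0) * monomial b x)"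
    by (rule sym)
qed

lemma poly_field_C1: "poly_field l q \<Longrightarrow> C1 (\<lambda>x. q x $ j)"
  unfolding poly_field_def by (intro C1_poly_le) auto

lemma poly_field_continuous: "poly_field l q \<Longrightarrow> continuous_on UNIV q"
  by (intro continuous_on_vec3 C1_D(3)) (rule poly_field_C1)

lemma poly_field_zero: "poly_field l (\<lambda>x. 0)"
  by (simp add: poly_field_def poly_le_zero)

lemma poly_field_add: "poly_field l p \<Longrightarrow> poly_field l q \<Longrightarrow> poly_field l (\<lambda>x. p x + q x)"
  by (simp add: poly_field_def poly_le_add)

lemma poly_field_scale: "poly_field l p \<Longrightarrow> poly_field l (\<lambda>x. k *\<^sub>R p x)"
  by (simp add: poly_field_def poly_le_scale)

lemma poly_field_monomial:
  assumes "(\<Sum>i\<in>UNIV. a i) \<le> l" shows "poly_field l (\<lambda>x. monomial a x *\<^sub>R axis k 1)"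
  unfolding poly_field_def
proof
  fix i
  show "poly_le l (\<lambda>x. (monomial a x *\<^sub>R axis k 1 :: real^3) $ i)"
    using poly_le_monomial[OF assms] poly_le_zero by (cases "i = k") (simp_all add: axis_def)
qed

definition piece :: "nat \<Rightarrow> field3 \<Rightarrow> (real^3) set \<Rightarrow> field3" where
  "piece l w K = (SOME p. poly_field l p \<and> (AE x in lebesgue_on K. w x = p x))"

lemma dg_space_eq:
  "dg_space \<Omega> \<T> l = {v. L2_field \<Omega> v \<and>
    (\<forall>K\<in>\<T>. \<exists>p. poly_field l p \<and> (AE x in lebesgue_on K. v x = p x))}"
  by (simp add: dg_space_def poly_field_def)

lemma dg_space_piece:
  assumes "w \<in> dg_space \<Omega> \<T> l" "K \<in> \<T>"
  shows "poly_field l (piece l w K)" "AE x in lebesgue_on K. w x = piece l w K x"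
proof -
  have "\<exists>p. poly_field l p \<and> (AE x in lebesgue_on K. w x = p x)"
    using assms by (simp add: dg_space_eq)
  from someI_ex[OF this] show "poly_field l (piece l w K)" "AE x in lebesgue_on K. w x = piece l w K x"
    by (simp_all add: piece_def)
qed

lemma dg_space_L2: "w \<in> dg_space \<Omega> \<T> l \<Longrightarrow> L2_field \<Omega> w"
  by (simp add: dg_space_def)

lemma dg_space_zero: "(\<lambda>x. 0) \<in> dg_space \<Omega> \<T> l"
  unfolding dg_space_eq using L2_field_zero poly_field_zero by auto

lemma dg_space_add_scaled:
  assumes "v \<in> dg_space \<Omega> \<T> l" "w \<in> dg_space \<Omega> \<T> l"
  shows "(\<lambda>x. v x + k *\<^sub>R w x) \<in> dg_space \<Omega> \<T> l"
  unfolding dg_space_eq mem_Collect_eq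
proof (intro conjI ballI)
  show "L2_field \<Omega> (\<lambda>x. v x + k *\<^sub>R w x)"
    using assms by (intro L2_field_add L2_field_scale dg_space_L2)
  fix K assume K: "K \<in> \<T>"
  show "\<exists>p. poly_field l p \<and> (AE x in lebesgue_on K. v x + k *\<^sub>R w x = p x)"
  proof (intro exI conjI)
    show "poly_field l (\<lambda>x. piece l v K x + k *\<^sub>R piece l w K x)"
      using assms K by (intro poly_field_add poly_field_scale dg_space_piece)
    show "AE x in lebesgue_on K. v x + k *\<^sub>R w x = piece l v K x + k *\<^sub>R piece l w K x"
      using dg_space_piece(2)[OF assms(1) K] dg_space_piece(2)[OF assms(2) K] by eventually_elim simp
  qed
qed

lemma field_span_subset_dg_space:
  assumes "r \<in> field_span B" "B \<subseteq> dg_space \<Omega> \<T> l" shows "r \<in> dg_space \<Omega> \<T> l"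
  using assms by (induction rule: field_span.induct) (auto intro: dg_space_zero dg_space_add_scaled)

lemma poly_field_expand:
  assumes "poly_field l q"
  obtains c where "\<And>x. q x = (\<Sum>k\<in>UNIV. \<Sum>a | (\<Sum>i\<in>UNIV. a i) \<le> l. c k a *\<^sub>R (monomial a x *\<^sub>R axis k 1))"
proof -
  have "\<forall>k. \<exists>c. \<forall>x. q x $ k = (\<Sum>a | (\<Sum>i\<in>UNIV. a i) \<le> l. c a * monomial a x)"
    using assms by (simp add: poly_field_def poly_le_expand)
  then have "\<exists>c. \<forall>k x. q x $ k = (\<Sum>a | (\<Sum>i\<in>UNIV. a i) \<le> l. c k a * monomial a x)"
    by (rule choice)
  then obtain c where c: "\<And>k x. q x $ k = (\<Sum>a | (\<Sum>i\<in>UNIV. a i) \<le> l. c k a * monomial a x)" by auto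
  have "q x = (\<Sum>k\<in>UNIV. \<Sum>a | (\<Sum>i\<in>UNIV. a i) \<le> l. c k a *\<^sub>R (monomial a x *\<^sub>R axis k 1))" for x
  proof -
    have "q x = (\<Sum>k\<in>UNIV. (q x $ k) *\<^sub>R axis k 1)"
      using basis_expansion[of "q x"] by (simp add: scalar_mult_eq_scaleR)
    also have "\<dots> = (\<Sum>k\<in>UNIV. \<Sum>a | (\<Sum>i\<in>UNIV. a i) \<le> l. c k a *\<^sub>R (monomial a x *\<^sub>R axis k 1))"
      by (simp add: c scaleR_sum_left)
    finally show ?thesis .
  qed
  then show ?thesis by (rule that)
qed

context mesh
begin

definition dg_basis_field :: "(real^3) set \<times> 3 \<times> (3 \<Rightarrow> nat) \<Rightarrow> field3" where
  "dg_basis_field = (\<lambda>(K, k, a) x. indicator (interior K) x *\<^sub>R (monomial a x *\<^sub>R axis k 1))"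

definition dg_basis :: "nat \<Rightarrow> field3 set" where
  "dg_basis l = dg_basis_field ` (\<T> \<times> UNIV \<times> {a. (\<Sum>i\<in>UNIV. a i) \<le> l})"

lemma finite_dg_basis: "finite (dg_basis l)"
  unfolding dg_basis_def by (intro finite_imageI finite_cartesian_product finite_mesh finite finite_multi_indices)

lemma dg_basis_subset: "dg_basis l \<subseteq> V_h l"
proof
  fix b assume "b \<in> dg_basis l"
  then obtain K k a where K: "K \<in> \<T>" "(\<Sum>i\<in>UNIV. a i) \<le> l"
    and b: "b = (\<lambda>x. indicator (interior K) x *\<^sub>R (monomial a x *\<^sub>R axis k 1))"
    by (auto simp: dg_basis_def dg_basis_field_def)
  have pm: "poly_field l (\<lambda>x. monomial a x *\<^sub>R axis k 1)" by (rule poly_field_monomial[OF K(2)])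
  show "b \<in> V_h l"
    unfolding dg_space_eq mem_Collect_eq
  proof (intro conjI ballI)
    show "L2_field \<Omega> b" unfolding b
      by (rule L2_field_continuous_piece[OF domain_bounded(2,3) open_interior poly_field_continuous[OF pm]])
    fix K' assume K': "K' \<in> \<T>"
    show "\<exists>p. poly_field l p \<and> (AE x in lebesgue_on K'. b x = p x)"
    proof (cases "K' = K")
      case True
      have "AE x in lebesgue_on K'. b x = monomial a x *\<^sub>R axis k 1"
        using AE_interior_element[OF K'] by eventually_elim (simp add: b True)
      then show ?thesis using pm by blast
    next
      case False
      have "AE x in lebesgue_on K'. b x = 0"
        using AE_interior_element[OF K']
      proof eventually_elim
        case (elim x)
        then have "x \<notin> interior K" using disjoint_interiors[OF K' K(1) False] by auto
        then show ?case by (simp add: b)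
      qed
      then show ?thesis using poly_field_zero by blast
    qed
  qed
qed

lemma dg_basis_L2: "b \<in> dg_basis l \<Longrightarrow> L2_field \<Omega> b"
  using dg_basis_subset dg_space_L2 by blast

lemma dg_space_AE_in_span:
  assumes "w \<in> V_h l"
  obtains r where "r \<in> field_span (dg_basis l)" "AE x in lebesgue_on \<Omega>. w x = r x"
proof -
  let ?I = "{a :: 3 \<Rightarrow> nat. (\<Sum>i\<in>UNIV. a i) \<le> l}"
  have "\<exists>c. \<forall>x. piece l w K x = (\<Sum>k\<in>UNIV. \<Sum>a\<in>?I. c k a *\<^sub>R (monomial a x *\<^sub>R axis k 1))" if "K \<in> \<T>" for K
    by (rule poly_field_expand[OF dg_space_piece(1)[OF assms that]]) blast
  then have "\<exists>c. \<forall>K\<in>\<T>. \<forall>x. piece l w K x = (\<Sum>k\<in>UNIV. \<Sum>a\<in>?I. c K k a *\<^sub>R (monomial a x *\<^sub>R axis k 1))"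
    by (intro bchoice ballI)
  then obtain c where c: "\<And>K x. K \<in> \<T> \<Longrightarrow> piece l w K x = (\<Sum>k\<in>UNIV. \<Sum>a\<in>?I. c K k a *\<^sub>R (monomial a x *\<^sub>R axis k 1))"
    by auto
  define r where "r = (\<lambda>x. \<Sum>K\<in>\<T>. \<Sum>k\<in>UNIV. \<Sum>a\<in>?I. c K k a *\<^sub>R dg_basis_field (K, k, a) x)"
  show ?thesis
  proof
    show "r \<in> field_span (dg_basis l)"
      unfolding r_def
      by (intro field_span_sum field_span_scale field_span_base finite_mesh finite finite_multi_indices)
        (auto simp: dg_basis_def)
    have r: "r x = (\<Sum>K\<in>\<T>. indicator (interior K) x *\<^sub>R piece l w K x)" for x
      unfolding r_def dg_basis_field_def
      by (intro sum.cong refl) (simp add: c scaleR_sum_right mult_ac)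
    have "AE x in lebesgue_on \<Omega>. \<exists>K\<in>\<T>. x \<in> interior K \<and> w x = piece l w K x"
      by (rule AE_domain_from_elements) (rule dg_space_piece(2)[OF assms])
    then show "AE x in lebesgue_on \<Omega>. w x = r x"
    proof eventually_elim
      case (elim x)
      then obtain K where K: "K \<in> \<T>" "x \<in> interior K" "w x = piece l w K x" by blast
      then show ?case
        using sum_indicator_interior[OF K(1,2), of "\<lambda>K. piece l w K x"] by (simp add: r)
    qed
  qed
qed

text \<open>
  Up to null sets the discrete space is the span of finitely many fields, the monomials in one component cut off
  to one element, so a projection exists and the choice in the definition is justified.
\<close>

lemma L2_projection_orthogonal:
  assumes w: "L2_field \<Omega> w"
  shows "Pi_h l w \<in> V_h l"
    and "\<And>\<phi>. \<phi> \<in> V_h l \<Longrightarrow> L2_inner \<Omega> (\<lambda>x. w x - Pi_h l w x) \<phi> = 0"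
proof -
  obtain q where q: "q \<in> field_span (dg_basis l)"
    "\<And>b. b \<in> dg_basis l \<Longrightarrow> L2_inner \<Omega> (\<lambda>x. w x - q x) b = 0"
    using exists_L2_projection_on_span[OF finite_dg_basis[of l] dg_basis_L2[of _ l] w] by blast
  have qd: "q \<in> V_h l" by (rule field_span_subset_dg_space[OF q(1) dg_basis_subset])
  have Lwq: "L2_field \<Omega> (\<lambda>x. w x - q x)" by (rule L2_field_diff[OF w dg_space_L2[OF qd]])
  have "L2_inner \<Omega> (\<lambda>x. w x - q x) \<phi> = 0" if \<phi>: "\<phi> \<in> V_h l" for \<phi>
  proof -
    obtain r where r: "r \<in> field_span (dg_basis l)" "AE x in lebesgue_on \<Omega>. \<phi> x = r x"
      using dg_space_AE_in_span[OF \<phi>] .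
    have Lr: "L2_field \<Omega> r" by (rule L2_field_span[OF r(1) dg_basis_L2])
    have "L2_inner \<Omega> (\<lambda>x. w x - q x) \<phi> = L2_inner \<Omega> (\<lambda>x. w x - q x) r"
      unfolding L2_inner_def
    proof (rule integral_cong_AE)
      show "AE x in lebesgue_on \<Omega>. (w x - q x) \<bullet> \<phi> x = (w x - q x) \<bullet> r x"
        using r(2) by eventually_elim simp
    qed (use Lwq Lr dg_space_L2[OF \<phi>] in \<open>auto simp: L2_field_def intro!: borel_measurable_inner\<close>)
    also have "\<dots> = 0" by (rule L2_inner_span_eq_0[OF r(1) dg_basis_L2 Lwq q(2)])
    finally show ?thesis .
  qed
  then have "\<exists>q. q \<in> V_h l \<and> (\<forall>\<phi>\<in>V_h l. L2_inner \<Omega> (\<lambda>x. w x - q x) \<phi> = 0)"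
    using qd by blast
  from someI_ex[OF this[unfolded L2_inner_def]]
  show "Pi_h l w \<in> V_h l"
    and "\<And>\<phi>. \<phi> \<in> V_h l \<Longrightarrow> L2_inner \<Omega> (\<lambda>x. w x - Pi_h l w x) \<phi> = 0"
    unfolding L2_projection_def L2_inner_def by blast+
qed

text \<open>
  Orthogonality to the projection \<open>q\<close> itself gives \<open>\<parallel>q\<parallel>\<^sup>2 = \<langle>w, q\<rangle>\<close>.
\<close>

lemma L2_projection_contraction:
  assumes w: "L2_field \<Omega> w"
  shows "L2_norm \<Omega> (Pi_h l w) \<le> L2_norm \<Omega> w"
proof -
  define q where "q = Pi_h l w"
  have q: "q \<in> V_h l" "L2_inner \<Omega> (\<lambda>x. w x - q x) q = 0"
    using L2_projection_orthogonal[OF w] by (auto simp: q_def)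
  have Lq: "L2_field \<Omega> q" by (rule dg_space_L2[OF q(1)])
  have "L2_norm \<Omega> q * L2_norm \<Omega> q = L2_inner \<Omega> w q"
    using q(2) L2_inner_diff_left[OF w Lq Lq] by (simp add: L2_inner_self power2_eq_square)
  also have "\<dots> \<le> L2_norm \<Omega> w * L2_norm \<Omega> q" using abs_L2_inner_le[OF w Lq] by linarith
  finally show ?thesis
    unfolding q_def[symmetric] using L2_norm_nonneg[of \<Omega> q] L2_norm_nonneg[of \<Omega> w]
    by (metis mult_le_cancel_right not_le order_antisym_conv)
qed

lemma sum_space_L2:
  assumes "v \<in> V_sum l" shows "L2_field \<Omega> v"
  using assms dg_space_L2 unfolding sum_space_def H0_curl_def by (auto intro!: L2_field_add)

lemma dg_part_in_dg_space:
  assumes "v \<in> V_sum l" shows "dg_part \<Omega> \<T> l v \<in> V_h l"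
proof -
  obtain u w where uw: "v = (\<lambda>x. u x + w x)" "u \<in> H0_curl \<Omega>" "w \<in> V_h l"
    using assms by (auto simp: sum_space_def)
  have "w \<in> V_h l \<and> (\<lambda>x. v x - w x) \<in> H0_curl \<Omega>" using uw by simp
  from someI[where P = "\<lambda>w. w \<in> V_h l \<and> (\<lambda>x. v x - w x) \<in> H0_curl \<Omega>", OF this] show ?thesis by (simp add: dg_part_def)
qed

text \<open>
  The weak curl of the \<open>H_0(curl)\<close> part plus the classical curls of the polynomial pieces satisfies the conditions
  under which the elementwise curl is chosen.
\<close>

lemma elementwise_curl_L2:
  assumes "v \<in> V_sum l" shows "L2_field \<Omega> (curl_h v)"
proof -
  obtain u w where uw: "v = (\<lambda>x. u x + w x)" "u \<in> H0_curl \<Omega>" "w \<in> V_h l"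
    using assms by (auto simp: sum_space_def)
  obtain cu where cu: "L2_field \<Omega> cu" "has_weak_curl \<Omega> u cu"
    using uw(2) by (auto simp: H0_curl_def)
  have Lu: "L2_field \<Omega> u" using uw(2) by (simp add: H0_curl_def)
  have Lw: "L2_field \<Omega> w" by (rule dg_space_L2[OF uw(3)])
  define cw where "cw = (\<lambda>x. \<Sum>K\<in>\<T>. indicator (interior K) x *\<^sub>R curl (piece l w K) x)"
  have C: "C1 (\<lambda>x. piece l w K x $ j)" if "K \<in> \<T>" for K j
    by (rule poly_field_C1[OF dg_space_piece(1)[OF uw(3) that]])
  have Lcw: "L2_field \<Omega> cw"
    unfolding cw_def
    by (intro L2_field_sum finite_mesh L2_field_continuous_piece domain_bounded(2,3) open_interior continuous_on_curl C)
  have "has_weak_curl (interior K) (\<lambda>x. u x + w x) (\<lambda>x. cu x + cw x)" if K: "K \<in> \<T>" for K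
  proof (rule has_weak_curl_add)
    show "bounded (interior K)"
      using element_body(1)[OF K] bounded_interior compact_imp_bounded by blast
    show "has_weak_curl (interior K) u cu"
      by (rule has_weak_curl_subset[OF cu(2) interior_element_subset[OF K] interior_lebesgue domain_bounded(3)])
    show "has_weak_curl (interior K) w cw"
    proof (rule has_weak_curl_C1[OF open_interior C[OF K]])
      show "w \<in> borel_measurable (lebesgue_on (interior K))" "cw \<in> borel_measurable (lebesgue_on (interior K))"
        using L2_field_on_interior[OF K] Lw Lcw by (simp_all add: L2_field_def)
      show "AE x in lebesgue_on (interior K). w x = piece l w K x"
        by (rule AE_lebesgue_on_subset[OF dg_space_piece(2)[OF uw(3) K] interior_subset element_body(4)[OF K] interior_lebesgue])
      show "AE x in lebesgue_on (interior K). cw x = curl (piece l w K) x"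
        by (rule AE_I2) (simp add: cw_def sum_indicator_interior[OF K])
    qed
  qed (use L2_field_on_interior[OF K] Lu Lw Lcw cu(1) in auto)
  then have "L2_field \<Omega> (\<lambda>x. cu x + cw x) \<and> (\<forall>K\<in>\<T>. has_weak_curl (interior K) v (\<lambda>x. cu x + cw x))"
    using L2_field_add[OF cu(1) Lcw] by (simp add: uw(1))
  from someI[where P = "\<lambda>w. L2_field \<Omega> w \<and> (\<forall>K\<in>\<T>. has_weak_curl (interior K) v w)", OF this]
  show ?thesis by (simp add: elementwise_curl_def)
qed

end

section \<open>Faces of a mesh\<close>

lemma sum_Un_le:
  fixes f :: "'a \<Rightarrow> real"
  assumes "finite A" "finite B" "\<And>x. x \<in> A \<union> B \<Longrightarrow> 0 \<le> f x"
  shows "sum f (A \<union> B) \<le> sum f A + sum f B"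
proof -
  have "sum f (A \<union> B) + sum f (A \<inter> B) = sum f A + sum f B"
    by (rule sum.union_inter[OF assms(1,2)])
  moreover have "0 \<le> sum f (A \<inter> B)" using assms(3) by (intro sum_nonneg) auto
  ultimately show ?thesis by linarith
qed

context mesh
begin

lemma three_elements:
  assumes "K1 \<in> \<T>" "K2 \<in> \<T>" "K3 \<in> \<T>" "K1 \<noteq> K2" "K1 \<noteq> K3" "K2 \<noteq> K3"
  shows "aff_dim (K1 \<inter> K2 \<inter> K3) \<le> 1"
proof -
  define K where "K = (\<lambda>i::nat. if i = 0 then K1 else if i = 1 then K2 else K3)"
  have m: "K i \<in> \<T>" for i using assms by (simp add: K_def)
  have d: "K i \<noteq> K j" if "i < 3" "j < 3" "i \<noteq> j" for i j
    using that assms by (auto simp: K_def)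
  have "aff_dim (K 0 \<inter> K 1 \<inter> K 2) \<le> 1"
    by (rule three_elements_meet_in_line) (simp_all add: element_body[OF m] disjoint_interiors[OF m m d])
  then show ?thesis by (simp add: K_def)
qed

lemma facet_body:
  assumes "K \<in> \<T>" "F facet_of K"
  shows "compact F" "convex F" "F \<subseteq> K" "F \<inter> interior K = {}" "aff_dim F = 2"
proof -
  have d: "aff_dim K = 3" using aff_dim_nonempty_interior[OF element_body(3)[OF assms(1)]] by simp
  have f: "F face_of K" "aff_dim F = 2" using assms(2) d by (auto simp: facet_of_def)
  show "aff_dim F = 2" by (rule f(2))
  have "F \<noteq> K" using f(2) d by auto
  then show "F \<inter> interior K = {}" by (rule face_of_disjoint_interior[OF f(1)])
  show "F \<subseteq> K" by (rule face_of_imp_subset[OF f(1)])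
  show "convex F" by (rule face_of_imp_convex[OF f(1)])
  show "compact F" by (rule face_of_imp_compact[OF element_body(2,1)[OF assms(1)] f(1)])
qed

lemma supporting_plane_element:
  assumes K: "K \<in> \<T>" and G: "convex G" "G \<subseteq> K" "G \<inter> interior K = {}" and f: "f \<subseteq> G" "aff_dim f = 2"
  shows "\<exists>n b. norm n = 1 \<and> (\<forall>x\<in>K. n \<bullet> x \<le> b) \<and> affine hull f = {y. n \<bullet> y = b}"
proof -
  have "f \<noteq> {}" using f(2) by auto
  then have "G \<noteq> {}" using f(1) by auto
  obtain n b where n: "norm n = 1" "\<And>x. x \<in> K \<Longrightarrow> n \<bullet> x \<le> b" "\<And>y. y \<in> G \<Longrightarrow> n \<bullet> y = b"
    using supporting_plane[OF element_body(2,3)[OF K] G(1) \<open>G \<noteq> {}\<close> G(2,3)] by blast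
  have "n \<noteq> 0" using n(1) by auto
  then have "affine hull f = {y. n \<bullet> y = b}"
    using n(3) f by (intro affine_hull_eq_plane) auto
  with n show ?thesis by (intro exI[of _ n] exI[of _ b]) simp
qed

lemma boundary_faceE:
  assumes "f \<in> boundary_faces \<Omega> \<T>"
  obtains F K where "K \<in> \<T>" "F facet_of K" "f = F \<inter> frontier \<Omega>" "compact f" "aff_dim f = 2"
proof -
  obtain F K where F: "K \<in> \<T>" "F facet_of K" "f = F \<inter> frontier \<Omega>" "0 < emeasure (area_measure F) f"
    using assms by (auto simp: boundary_faces_def)
  note Fp = facet_body[OF F(1,2)]
  have c: "compact f" unfolding F(3) by (intro compact_Int_closed Fp) auto
  obtain n b where n: "norm n = 1" "affine hull F = {y. n \<bullet> y = b}"
    using supporting_plane_element[OF F(1) Fp(2-4) subset_refl Fp(5)] by (elim exE conjE)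
  have fF: "f \<subseteq> affine hull F" using F(3) hull_subset[of F affine] by blast
  have "\<not> aff_dim f \<le> 1"
    using emeasure_area_measure_thin[OF n c fF] F(4) by auto
  moreover have "aff_dim f \<le> aff_dim F" using F(3) by (intro aff_dim_subset) auto
  ultimately have "aff_dim f = 2" using Fp(5) by linarith
  with F c show ?thesis by (intro that)
qed

lemma interior_faceE:
  assumes "f \<in> interior_faces \<T>"
  obtains K K' where "K \<in> \<T>" "K' \<in> \<T>" "K \<noteq> K'" "f = K \<inter> K'" "compact f" "aff_dim f = 2"
proof -
  obtain K K' where K: "K \<in> \<T>" "K' \<in> \<T>" "K \<noteq> K'" "f = K \<inter> K'" "aff_dim f = 2"
    using assms by (auto simp: interior_faces_def)
  moreover have "compact f" unfolding K(4) by (intro compact_Int element_body K)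
  ultimately show ?thesis by (intro that)
qed

lemma face_planar:
  assumes "f \<in> faces_h"
  shows "compact f" "aff_dim f = 2" "adjacent \<T> f \<noteq> {}"
proof -
  consider "f \<in> interior_faces \<T>" | "f \<in> boundary_faces \<Omega> \<T>" using assms by (auto simp: faces_def)
  then have "compact f \<and> aff_dim f = 2 \<and> adjacent \<T> f \<noteq> {}"
  proof cases
    case 1
    then show ?thesis by (rule interior_faceE) (auto simp: adjacent_def)
  next
    case 2
    then show ?thesis
      by (rule boundary_faceE) (use facet_body(3) in \<open>auto simp: adjacent_def\<close>)
  qed
  then show "compact f" "aff_dim f = 2" "adjacent \<T> f \<noteq> {}" by auto
qed

lemma adjacent_element: "K \<in> adjacent \<T> f \<Longrightarrow> K \<in> \<T>" "K \<in> adjacent \<T> f \<Longrightarrow> f \<subseteq> K"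
  and finite_adjacent: "finite (adjacent \<T> f)"
  using finite_mesh by (auto simp: adjacent_def)

lemma finite_faces: "finite (faces_h)"
proof -
  have "interior_faces \<T> \<subseteq> (\<lambda>(K, K'). K \<inter> K') ` (\<T> \<times> \<T>)" by (auto simp: interior_faces_def)
  then have "finite (interior_faces \<T>)" by (rule finite_subset) (simp add: finite_mesh)
  moreover have "boundary_faces \<Omega> \<T> \<subseteq> (\<Union>K\<in>\<T>. (\<lambda>F. F \<inter> frontier \<Omega>) ` {F. F facet_of K})"
    by (auto simp: boundary_faces_def)
  then have "finite (boundary_faces \<Omega> \<T>)"
    by (rule finite_subset) (intro finite_UN_I finite_imageI finite_mesh finite_polytope_facets polytope_element)
  ultimately show ?thesis by (simp add: faces_def)
qed

text \<open>
  The convex set \<open>G\<close> replaces the face, which on the boundary of the domain need not be convex: it is a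
  facet of \<open>K\<close> or the intersection of \<open>K\<close> with another element that contains \<open>f\<close>.
\<close>

lemma face_in_element_boundary:
  assumes "f \<in> faces_h" "K \<in> \<T>" "f \<subseteq> K"
  obtains G where "convex G" "G \<subseteq> K" "G \<inter> interior K = {}" "f \<subseteq> G"
proof -
  note result = that
  have other: thesis if K': "K' \<in> \<T>" "K' \<noteq> K" "f \<subseteq> K'" for K'
  proof (rule result[of "K \<inter> K'"])
    show "convex (K \<inter> K')" by (intro convex_Int element_body K' assms)
    show "K \<inter> K' \<inter> interior K = {}" using elements_avoid_interior[of K K'] K' assms by blast
  qed (use K' assms in auto)
  consider "f \<in> interior_faces \<T>" | "f \<in> boundary_faces \<Omega> \<T>" using assms(1) by (auto simp: faces_def)
  then show thesis
  proof cases
    case 1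
    then obtain K1 K2 where "K1 \<in> \<T>" "K2 \<in> \<T>" "K1 \<noteq> K2" "f = K1 \<inter> K2" by (rule interior_faceE)
    then show thesis using other[of K1] other[of K2] by (cases "K1 = K") auto
  next
    case 2
    then obtain F K0 where F: "K0 \<in> \<T>" "F facet_of K0" "f = F \<inter> frontier \<Omega>" by (rule boundary_faceE)
    note Fp = facet_body[OF F(1,2)]
    show thesis
    proof (cases "K0 = K")
      case True
      then show thesis using result[of F] Fp F(3) by auto
    next
      case False
      then show thesis using other[of K0] F Fp(3) by auto
    qed
  qed
qed

lemma face_plane:
  assumes "f \<in> faces_h" "K \<in> \<T>" "f \<subseteq> K"
  shows "\<exists>n b. norm n = 1 \<and> (\<forall>x\<in>K. n \<bullet> x \<le> b) \<and> affine hull f = {y. n \<bullet> y = b}"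
proof -
  obtain G where "convex G" "G \<subseteq> K" "G \<inter> interior K = {}" "f \<subseteq> G"
    by (rule face_in_element_boundary[OF assms])
  then show ?thesis using supporting_plane_element[OF assms(2) _ _ _ _ face_planar(2)[OF assms(1)]] by simp
qed

lemma face_avoids_interior:
  assumes "f \<in> faces_h" "K \<in> \<T>" "f \<subseteq> K"
  shows "f \<inter> interior K = {}"
  by (rule face_in_element_boundary[OF assms]) blast

text \<open>
  The centre of a ball of radius \<open>r\<close> in \<open>K\<close> has distance at least \<open>r\<close> from every supporting plane.
\<close>

lemma face_trace_inequality:
  assumes f: "f \<in> faces_h" "K \<in> \<T>" "f \<subseteq> K" and r: "0 < r" "ball c r \<subseteq> K" and q: "poly_field l q"
  shows "face_integral f (\<lambda>x. (norm (q x))\<^sup>2)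
    \<le> 8 * 9 ^ l * real (Suc l) ^ 3 / r * integral (apex_cone c f) (\<lambda>x. (norm (q x))\<^sup>2)"
proof -
  obtain n b where n: "norm n = 1" "\<forall>x\<in>K. n \<bullet> x \<le> b" "affine hull f = {y. n \<bullet> y = b}"
    using face_plane[OF f] by (elim exE conjE)
  have d: "n \<bullet> c + r \<le> b"
    using ball_depth_below_plane[of n c r b] n r by blast
  have cq: "continuous_on UNIV q" by (rule poly_field_continuous[OF q])
  have "0 \<le> integral (apex_cone c f) (\<lambda>x. (norm (q x))\<^sup>2)"
    by (rule integral_nonneg)
      (auto intro!: set_lebesgue_integral_eq_integral(1) absolutely_integrable_continuous_compact
        compact_apex_cone face_planar(1)[OF f(1)] continuous_intros continuous_on_subset[OF cq])
  then have "8 * 9 ^ l * real (Suc l) ^ 3 / (b - n \<bullet> c) * integral (apex_cone c f) (\<lambda>x. (norm (q x))\<^sup>2)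
      \<le> 8 * 9 ^ l * real (Suc l) ^ 3 / r * integral (apex_cone c f) (\<lambda>x. (norm (q x))\<^sup>2)"
    using d r by (intro mult_right_mono divide_left_mono) auto
  moreover have "face_integral f (\<lambda>x. (norm (q x))\<^sup>2)
    \<le> 8 * 9 ^ l * real (Suc l) ^ 3 / (b - n \<bullet> c) * integral (apex_cone c f) (\<lambda>x. (norm (q x))\<^sup>2)"
    using d r by (intro polynomial_trace_inequality[OF n(1,3) face_planar(1)[OF f(1)] _ q cq]) simp
  ultimately show ?thesis by simp
qed

lemma sum_cone_integrals_le:
  fixes g :: "real^3 \<Rightarrow> real"
  assumes K: "K \<in> \<T>" "c \<in> interior K" and Fs: "Fs \<subseteq> {f \<in> faces_h. f \<subseteq> K}"
    and thin: "\<And>f f'. f \<in> Fs \<Longrightarrow> f' \<in> Fs \<Longrightarrow> f \<noteq> f' \<Longrightarrow> aff_dim (f \<inter> f') \<le> 1"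
    and g: "continuous_on UNIV g" "\<And>x. 0 \<le> g x"
  shows "(\<Sum>f\<in>Fs. integral (apex_cone c f) g) \<le> integral K g"
proof -
  have int: "g integrable_on S" if "compact S" for S
    by (rule set_lebesgue_integral_eq_integral(1)[OF absolutely_integrable_continuous_compact[OF that
      continuous_on_subset[OF g(1) subset_UNIV]]])
  have Fs': "f \<in> faces_h" "f \<subseteq> K" if "f \<in> Fs" for f using that Fs by auto
  have "(g has_integral (\<Sum>f\<in>Fs. integral (apex_cone c f) g)) (\<Union>f\<in>Fs. apex_cone c f)"
  proof (rule has_integral_UN)
    show "finite Fs" using Fs finite_faces by (auto intro: finite_subset)
    show "(g has_integral integral (apex_cone c f) g) (apex_cone c f)" if "f \<in> Fs" for f
      by (intro integrable_integral int compact_apex_cone face_planar(1) Fs' that)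
    show "pairwise (\<lambda>f f'. negligible (apex_cone c f \<inter> apex_cone c f')) Fs"
    proof (rule pairwiseI)
      fix f f' assume ff: "f \<in> Fs" "f' \<in> Fs" "f \<noteq> f'"
      show "negligible (apex_cone c f \<inter> apex_cone c f')"
        using face_avoids_interior[OF Fs'(1)[OF ff(1)] K(1) Fs'(2)[OF ff(1)]]
          face_avoids_interior[OF Fs'(1)[OF ff(2)] K(1) Fs'(2)[OF ff(2)]]
        by (intro negligible_apex_cone_overlap[OF element_body(2)[OF K(1)] K(2) Fs'(2)[OF ff(1)] Fs'(2)[OF ff(2)]]
            thin[OF ff])
    qed
  qed
  then have "(\<Sum>f\<in>Fs. integral (apex_cone c f) g) = integral (\<Union>f\<in>Fs. apex_cone c f) g"
    and "g integrable_on (\<Union>f\<in>Fs. apex_cone c f)" by (auto simp: has_integral_iff)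
  moreover have "(\<Union>f\<in>Fs. apex_cone c f) \<subseteq> K"
    using apex_cone_subset[OF element_body(2)[OF K(1)] subsetD[OF interior_subset K(2)]] Fs'(2) by blast
  ultimately show ?thesis
    using int[OF element_body(1)[OF K(1)]] g(2) by (auto intro: integral_subset_le)
qed

text \<open>
  The faces in \<open>K\<close> are sorted into the interior faces, the boundary faces cut out of facets of \<open>K\<close>, and those
  cut out of facets of other elements. Within each of these three families two distinct faces meet in
  dimension at most one, so that their cones overlap in null sets. The factor 48 is 8 from the trace
  inequality, 2 from radius and diameter of the inscribed ball, and 3 from the families.
\<close>

lemma sum_face_integrals_le:
  assumes K: "K \<in> \<T>" and q: "poly_field l q"
  shows "diameter K * (\<Sum>f | f \<in> faces_h \<and> f \<subseteq> K. face_integral f (\<lambda>x. (norm (q x))\<^sup>2))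
    \<le> 48 * 9 ^ l * real (Suc l) ^ 3 * \<sigma> * integral K (\<lambda>x. (norm (q x))\<^sup>2)"
proof -
  define g where "g = (\<lambda>x. (norm (q x))\<^sup>2)"
  define A where "A = 8 * 9 ^ l * real (Suc l) ^ 3"
  have cg: "continuous_on UNIV g" unfolding g_def by (intro continuous_intros poly_field_continuous[OF q])
  obtain c \<rho> where c: "0 < \<rho>" "ball c (\<rho> / 2) \<subseteq> K" "diameter K \<le> \<sigma> * \<rho>" by (rule inscribed_ball[OF K])
  have ci: "c \<in> interior K" using c by (intro interiorI[of "ball c (\<rho> / 2)"]) auto
  define S where "S = {f \<in> faces_h. f \<subseteq> K}"
  define SI where "SI = S \<inter> interior_faces \<T>"
  define SB where "SB = {f \<in> S. \<exists>F. F facet_of K \<and> f = F \<inter> frontier \<Omega>}"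
  define SB' where "SB' = {f \<in> S. \<exists>F K'. K' \<in> \<T> \<and> K' \<noteq> K \<and> F facet_of K' \<and> f = F \<inter> frontier \<Omega>}"
  have fin: "finite S" using finite_faces by (simp add: S_def)
  have S: "S = SI \<union> (SB \<union> SB')"
  proof
    show "S \<subseteq> SI \<union> (SB \<union> SB')"
    proof
      fix f assume f: "f \<in> S"
      show "f \<in> SI \<union> (SB \<union> SB')"
      proof (cases "f \<in> interior_faces \<T>")
        case False
        then have "f \<in> boundary_faces \<Omega> \<T>" using f by (auto simp: S_def faces_def)
        then obtain F K' where "K' \<in> \<T>" "F facet_of K'" "f = F \<inter> frontier \<Omega>" by (rule boundary_faceE)
        then show ?thesis using f by (cases "K' = K") (auto simp: SB_def SB'_def)
      qed (use f in \<open>auto simp: SI_def\<close>)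
    qed
  qed (auto simp: SI_def SB_def SB'_def)
  have facets: "aff_dim (F \<inter> F') \<le> 1" if "K' \<in> \<T>" "F facet_of K'" "F' facet_of K'" "F \<noteq> F'" for K' F F'
    using distinct_facets_meet_in_line[OF element_body(2)[OF that(1)] that(2-4)]
      aff_dim_nonempty_interior[OF element_body(3)[OF that(1)]] by simp
  have thin_mono: "aff_dim A \<le> 1" if "A \<subseteq> B" "aff_dim B \<le> 1" for A B :: "(real^3) set"
    using aff_dim_subset[OF that(1)] that(2) by linarith
  have I: "(\<Sum>f\<in>SI. integral (apex_cone c f) g) \<le> integral K g"
  proof (rule sum_cone_integrals_le[OF K ci _ _ cg])
    fix f f' assume f: "f \<in> SI" "f' \<in> SI" "f \<noteq> f'"
    have fi: "f \<in> interior_faces \<T>" "f' \<in> interior_faces \<T>" using f by (auto simp: SI_def)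
    obtain K1 K2 where 1: "K1 \<in> \<T>" "K2 \<in> \<T>" "K1 \<noteq> K2" "f = K1 \<inter> K2"
      by (rule interior_faceE[OF fi(1)])
    obtain K3 K4 where 2: "K3 \<in> \<T>" "K4 \<in> \<T>" "K3 \<noteq> K4" "f' = K3 \<inter> K4"
      by (rule interior_faceE[OF fi(2)])
    \<comment> \<open>Different interior faces come from different pairs of elements, so at least three elements are involved.\<close>
    have "\<exists>K'\<in>{K3, K4}. K' \<notin> {K1, K2}"
      using f(3) 1(4) 2(3,4) by auto
    then obtain K' where K': "K' \<in> \<T>" "K' \<noteq> K1" "K' \<noteq> K2" "f' \<subseteq> K'" using 2 by auto
    show "aff_dim (f \<inter> f') \<le> 1"
      by (rule thin_mono[OF _ three_elements[of K1 K2 K']]) (use 1 K' in auto)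
  qed (auto simp: SI_def S_def g_def)
  have B: "(\<Sum>f\<in>SB. integral (apex_cone c f) g) \<le> integral K g"
  proof (rule sum_cone_integrals_le[OF K ci _ _ cg])
    fix f f' assume f: "f \<in> SB" "f' \<in> SB" "f \<noteq> f'"
    obtain F F' where F: "F facet_of K" "f = F \<inter> frontier \<Omega>" "F' facet_of K" "f' = F' \<inter> frontier \<Omega>"
      using f by (auto simp: SB_def)
    then have "F \<noteq> F'" using f(3) by auto
    show "aff_dim (f \<inter> f') \<le> 1"
      by (rule thin_mono[OF _ facets[OF K F(1,3) \<open>F \<noteq> F'\<close>]]) (use F in auto)
  qed (auto simp: SB_def S_def g_def)
  have B': "(\<Sum>f\<in>SB'. integral (apex_cone c f) g) \<le> integral K g"
  proof (rule sum_cone_integrals_le[OF K ci _ _ cg])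
    fix f f' assume f: "f \<in> SB'" "f' \<in> SB'" "f \<noteq> f'"
    obtain F K1 where F: "K1 \<in> \<T>" "K1 \<noteq> K" "F facet_of K1" "f = F \<inter> frontier \<Omega>"
      using f(1) by (auto simp: SB'_def)
    obtain F' K2 where F': "K2 \<in> \<T>" "K2 \<noteq> K" "F' facet_of K2" "f' = F' \<inter> frontier \<Omega>"
      using f(2) by (auto simp: SB'_def)
    have sub: "f \<subseteq> K" "f' \<subseteq> K" using f by (auto simp: SB'_def S_def)
    show "aff_dim (f \<inter> f') \<le> 1"
    proof (cases "K1 = K2")
      case True
      then have ff: "F facet_of K1" "F' facet_of K1" "F \<noteq> F'" using F F' f(3) by auto
      show ?thesis by (rule thin_mono[OF _ facets[OF F(1) ff]]) (use F F' in auto)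
    next
      case False
      show ?thesis
        by (rule thin_mono[OF _ three_elements[OF K F(1) F'(1)]])
          (use F F' False sub facet_body(3)[OF F(1,3)] facet_body(3)[OF F'(1,3)] in auto)
    qed
  qed (auto simp: SB'_def S_def g_def)
  have I0: "0 \<le> integral (apex_cone c f) g" for f
    by (cases "g integrable_on apex_cone c f") (auto simp: integral_nonneg g_def not_integrable_integral)
  have finS: "finite SI" "finite SB" "finite SB'" using fin by (auto simp: SI_def SB_def SB'_def)
  have "(\<Sum>f\<in>S. integral (apex_cone c f) g)
      \<le> (\<Sum>f\<in>SI. integral (apex_cone c f) g) + (\<Sum>f\<in>SB \<union> SB'. integral (apex_cone c f) g)"
    unfolding S using finS I0 by (intro sum_Un_le) auto
  moreover have "(\<Sum>f\<in>SB \<union> SB'. integral (apex_cone c f) g)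
      \<le> (\<Sum>f\<in>SB. integral (apex_cone c f) g) + (\<Sum>f\<in>SB'. integral (apex_cone c f) g)"
    using finS I0 by (intro sum_Un_le) auto
  ultimately have sum3: "(\<Sum>f\<in>S. integral (apex_cone c f) g) \<le> 3 * integral K g"
    using I B B' by linarith
  have A0: "0 \<le> A" by (simp add: A_def)
  have J0: "0 \<le> (\<Sum>f\<in>S. face_integral f g)"
    by (intro sum_nonneg) (simp add: face_integral_def set_lebesgue_integral_def g_def)
  have "(\<Sum>f\<in>S. face_integral f g) \<le> (\<Sum>f\<in>S. A / (\<rho> / 2) * integral (apex_cone c f) g)"
    using face_trace_inequality[OF _ K _ _ c(2) q] c(1) by (intro sum_mono) (auto simp: S_def g_def A_def)
  also have "\<dots> = A / (\<rho> / 2) * (\<Sum>f\<in>S. integral (apex_cone c f) g)" by (simp add: sum_distrib_left)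
  also have "\<dots> \<le> A / (\<rho> / 2) * (3 * integral K g)"
    using sum3 A0 c(1) by (intro mult_left_mono) auto
  finally have "\<rho> * (\<Sum>f\<in>S. face_integral f g) \<le> 6 * A * integral K g"
    using c(1) by (simp add: field_simps)
  moreover have "0 < \<sigma>"
    using diameter_pos[OF K] c by (metis less_le_trans zero_less_mult_pos2)
  ultimately have "\<sigma> * (\<rho> * (\<Sum>f\<in>S. face_integral f g)) \<le> \<sigma> * (6 * A * integral K g)"
    by (intro mult_left_mono) auto
  moreover have "diameter K * (\<Sum>f\<in>S. face_integral f g) \<le> (\<sigma> * \<rho>) * (\<Sum>f\<in>S. face_integral f g)"
    using c(3) J0 by (rule mult_right_mono)
  ultimately have "diameter K * (\<Sum>f\<in>S. face_integral f g) \<le> 6 * A * \<sigma> * integral K g"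
    by (simp add: mult_ac)
  then show ?thesis by (simp add: S_def g_def A_def mult_ac)
qed

end

section \<open>Continuity of the bilinear form\<close>

lemma face_integral_eq_restrict:
  assumes "f \<in> sets borel"
  shows "face_integral f g = integral\<^sup>L (restrict_space (area_measure f) f) g"
proof -
  have "f \<inter> space (area_measure f) \<in> sets (area_measure f)"
    using assms by (simp add: area_measure_def)
  then show ?thesis
    by (simp add: face_integral_def set_lebesgue_integral_def integral_restrict_space)
qed

lemma face_integral_cong: "(\<And>x. x \<in> f \<Longrightarrow> g x = h x) \<Longrightarrow> face_integral f g = face_integral f h"
  unfolding face_integral_def set_lebesgue_integral_def
  by (rule arg_cong[where f = "integral\<^sup>L _"]) (auto simp: indicator_def fun_eq_iff)

lemma face_integral_nonneg: "(\<And>x. 0 \<le> g x) \<Longrightarrow> 0 \<le> face_integral f g"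
  unfolding face_integral_def set_lebesgue_integral_def by (intro integral_nonneg_AE) simp

lemma face_integral_cmult: "face_integral f (\<lambda>x. k * g x) = k * face_integral f g"
  unfolding face_integral_def by simp

lemma face_norm_scaled_square:
  assumes "0 \<le> a"
  shows "(face_norm f (\<lambda>x. sqrt a *\<^sub>R v x))\<^sup>2 = a * face_integral f (\<lambda>x. (norm (v x))\<^sup>2)"
  using assms face_integral_nonneg[of "\<lambda>x. (norm (v x))\<^sup>2" f]
  by (simp add: face_norm_def power_mult_distrib face_integral_cmult)

lemma sum_mult_le_sqrt:
  fixes a b :: "'a \<Rightarrow> real"
  shows "(\<Sum>i\<in>I. \<bar>a i\<bar> * \<bar>b i\<bar>) \<le> sqrt (\<Sum>i\<in>I. (a i)\<^sup>2) * sqrt (\<Sum>i\<in>I. (b i)\<^sup>2)"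
  using L2_set_mult_ineq[of a b I] by (simp add: L2_set_def)

lemma mean_square_le:
  fixes a :: "'a \<Rightarrow> real"
  assumes "finite I" "I \<noteq> {}"
  shows "((\<Sum>i\<in>I. a i) / real (card I))\<^sup>2 \<le> (\<Sum>i\<in>I. (a i)\<^sup>2)"
proof -
  have c: "1 \<le> real (card I)" using assms by (simp add: Suc_leI card_gt_0_iff)
  have "(\<Sum>i\<in>I. a i)\<^sup>2 \<le> (\<Sum>i\<in>I. (a i)\<^sup>2) * real (card I)"
    using sum_squared_le_sum_of_squares[of a I] by simp
  also have "\<dots> \<le> (\<Sum>i\<in>I. (a i)\<^sup>2) * (real (card I))\<^sup>2"
    using c by (intro mult_left_mono sum_nonneg) (auto simp: power2_eq_square)
  finally show ?thesis using c by (simp add: power_divide divide_le_eq)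
qed

text \<open>
  A continuous function that dominates the modulus of the numerical flux on \<open>f\<close>.
\<close>

definition dg_flux_bound ::
  "(real^3) set set \<Rightarrow> nat \<Rightarrow> real \<Rightarrow> (real^3) set \<Rightarrow> field3 \<Rightarrow> real^3 \<Rightarrow> real" where
  "dg_flux_bound \<T> l m f Q x =
     (\<Sum>K\<in>adjacent \<T> f. norm (piece l Q K x) / m) / real (card (adjacent \<T> f))"

context mesh
begin

lemma face_measure_integrable:
  assumes f: "f \<in> faces_h" and g: "continuous_on UNIV (g :: real^3 \<Rightarrow> real)"
  shows "integrable (restrict_space (area_measure f) f) g"
proof -
  obtain K where K: "K \<in> adjacent \<T> f" using face_planar(3)[OF f] by blast
  obtain n b where n: "norm n = 1" "affine hull f = {y. n \<bullet> y = b}"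
    using face_plane[OF f adjacent_element[OF K]] by (elim exE conjE)
  have "f \<in> sets borel" using face_planar(1)[OF f] by (simp add: compact_imp_closed)
  then have "f \<inter> space (area_measure f) \<in> sets (area_measure f)" by (simp add: area_measure_def)
  then show ?thesis
    using set_integrable_area_continuous[OF n face_planar(1)[OF f] g]
    by (simp add: set_integrable_def integrable_restrict_space)
qed

lemma face_borel: "f \<in> faces_h \<Longrightarrow> f \<in> sets borel"
  using face_planar(1) by (simp add: compact_imp_closed)

lemma face_measurable:
  assumes f: "f \<in> faces_h" and g: "continuous_on UNIV (g :: real^3 \<Rightarrow> 'b::euclidean_space)"
  shows "g \<in> borel_measurable (restrict_space (area_measure f) f)"
  using borel_measurable_continuous_onI[OF g]
  by (intro measurable_restrict_space1) (simp add: area_measure_def)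

lemma face_integral_mono:
  assumes f: "f \<in> faces_h" and g: "continuous_on UNIV g" "continuous_on UNIV h"
    and le: "\<And>x. g x \<le> h x"
  shows "face_integral f g \<le> face_integral f h"
  unfolding face_integral_eq_restrict[OF face_borel[OF f]]
  by (intro integral_mono face_measure_integrable f g le)

lemma face_integral_sum:
  assumes f: "f \<in> faces_h" and g: "\<And>i. i \<in> I \<Longrightarrow> continuous_on UNIV (g i)"
  shows "face_integral f (\<lambda>x. \<Sum>i\<in>I. g i x) = (\<Sum>i\<in>I. face_integral f (g i))"
  unfolding face_integral_eq_restrict[OF face_borel[OF f]]
  by (intro Bochner_Integration.integral_sum face_measure_integrable f g)

lemma face_integral_Cauchy_Schwarz:
  assumes f: "f \<in> faces_h" and c: "continuous_on UNIV J0" "continuous_on UNIV G"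
    and J: "\<And>x. x \<in> f \<Longrightarrow> J x = J0 x" and v: "\<And>x. x \<in> f \<Longrightarrow> norm (v x) \<le> G x"
  shows "\<bar>face_integral f (\<lambda>x. J x \<bullet> v x)\<bar>
    \<le> sqrt (face_integral f (\<lambda>x. (norm (J x))\<^sup>2)) * sqrt (face_integral f (\<lambda>x. (G x)\<^sup>2))"
proof -
  let ?M = "restrict_space (area_measure f) f"
  have sp: "space ?M = f" by (simp add: space_restrict_space area_measure_def)
  note r = face_integral_eq_restrict[OF face_borel[OF f]]
  have "\<bar>integral\<^sup>L ?M (\<lambda>x. J x \<bullet> v x)\<bar> \<le> integral\<^sup>L ?M (\<lambda>x. norm (J0 x) * G x)"
  proof (rule abs_integral_le_dominating)
    show "integrable ?M (\<lambda>x. norm (J0 x) * G x)"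
      by (intro face_measure_integrable f continuous_intros c)
    show "AE x in ?M. \<bar>J x \<bullet> v x\<bar> \<le> norm (J0 x) * G x"
    proof (rule AE_I2)
      fix x assume "x \<in> space ?M"
      then have x: "x \<in> f" by (simp add: sp)
      have "\<bar>J x \<bullet> v x\<bar> \<le> norm (J x) * norm (v x)" by (rule Cauchy_Schwarz_ineq2)
      also have "\<dots> \<le> norm (J0 x) * G x"
        unfolding J[OF x] by (intro mult_left_mono v x) simp
      finally show "\<bar>J x \<bullet> v x\<bar> \<le> norm (J0 x) * G x" .
    qed
  qed
  also have "\<dots> \<le> \<bar>integral\<^sup>L ?M (\<lambda>x. norm (J0 x) * G x)\<bar>" by simp
  also have "\<dots> \<le> sqrt (integral\<^sup>L ?M (\<lambda>x. (norm (J0 x))\<^sup>2)) * sqrt (integral\<^sup>L ?M (\<lambda>x. (G x)\<^sup>2))"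
    by (intro Cauchy_Schwarz_integral face_measurable face_measure_integrable f continuous_intros c)
  finally have "\<bar>face_integral f (\<lambda>x. J x \<bullet> v x)\<bar>
      \<le> sqrt (face_integral f (\<lambda>x. (norm (J0 x))\<^sup>2)) * sqrt (face_integral f (\<lambda>x. (G x)\<^sup>2))"
    by (simp only: r)
  moreover have "face_integral f (\<lambda>x. (norm (J0 x))\<^sup>2) = face_integral f (\<lambda>x. (norm (J x))\<^sup>2)"
    by (rule face_integral_cong) (simp add: J)
  ultimately show ?thesis by simp
qed

text \<open>
  On a face every trace of the piecewise polynomial part is a polynomial field. Continuity of the jumps is what
  makes the face integrals in the norm genuine, rather than zero for lack of integrability.
\<close>

lemma jump_continuous:
  assumes v: "v \<in> V_sum l" and f: "f \<in> faces_h"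
  shows "\<exists>J. continuous_on UNIV J \<and> (\<forall>x\<in>f. jump_h l f v x = J x)"
proof -
  define J where "J = (\<lambda>x. \<Sum>K\<in>adjacent \<T> f. cross3 (outward_normal K f) (piece l (dg_part \<Omega> \<T> l v) K x))"
  note w = dg_part_in_dg_space[OF v]
  have c: "continuous_on UNIV (piece l (dg_part \<Omega> \<T> l v) K)" if "K \<in> \<T>" for K
    by (rule poly_field_continuous[OF dg_space_piece(1)[OF w that]])
  have "continuous_on UNIV J"
    unfolding J_def by (intro continuous_on_sum continuous_on_cross continuous_on_const c adjacent_element)
  moreover have "jump_h l f v x = J x" if "x \<in> f" for x
    unfolding jump_def tangential_jump_def J_def
  proof (rule sum.cong[OF refl])
    fix K assume "K \<in> adjacent \<T> f"
    from adjacent_element[OF this] have K: "K \<in> \<T>" "x \<in> K" using that by auto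
    show "cross3 (outward_normal K f) (field_trace K (dg_part \<Omega> \<T> l v) x) =
        cross3 (outward_normal K f) (piece l (dg_part \<Omega> \<T> l v) K x)"
      using field_trace_eq[OF element_body(1-3)[OF K(1)] K(2) c[OF K(1)] dg_space_piece(2)[OF w K(1)]] by simp
  qed
  ultimately show ?thesis by (intro exI[of _ J]) simp
qed

lemma face_size_pos:
  assumes "f \<in> faces_h"
  shows "0 < face_size \<T> f" "K \<in> adjacent \<T> f \<Longrightarrow> face_size \<T> f \<le> diameter K"
proof -
  have fin: "finite (diameter ` adjacent \<T> f)" using finite_adjacent by simp
  have "diameter ` adjacent \<T> f \<noteq> {}" using face_planar(3)[OF assms] by simp
  then have "face_size \<T> f \<in> diameter ` adjacent \<T> f" unfolding face_size_def by (rule Min_in[OF fin])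
  then show "0 < face_size \<T> f" using diameter_pos adjacent_element(1) by auto
  show "K \<in> adjacent \<T> f \<Longrightarrow> face_size \<T> f \<le> diameter K"
    unfolding face_size_def using fin by simp
qed

lemma dg_flux_dominated:
  assumes Q: "Pi_h l (curl_h v) = Q" "Q \<in> V_h l"
    and m: "0 < m" "AE x in lebesgue_on \<Omega>. m \<le> \<mu> x"
  shows "x \<in> f \<Longrightarrow> norm (dg_flux \<Omega> \<T> l \<mu> f v x) \<le> dg_flux_bound \<T> l m f Q x"
    and "continuous_on UNIV (dg_flux_bound \<T> l m f Q)"
proof -
  have c: "continuous_on UNIV (piece l Q K)" if "K \<in> \<T>" for K
    by (rule poly_field_continuous[OF dg_space_piece(1)[OF Q(2) that]])
  show "continuous_on UNIV (dg_flux_bound \<T> l m f Q)"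
    unfolding dg_flux_bound_def divide_inverse by (intro continuous_intros c adjacent_element(1))
  assume x: "x \<in> f"
  have "norm (\<Sum>K\<in>adjacent \<T> f. field_trace K (\<lambda>x. Q x /\<^sub>R \<mu> x) x)
      \<le> (\<Sum>K\<in>adjacent \<T> f. norm (piece l Q K x) / m)"
  proof (rule sum_norm_le)
    fix K assume "K \<in> adjacent \<T> f"
    from adjacent_element[OF this] have K: "K \<in> \<T>" "x \<in> K" using x by auto
    show "norm (field_trace K (\<lambda>x. Q x /\<^sub>R \<mu> x) x) \<le> norm (piece l Q K x) / m"
      by (rule norm_field_trace_weighted_le[OF element_body(1-3)[OF K(1)] K(2) c[OF K(1)]
          dg_space_piece(2)[OF Q(2) K(1)] m(1) AE_on_element[OF K(1) m(2)]])
  qed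
  then show "norm (dg_flux \<Omega> \<T> l \<mu> f v x) \<le> dg_flux_bound \<T> l m f Q x"
    by (simp add: dg_flux_def average_def dg_flux_bound_def Q(1) divide_inverse mult.commute mult_left_mono)
qed

text \<open>
  The square of an average is at most the sum of the squares, and the size of a face is at most the diameter
  of each adjacent element. After the sums over faces and elements are exchanged, the discrete trace
  inequality applies in every element.
\<close>

lemma sum_flux_bound_le:
  assumes Q: "Q \<in> V_h l" and m: "0 < m"
  shows "(\<Sum>f\<in>faces_h. face_size \<T> f * face_integral f (\<lambda>x. (dg_flux_bound \<T> l m f Q x)\<^sup>2))
    \<le> 48 * 9 ^ l * real (Suc l) ^ 3 * \<bar>\<sigma>\<bar> / m\<^sup>2 * (L2_norm \<Omega> Q)\<^sup>2"
proof -
  define g where "g = (\<lambda>K x. (norm (piece l Q K x))\<^sup>2)"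
  define C where "C = 48 * 9 ^ l * real (Suc l) ^ 3"
  have cQ: "continuous_on UNIV (piece l Q K)" if "K \<in> \<T>" for K
    by (rule poly_field_continuous[OF dg_space_piece(1)[OF Q that]])
  have cg: "continuous_on UNIV (g K)" if "K \<in> \<T>" for K
    unfolding g_def by (intro continuous_intros cQ that)
  have "face_size \<T> f * face_integral f (\<lambda>x. (dg_flux_bound \<T> l m f Q x)\<^sup>2)
      \<le> (\<Sum>K\<in>adjacent \<T> f. diameter K / m\<^sup>2 * face_integral f (g K))" if f: "f \<in> faces_h" for f
  proof -
    have "face_integral f (\<lambda>x. (dg_flux_bound \<T> l m f Q x)\<^sup>2)
        \<le> face_integral f (\<lambda>x. \<Sum>K\<in>adjacent \<T> f. 1 / m\<^sup>2 * g K x)"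
    proof (rule face_integral_mono[OF f])
      show "continuous_on UNIV (\<lambda>x. (dg_flux_bound \<T> l m f Q x)\<^sup>2)"
        unfolding dg_flux_bound_def divide_inverse by (intro continuous_intros cQ adjacent_element(1))
      show "continuous_on UNIV (\<lambda>x. \<Sum>K\<in>adjacent \<T> f. 1 / m\<^sup>2 * g K x)"
        by (intro continuous_intros cg adjacent_element(1))
      fix x
      show "(dg_flux_bound \<T> l m f Q x)\<^sup>2 \<le> (\<Sum>K\<in>adjacent \<T> f. 1 / m\<^sup>2 * g K x)"
        using mean_square_le[OF finite_adjacent face_planar(3)[OF f], of "\<lambda>K. norm (piece l Q K x) / m"]
        by (simp add: dg_flux_bound_def g_def power_divide)
    qed
    also have "\<dots> = (\<Sum>K\<in>adjacent \<T> f. 1 / m\<^sup>2 * face_integral f (g K))"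
    proof (subst face_integral_sum[OF f])
      show "continuous_on UNIV (\<lambda>x. 1 / m\<^sup>2 * g K x)" if "K \<in> adjacent \<T> f" for K
        by (intro continuous_on_mult continuous_on_const cg adjacent_element(1)[OF that])
    qed (simp only: face_integral_cmult)
    finally have "face_size \<T> f * face_integral f (\<lambda>x. (dg_flux_bound \<T> l m f Q x)\<^sup>2)
        \<le> face_size \<T> f * (\<Sum>K\<in>adjacent \<T> f. 1 / m\<^sup>2 * face_integral f (g K))"
      using face_size_pos(1)[OF f] by (intro mult_left_mono) auto
    also have "\<dots> = (\<Sum>K\<in>adjacent \<T> f. face_size \<T> f * (1 / m\<^sup>2 * face_integral f (g K)))"
      by (rule sum_distrib_left)
    also have "\<dots> \<le> (\<Sum>K\<in>adjacent \<T> f. diameter K * (1 / m\<^sup>2 * face_integral f (g K)))"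
      by (intro sum_mono mult_right_mono face_size_pos(2)[OF f] mult_nonneg_nonneg face_integral_nonneg)
        (auto simp: g_def)
    finally show ?thesis by simp
  qed
  then have "(\<Sum>f\<in>faces_h. face_size \<T> f * face_integral f (\<lambda>x. (dg_flux_bound \<T> l m f Q x)\<^sup>2))
      \<le> (\<Sum>f\<in>faces_h. \<Sum>K\<in>adjacent \<T> f. diameter K / m\<^sup>2 * face_integral f (g K))"
    by (rule sum_mono)
  also have "\<dots> = (\<Sum>f\<in>faces_h. \<Sum>K | K \<in> \<T> \<and> f \<subseteq> K. diameter K / m\<^sup>2 * face_integral f (g K))"
    by (simp add: adjacent_def)
  also have "\<dots> = (\<Sum>K\<in>\<T>. \<Sum>f | f \<in> faces_h \<and> f \<subseteq> K. diameter K / m\<^sup>2 * face_integral f (g K))"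
    by (rule sum.swap_restrict[OF finite_faces finite_mesh])
  also have "\<dots> = (\<Sum>K\<in>\<T>. 1 / m\<^sup>2 * (diameter K * (\<Sum>f | f \<in> faces_h \<and> f \<subseteq> K. face_integral f (g K))))"
    by (simp add: sum_distrib_left)
  also have "\<dots> \<le> (\<Sum>K\<in>\<T>. 1 / m\<^sup>2 * (C * \<bar>\<sigma>\<bar> * integral\<^sup>L (lebesgue_on K) (\<lambda>x. (norm (Q x))\<^sup>2)))"
  proof (intro sum_mono mult_left_mono)
    fix K assume K: "K \<in> \<T>"
    have LQ: "L2_field K Q" by (rule L2_field_on_element[OF K dg_space_L2[OF Q]])
    have "integrable (lebesgue_on K) (g K)"
      using L2_field_continuous[OF _ element_body(4)[OF K] cQ[OF K]] element_body(1)[OF K]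
      by (simp add: L2_field_def g_def compact_imp_bounded)
    then have "integral K (g K) = integral\<^sup>L (lebesgue_on K) (g K)"
      using has_integral_integral_lebesgue_on[OF _ element_body(4)[OF K]] by (blast intro: integral_unique)
    also have "\<dots> = integral\<^sup>L (lebesgue_on K) (\<lambda>x. (norm (Q x))\<^sup>2)"
    proof (rule integral_cong_AE)
      show "g K \<in> borel_measurable (lebesgue_on K)"
        using \<open>integrable (lebesgue_on K) (g K)\<close> by (rule borel_measurable_integrable)
      show "(\<lambda>x. (norm (Q x))\<^sup>2) \<in> borel_measurable (lebesgue_on K)"
        using LQ by (auto simp: L2_field_def)
      show "AE x in lebesgue_on K. g K x = (norm (Q x))\<^sup>2"
        using dg_space_piece(2)[OF Q K] by eventually_elim (simp add: g_def)
    qed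
    finally have eq: "integral K (g K) = integral\<^sup>L (lebesgue_on K) (\<lambda>x. (norm (Q x))\<^sup>2)" .
    have "diameter K * (\<Sum>f | f \<in> faces_h \<and> f \<subseteq> K. face_integral f (g K)) \<le> C * \<sigma> * integral K (g K)"
      unfolding g_def C_def by (rule sum_face_integrals_le[OF K dg_space_piece(1)[OF Q K]])
    also have "\<dots> \<le> C * \<bar>\<sigma>\<bar> * integral K (g K)"
      unfolding eq by (intro mult_right_mono mult_left_mono) (auto simp: C_def)
    finally show "diameter K * (\<Sum>f | f \<in> faces_h \<and> f \<subseteq> K. face_integral f (g K))
        \<le> C * \<bar>\<sigma>\<bar> * integral\<^sup>L (lebesgue_on K) (\<lambda>x. (norm (Q x))\<^sup>2)" unfolding eq .
  qed simp
  also have "\<dots> = C * \<bar>\<sigma>\<bar> / m\<^sup>2 * (\<Sum>K\<in>\<T>. integral\<^sup>L (lebesgue_on K) (\<lambda>x. (norm (Q x))\<^sup>2))"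
    by (simp add: sum_distrib_left)
  also have "\<dots> = C * \<bar>\<sigma>\<bar> / m\<^sup>2 * (L2_norm \<Omega> Q)\<^sup>2"
    unfolding L2_norm_square using dg_space_L2[OF Q]
    by (subst sum_integral_elements) (auto simp: L2_field_def)
  finally show ?thesis by (simp add: C_def)
qed

lemma sum_L2_norm_elements:
  assumes "L2_field \<Omega> w"
  shows "(\<Sum>K\<in>\<T>. (L2_norm K w)\<^sup>2) = (L2_norm \<Omega> w)\<^sup>2"
  unfolding L2_norm_square using assms by (intro sum_integral_elements) (simp add: L2_field_def)

lemma dg_norm_components:
  assumes "v \<in> V_sum l"
  shows "L2_norm \<Omega> v \<le> norm_h l \<eta> v"
    and "sqrt (\<Sum>K\<in>\<T>. (L2_norm K (curl_h v))\<^sup>2) \<le> norm_h l \<eta> v"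
    and "sqrt (\<Sum>f\<in>faces_h. (face_norm f (\<lambda>x. sqrt (penalty \<T> \<eta> f) *\<^sub>R jump_h l f v x))\<^sup>2)
      \<le> norm_h l \<eta> v"
    and "L2_norm \<Omega> (curl_h v) \<le> norm_h l \<eta> v"
proof -
  define a where "a = (\<Sum>K\<in>\<T>. (L2_norm K (curl_h v))\<^sup>2)"
  define b where "b = (\<Sum>f\<in>faces_h. (face_norm f (\<lambda>x. sqrt (penalty \<T> \<eta> f) *\<^sub>R jump_h l f v x))\<^sup>2)"
  have ab: "0 \<le> a" "0 \<le> b" by (auto simp: a_def b_def intro!: sum_nonneg)
  have n: "norm_h l \<eta> v = sqrt ((L2_norm \<Omega> v)\<^sup>2 + (a + b))"
    using ab by (simp add: dg_norm_def dg_seminorm_def a_def b_def)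
  have "sqrt ((L2_norm \<Omega> v)\<^sup>2) \<le> norm_h l \<eta> v" unfolding n using ab by (intro real_sqrt_le_mono) simp
  then show "L2_norm \<Omega> v \<le> norm_h l \<eta> v" using L2_norm_nonneg[of \<Omega> v] by simp
  show a: "sqrt a \<le> norm_h l \<eta> v" unfolding n using ab by (intro real_sqrt_le_mono) simp
  show "sqrt b \<le> norm_h l \<eta> v" unfolding n using ab by (intro real_sqrt_le_mono) simp
  have "a = (L2_norm \<Omega> (curl_h v))\<^sup>2"
    unfolding a_def by (rule sum_L2_norm_elements[OF elementwise_curl_L2[OF assms]])
  then show "L2_norm \<Omega> (curl_h v) \<le> norm_h l \<eta> v"
    using a L2_norm_nonneg[of \<Omega> "curl_h v"] by simp
qed

lemma penalty_pos: "0 < \<eta> \<Longrightarrow> f \<in> faces_h \<Longrightarrow> 0 < penalty \<T> \<eta> f"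
  using face_size_pos(1) by (simp add: penalty_def)

lemma curl_term_le:
  assumes E: "E \<in> V_sum l" and v: "v \<in> V_sum l"
    and m: "0 < m" "AE x in lebesgue_on \<Omega>. m \<le> \<mu> x"
  shows "\<bar>\<Sum>K\<in>\<T>. integral\<^sup>L (lebesgue_on K)
          (\<lambda>x. inverse (\<mu> x) * (curl_h E x \<bullet> curl_h v x))\<bar>
    \<le> 1 / m * (norm_h l \<eta> E * norm_h l \<eta> v)"
proof -
  let ?c = "curl_h"
  have "\<bar>\<Sum>K\<in>\<T>. integral\<^sup>L (lebesgue_on K) (\<lambda>x. inverse (\<mu> x) * (?c E x \<bullet> ?c v x))\<bar>
      \<le> (\<Sum>K\<in>\<T>. 1 / m * (L2_norm K (?c E) * L2_norm K (?c v)))"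
  proof (rule order_trans[OF sum_abs sum_mono])
    fix K assume K: "K \<in> \<T>"
    have "AE x in lebesgue_on K. \<bar>inverse (\<mu> x)\<bar> \<le> 1 / m"
      using AE_on_element[OF K m(2)]
      by eventually_elim (use m(1) in \<open>auto simp: inverse_eq_divide intro!: divide_left_mono\<close>)
    then show "\<bar>integral\<^sup>L (lebesgue_on K) (\<lambda>x. inverse (\<mu> x) * (?c E x \<bullet> ?c v x))\<bar>
        \<le> 1 / m * (L2_norm K (?c E) * L2_norm K (?c v))"
      using m(1) by (intro abs_integral_weighted_inner_le L2_field_on_element[OF K] elementwise_curl_L2[OF E]
          elementwise_curl_L2[OF v]) auto
  qed
  also have "\<dots> = 1 / m * (\<Sum>K\<in>\<T>. \<bar>L2_norm K (?c E)\<bar> * \<bar>L2_norm K (?c v)\<bar>)"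
    by (simp add: sum_distrib_left L2_norm_nonneg)
  also have "\<dots> \<le> 1 / m * (sqrt (\<Sum>K\<in>\<T>. (L2_norm K (?c E))\<^sup>2) * sqrt (\<Sum>K\<in>\<T>. (L2_norm K (?c v))\<^sup>2))"
    using m(1) by (intro mult_left_mono sum_mult_le_sqrt) auto
  also have "\<dots> \<le> 1 / m * (norm_h l \<eta> E * norm_h l \<eta> v)"
    using m(1) by (intro mult_left_mono mult_mono dg_norm_components(2)[OF E] dg_norm_components(2)[OF v])
      (auto simp: dg_norm_def intro!: sum_nonneg)
  finally show ?thesis .
qed

text \<open>
  The penalty \<open>\<alpha>\<close> is split as \<open>\<alpha>\<^sup>1\<^sup>/\<^sup>2 \<alpha>\<^sup>-\<^sup>1\<^sup>/\<^sup>2\<close>, and the Cauchy-Schwarz inequality is applied on each face and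
  then to the sum over the faces. As \<open>\<alpha>\<^sup>-\<^sup>1\<close> is the face size divided by \<open>\<eta>\<close>, the second factor is bounded by
  \<open>sum_flux_bound_le\<close>.
\<close>

lemma flux_term_le:
  assumes E: "E \<in> V_sum l" and v: "v \<in> V_sum l"
    and m: "0 < m" "AE x in lebesgue_on \<Omega>. m \<le> \<mu> x" and \<eta>: "0 < \<eta>"
  shows "\<bar>\<Sum>f\<in>faces_h. face_integral f (\<lambda>x. jump_h l f E x \<bullet> dg_flux \<Omega> \<T> l \<mu> f v x)\<bar>
    \<le> sqrt (48 * 9 ^ l * real (Suc l) ^ 3 * \<bar>\<sigma>\<bar> / (\<eta> * m\<^sup>2)) * (norm_h l \<eta> E * norm_h l \<eta> v)"
proof -
  define Q where "Q = Pi_h l (curl_h v)"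
  define C where "C = 48 * 9 ^ l * real (Suc l) ^ 3 * \<bar>\<sigma>\<bar>"
  define G where "G = (\<lambda>f. dg_flux_bound \<T> l m f Q)"
  define a where "a = (\<lambda>f. face_norm f (\<lambda>x. sqrt (penalty \<T> \<eta> f) *\<^sub>R jump_h l f E x))"
  define t where "t = (\<lambda>f. sqrt (face_integral f (\<lambda>x. (G f x)\<^sup>2) / penalty \<T> \<eta> f))"
  have Lc: "L2_field \<Omega> (curl_h v)" by (rule elementwise_curl_L2[OF v])
  have Q: "Q \<in> V_h l" unfolding Q_def by (rule L2_projection_orthogonal(1)[OF Lc])
  have G0: "0 \<le> face_integral f (\<lambda>x. (G f x)\<^sup>2)" for f by (rule face_integral_nonneg) simp
  have "\<bar>face_integral f (\<lambda>x. jump_h l f E x \<bullet> dg_flux \<Omega> \<T> l \<mu> f v x)\<bar> \<le> \<bar>a f\<bar> * \<bar>t f\<bar>"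
    if f: "f \<in> faces_h" for f
  proof -
    note p = penalty_pos[OF \<eta> f]
    obtain J where J: "continuous_on UNIV J" "\<forall>x\<in>f. jump_h l f E x = J x"
      using jump_continuous[OF E f] by (elim exE conjE)
    have "\<bar>face_integral f (\<lambda>x. jump_h l f E x \<bullet> dg_flux \<Omega> \<T> l \<mu> f v x)\<bar>
        \<le> sqrt (face_integral f (\<lambda>x. (norm (jump_h l f E x))\<^sup>2)) * sqrt (face_integral f (\<lambda>x. (G f x)\<^sup>2))"
      unfolding G_def
      by (rule face_integral_Cauchy_Schwarz[OF f J(1) dg_flux_dominated(2)[OF Q_def[symmetric] Q m] bspec[OF J(2)]
          dg_flux_dominated(1)[OF Q_def[symmetric] Q m]])
    also have "\<dots> = a f * t f"
    proof -
      have "a f = sqrt ((a f)\<^sup>2)"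
        by (simp add: a_def face_norm_def face_integral_nonneg)
      also have "\<dots> = sqrt (penalty \<T> \<eta> f) * sqrt (face_integral f (\<lambda>x. (norm (jump_h l f E x))\<^sup>2))"
        unfolding a_def using p by (simp add: face_norm_scaled_square real_sqrt_mult)
      finally show ?thesis using p by (simp add: t_def real_sqrt_divide)
    qed
    also have "\<dots> \<le> \<bar>a f\<bar> * \<bar>t f\<bar>" by (metis abs_ge_self abs_mult)
    finally show ?thesis .
  qed
  then have "\<bar>\<Sum>f\<in>faces_h. face_integral f (\<lambda>x. jump_h l f E x \<bullet> dg_flux \<Omega> \<T> l \<mu> f v x)\<bar>
      \<le> (\<Sum>f\<in>faces_h. \<bar>a f\<bar> * \<bar>t f\<bar>)"
    by (intro order_trans[OF sum_abs sum_mono])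
  also have "\<dots> \<le> sqrt (\<Sum>f\<in>faces_h. (a f)\<^sup>2) * sqrt (\<Sum>f\<in>faces_h. (t f)\<^sup>2)"
    by (rule sum_mult_le_sqrt)
  also have "\<dots> \<le> norm_h l \<eta> E * (sqrt (C / (\<eta> * m\<^sup>2)) * norm_h l \<eta> v)"
  proof (intro mult_mono)
    show "sqrt (\<Sum>f\<in>faces_h. (a f)\<^sup>2) \<le> norm_h l \<eta> E"
      unfolding a_def by (rule dg_norm_components(3)[OF E])
    have "(\<Sum>f\<in>faces_h. (t f)\<^sup>2) = (\<Sum>f\<in>faces_h. 1 / \<eta> * (face_size \<T> f * face_integral f (\<lambda>x. (G f x)\<^sup>2)))"
    proof (rule sum.cong[OF refl])
      fix f assume f: "f \<in> faces_h"
      show "(t f)\<^sup>2 = 1 / \<eta> * (face_size \<T> f * face_integral f (\<lambda>x. (G f x)\<^sup>2))"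
        using G0[of f] penalty_pos[OF \<eta> f] by (simp add: t_def) (simp add: penalty_def)
    qed
    also have "\<dots> = 1 / \<eta> * (\<Sum>f\<in>faces_h. face_size \<T> f * face_integral f (\<lambda>x. (G f x)\<^sup>2))"
      by (rule sum_distrib_left[symmetric])
    also have "\<dots> \<le> 1 / \<eta> * (C / m\<^sup>2 * (L2_norm \<Omega> Q)\<^sup>2)"
      using sum_flux_bound_le[OF Q m(1)] \<eta> unfolding G_def C_def by (intro mult_left_mono) auto
    also have "\<dots> \<le> 1 / \<eta> * (C / m\<^sup>2 * (norm_h l \<eta> v)\<^sup>2)"
    proof -
      have "L2_norm \<Omega> Q \<le> norm_h l \<eta> v"
        using L2_projection_contraction[OF Lc] dg_norm_components(4)[OF v] unfolding Q_def by (rule order_trans)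
      then show ?thesis using \<eta>
        by (intro mult_left_mono power_mono L2_norm_nonneg) (auto simp: C_def)
    qed
    finally have "(\<Sum>f\<in>faces_h. (t f)\<^sup>2) \<le> C / (\<eta> * m\<^sup>2) * (norm_h l \<eta> v)\<^sup>2" by (simp add: mult.commute)
    then have "sqrt (\<Sum>f\<in>faces_h. (t f)\<^sup>2) \<le> sqrt (C / (\<eta> * m\<^sup>2) * (norm_h l \<eta> v)\<^sup>2)"
      by (rule real_sqrt_le_mono)
    also have "\<dots> = sqrt (C / (\<eta> * m\<^sup>2)) * norm_h l \<eta> v"
      by (simp only: real_sqrt_mult real_sqrt_abs) (simp add: dg_norm_def)
    finally show "sqrt (\<Sum>f\<in>faces_h. (t f)\<^sup>2) \<le> sqrt (C / (\<eta> * m\<^sup>2)) * norm_h l \<eta> v" .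
  qed (auto simp: dg_norm_def intro!: sum_nonneg)
  finally show ?thesis by (simp add: C_def mult_ac)
qed

lemma penalty_term_le:
  assumes E: "E \<in> V_sum l" and v: "v \<in> V_sum l" and \<eta>: "0 < \<eta>"
  shows "\<bar>\<Sum>f\<in>faces_h. face_integral f
          (\<lambda>x. penalty \<T> \<eta> f * (jump_h l f E x \<bullet> jump_h l f v x))\<bar>
    \<le> norm_h l \<eta> E * norm_h l \<eta> v"
proof -
  define a where "a = (\<lambda>u f. face_norm f (\<lambda>x. sqrt (penalty \<T> \<eta> f) *\<^sub>R jump_h l f u x))"
  have "\<bar>face_integral f (\<lambda>x. penalty \<T> \<eta> f * (jump_h l f E x \<bullet> jump_h l f v x))\<bar>
      \<le> \<bar>a E f\<bar> * \<bar>a v f\<bar>" if f: "f \<in> faces_h" for f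
  proof -
    define p where "p = penalty \<T> \<eta> f"
    define I where "I = (\<lambda>u. sqrt (face_integral f (\<lambda>x. (norm (jump_h l f u x))\<^sup>2)))"
    have p: "0 < p" using penalty_pos[OF \<eta> f] by (simp add: p_def)
    obtain J where J: "continuous_on UNIV J" "\<forall>x\<in>f. jump_h l f E x = J x"
      using jump_continuous[OF E f] by (elim exE conjE)
    obtain J' where J': "continuous_on UNIV J'" "\<forall>x\<in>f. jump_h l f v x = J' x"
      using jump_continuous[OF v f] by (elim exE conjE)
    have "\<bar>face_integral f (\<lambda>x. jump_h l f E x \<bullet> jump_h l f v x)\<bar>
        \<le> I E * sqrt (face_integral f (\<lambda>x. (norm (J' x))\<^sup>2))"
      unfolding I_def using J(2) J'(2)
      by (intro face_integral_Cauchy_Schwarz[OF f J(1)] continuous_on_norm J'(1)) auto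
    also have "face_integral f (\<lambda>x. (norm (J' x))\<^sup>2) = face_integral f (\<lambda>x. (norm (jump_h l f v x))\<^sup>2)"
      by (rule face_integral_cong) (simp add: J')
    finally have cs: "\<bar>face_integral f (\<lambda>x. jump_h l f E x \<bullet> jump_h l f v x)\<bar> \<le> I E * I v"
      by (simp only: I_def)
    have a: "\<bar>a u f\<bar> = sqrt p * I u" for u
    proof -
      have sq: "(a u f)\<^sup>2 = p * face_integral f (\<lambda>x. (norm (jump_h l f u x))\<^sup>2)"
        unfolding a_def p_def by (rule face_norm_scaled_square) (use p in \<open>simp add: p_def\<close>)
      have "\<bar>a u f\<bar> = sqrt ((a u f)\<^sup>2)" by simp
      also have "\<dots> = sqrt p * I u" by (simp only: sq I_def real_sqrt_mult)
      finally show ?thesis .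
    qed
    have "\<bar>face_integral f (\<lambda>x. p * (jump_h l f E x \<bullet> jump_h l f v x))\<bar>
        = p * \<bar>face_integral f (\<lambda>x. jump_h l f E x \<bullet> jump_h l f v x)\<bar>"
      using p by (simp add: face_integral_cmult abs_mult)
    also have "\<dots> \<le> p * (I E * I v)" using p cs by (intro mult_left_mono) auto
    also have "\<dots> = (sqrt p * sqrt p) * (I E * I v)" using p by simp
    also have "\<dots> = \<bar>a E f\<bar> * \<bar>a v f\<bar>" unfolding a by (simp only: mult_ac)
    finally show ?thesis unfolding p_def .
  qed
  then have "\<bar>\<Sum>f\<in>faces_h. face_integral f
        (\<lambda>x. penalty \<T> \<eta> f * (jump_h l f E x \<bullet> jump_h l f v x))\<bar>
      \<le> (\<Sum>f\<in>faces_h. \<bar>a E f\<bar> * \<bar>a v f\<bar>)"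
    by (intro order_trans[OF sum_abs sum_mono])
  also have "\<dots> \<le> sqrt (\<Sum>f\<in>faces_h. (a E f)\<^sup>2) * sqrt (\<Sum>f\<in>faces_h. (a v f)\<^sup>2)"
    by (rule sum_mult_le_sqrt)
  also have "\<dots> \<le> norm_h l \<eta> E * norm_h l \<eta> v"
    unfolding a_def by (intro mult_mono dg_norm_components(3)[OF E] dg_norm_components(3)[OF v])
      (auto simp: dg_norm_def intro!: sum_nonneg)
  finally show ?thesis .
qed

lemma mass_term_le:
  assumes E: "E \<in> V_sum l" and v: "v \<in> V_sum l"
    and e: "AE x in lebesgue_on \<Omega>. \<bar>\<epsilon> x\<bar> \<le> M" "0 \<le> M"
  shows "\<bar>integral\<^sup>L (lebesgue_on \<Omega>) (\<lambda>x. \<epsilon> x * (E x \<bullet> v x))\<bar>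
    \<le> M * (norm_h l \<eta> E * norm_h l \<eta> v)"
proof -
  have "\<bar>integral\<^sup>L (lebesgue_on \<Omega>) (\<lambda>x. \<epsilon> x * (E x \<bullet> v x))\<bar> \<le> M * (L2_norm \<Omega> E * L2_norm \<Omega> v)"
    by (rule abs_integral_weighted_inner_le[OF sum_space_L2[OF E] sum_space_L2[OF v] e])
  also have "\<dots> \<le> M * (norm_h l \<eta> E * norm_h l \<eta> v)"
    by (intro mult_left_mono mult_mono dg_norm_components(1)[OF E] dg_norm_components(1)[OF v] e(2) L2_norm_nonneg)
      (simp add: dg_norm_def)
  finally show ?thesis .
qed

lemma dg_form_bounded:
  assumes E: "E \<in> V_sum l" and v: "v \<in> V_sum l"
    and e: "AE x in lebesgue_on \<Omega>. \<bar>\<epsilon> x\<bar> \<le> M" "0 \<le> M"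
    and m: "0 < m" "AE x in lebesgue_on \<Omega>. m \<le> \<mu> x" and \<eta>: "0 < \<eta>"
  shows "\<bar>dg_form \<Omega> \<T> l \<eta> \<epsilon> \<mu> E v\<bar>
    \<le> (M + 1 / m + 2 * sqrt (48 * 9 ^ l * real (Suc l) ^ 3 * \<bar>\<sigma>\<bar> / (\<eta> * m\<^sup>2)) + 1)
      * norm_h l \<eta> E * norm_h l \<eta> v"
proof -
  define N where "N = norm_h l \<eta> E * norm_h l \<eta> v"
  define T where "T = sqrt (48 * 9 ^ l * real (Suc l) ^ 3 * \<bar>\<sigma>\<bar> / (\<eta> * m\<^sup>2))"
  have tri: "\<bar>a + b - c - d + e\<bar> \<le> \<bar>a\<bar> + \<bar>b\<bar> + \<bar>c\<bar> + \<bar>d\<bar> + \<bar>e\<bar>" for a b c d e :: real by linarith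
  have "\<bar>dg_form \<Omega> \<T> l \<eta> \<epsilon> \<mu> E v\<bar> \<le> M * N + 1 / m * N + T * N + T * N + N"
    unfolding dg_form_def
    by (rule order_trans[OF tri]) (use mass_term_le[OF E v e] curl_term_le[OF E v m]
      flux_term_le[OF E v m \<eta>] flux_term_le[OF v E m \<eta>] penalty_term_le[OF E v \<eta>] in
      \<open>intro add_mono; simp add: N_def T_def mult.commute\<close>)
  also have "\<dots> = (M + 1 / m + 2 * T + 1) * N" by (simp add: algebra_simps)
  finally show ?thesis by (simp add: N_def T_def mult.assoc)
qed

end

theorem lemma1:
  fixes \<Omega> :: "(real^3) set" and \<epsilon> \<mu> :: "real^3 \<Rightarrow> real"
    and \<epsilon>0 \<epsilon>1 \<mu>0 \<mu>1 \<eta> \<sigma> :: real and l :: nat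
  assumes "lipschitz_domain \<Omega>"
    and "bounded_coefficient \<Omega> \<epsilon> \<epsilon>0 \<epsilon>1"
    and "bounded_coefficient \<Omega> \<mu> \<mu>0 \<mu>1"
    and "1 \<le> l"
    and "0 < \<eta>"
  shows "\<exists>C_b>0. \<forall>\<T>. shape_regular_partition \<sigma> \<Omega> \<T> \<longrightarrow>
    (\<forall>E\<in>sum_space \<Omega> \<T> l. \<forall>v\<in>sum_space \<Omega> \<T> l.
      \<bar>dg_form \<Omega> \<T> l \<eta> \<epsilon> \<mu> E v\<bar> \<le> C_b * dg_norm \<Omega> \<T> l \<eta> E * dg_norm \<Omega> \<T> l \<eta> v)"
proof (intro exI conjI allI impI ballI)
  let ?C = "\<bar>\<epsilon>1\<bar> + 1 / \<mu>0 + 2 * sqrt (48 * 9 ^ l * real (Suc l) ^ 3 * \<bar>\<sigma>\<bar> / (\<eta> * \<mu>0\<^sup>2)) + 1"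
  have \<mu>: "0 < \<mu>0" "AE x in lebesgue_on \<Omega>. \<mu>0 \<le> \<mu> x"
    using assms(3) by (auto simp: bounded_coefficient_def)
  have "0 < \<epsilon>0" "AE x in lebesgue_on \<Omega>. \<epsilon>0 \<le> \<epsilon> x \<and> \<epsilon> x \<le> \<epsilon>1"
    using assms(2) by (simp_all add: bounded_coefficient_def)
  then have \<epsilon>: "AE x in lebesgue_on \<Omega>. \<bar>\<epsilon> x\<bar> \<le> \<bar>\<epsilon>1\<bar>"
    by (elim eventually_mono) auto
  have "0 \<le> sqrt (48 * 9 ^ l * real (Suc l) ^ 3 * \<bar>\<sigma>\<bar> / (\<eta> * \<mu>0\<^sup>2))" using assms(5) by simp
  then show "0 < ?C" using \<mu>(1) by (intro add_nonneg_pos add_nonneg_nonneg) auto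
  fix \<T> E v
  assume "shape_regular_partition \<sigma> \<Omega> \<T>" and E: "E \<in> sum_space \<Omega> \<T> l" and v: "v \<in> sum_space \<Omega> \<T> l"
  then interpret mesh \<sigma> \<Omega> \<T> using assms(1) by unfold_locales
  show "\<bar>dg_form \<Omega> \<T> l \<eta> \<epsilon> \<mu> E v\<bar> \<le> ?C * dg_norm \<Omega> \<T> l \<eta> E * dg_norm \<Omega> \<T> l \<eta> v"
    by (rule dg_form_bounded[OF E v \<epsilon> abs_ge_zero \<mu> assms(5)])
qed

end
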